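(* Let $\psi:\mathbb{R}\to[0,\infty)$ be a function with $\psi(0)=1\ge\psi(x)$ for all $x\neq 0$, with support contained in $[-1,1]$, of bounded variation, and Hölder continuous with Hölder constant one (i.e. there is $\beta_0\in(0,1]$ with $|\psi(x)-\psi(y)|\le|x-y|^{\beta_0}$ for all $x,y\in\mathbb{R}$). Then there exists a constant $K_\psi>0$ such that $\Lambda_n(t,h)^2\ge 1/n$ for all $n\in\mathbb{N}$ and all $(t,h)\in\mathcal{T}_n(K_\psi)$. Moreover, for every constant $c>0$, the family of random variables $$\left(\sup_{(t,h)\in\mathcal{T}_n(K_\psi)}\Big(\big|\hat\Psi^{\hat c_n}_{n,t,h}(\mathbf{Z}_n)\big|-G_n\big(2\log(1/\Lambda_n(t,h)),\Lambda_n(t,h)\big)\Big)\right)_{n\in\mathbb{N},\ \mathcal{T}_n(K_\psi)\neq\emptyset}$$ is tight under $\mathbb{P}_c$, where $$G_n(\eta,\delta)=\sqrt{2\eta}+\frac{2\eta}{\max\{1,\sqrt n\,\delta\}}.$$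
   Context: Model: for a measurable $\sigma:[0,1]\to(0,\infty)$ (square integrable), under $\mathbb{P}_\sigma$ the process $Z=(Z_t)_{t\in[0,1]}$ is given by $dZ_t=\sigma(t)\,dW_t$, $Z_0=z_0\in\mathbb{R}$ fixed, with $W$ a standard Brownian motion. The observations are $\mathbf{Z}_n=(Z_0,Z_{1/n},\dots,Z_{(n-1)/n},Z_1)$; thus under $\mathbb{P}_\sigma$ the increments $Z_{k/n}-Z_{(k-1)/n}$, $k=1,\dots,n$, are independent with law $\mathcal{N}\big(0,\int_{(k-1)/n}^{k/n}\sigma(s)^2ds\big)$. For a constant $c>0$, $\mathbb{P}_c$ denotes $\mathbb{P}_\sigma$ with $\sigma\equiv c$. For a kernel $\psi$, $h>0$ and $t\in\mathbb{R}$ put $$\psi_{t,h}(s)=\psi\Big(\frac{s-t}{h}\Big),\quad \lambda_k(t,h)=\sqrt n\int_{(k-1)/n}^{k/n}\psi_{t,h}(s)\,ds,\quad \Lambda_n(t,h)=\Big(\sum_{k=1}^n\lambda_k(t,h)^2\Big)^{1/2}.$$ For $K>0$ let $\mathcal{T}_n(K)=\{(t,h)\in\mathbb{R}^2: h\in[K/n,1/2),\ t\in[h,1-h]\}$. For $c>0$ define $$\hat\Psi^c_{n,t,h}(\mathbf{Z}_n)=\frac{\frac1{\sqrt2}\sum_{k=1}^n\lambda_k(t,h)\big(n(Z_{k/n}-Z_{(k-1)/n})^2-c^2\big)}{c^2\Lambda_n(t,h)},$$ and $\hat\Psi^{\hat c_n}_{n,t,h}(\mathbf{Z}_n)$ denotes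 the same expression with $c^2$ replaced by $\hat c_n^2=\sum_{k=1}^n(Z_{k/n}-Z_{(k-1)/n})^2$. A family $(X_n)$ of real random variables is tight if for every $\epsilon>0$ there is $M$ with $\sup_n\mathbb{P}(|X_n|>M)\le\epsilon$. *)

theory Defs
  imports "HOL-Probability.Probability"
begin

text \<open>Standard Brownian motion on the time interval \<open>[0,1]\<close>; the values at times outside
  \<open>[0,1]\<close> are irrelevant.\<close>

locale standard_brownian_motion = prob_space M
  for M :: "'a measure" and W :: "real \<Rightarrow> 'a \<Rightarrow> real" +
  assumes measurable_W: "\<And>t. t \<in> {0..1} \<Longrightarrow> W t \<in> borel_measurable M"
    and start_zero: "AE \<omega> in M. W 0 \<omega> = 0"
    and indep_increments:
      "\<And>(m::nat) (\<tau>::nat \<Rightarrow> real).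
         \<lbrakk>\<And>i. i \<le> m \<Longrightarrow> \<tau> i \<in> {0..1}; \<And>i. i < m \<Longrightarrow> \<tau> i \<le> \<tau> (Suc i)\<rbrakk> \<Longrightarrow>
         indep_vars (\<lambda>_. borel) (\<lambda>i \<omega>. W (\<tau> (Suc i)) \<omega> - W (\<tau> i) \<omega>) {..<m}"
    and normal_increments:
      "\<And>s t. \<lbrakk>0 \<le> s; s < t; t \<le> 1\<rbrakk> \<Longrightarrow>
         distributed M lborel (\<lambda>\<omega>. W t \<omega> - W s \<omega>) (normal_density 0 (sqrt (t - s)))"
    and continuous_paths: "AE \<omega> in M. continuous_on {0..1} (\<lambda>t. W t \<omega>)"

text \<open>\<open>Z\<close> is a version of the process under \<open>P\<^sub>c\<close> started in \<open>z0\<close>, i.e. of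
  \<open>dZ = \<sigma> dW\<close> with \<open>\<sigma> = c\<close> constant, for which the stochastic integral is \<open>c W\<close>.\<close>

definition constant_volatility_process ::
  "'a measure \<Rightarrow> real \<Rightarrow> real \<Rightarrow> (real \<Rightarrow> 'a \<Rightarrow> real) \<Rightarrow> bool" where
  "constant_volatility_process M c z0 Z \<longleftrightarrow>
     (\<exists>W. standard_brownian_motion M W \<and>
          (\<forall>t\<in>{0..1}. \<forall>\<omega>\<in>space M. Z t \<omega> = z0 + c * W t \<omega>))"

text \<open>The vector of the values of \<open>Z\<close> at times \<open>k/n\<close>, indexed by \<open>k = 0, \<dots>, n\<close>.\<close>

definition observations :: "(real \<Rightarrow> 'a \<Rightarrow> real) \<Rightarrow> nat \<Rightarrow> 'a \<Rightarrow> nat \<Rightarrow> real" where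
  "observations Z n \<omega> k = Z (real k / real n) \<omega>"

definition bounded_variation :: "(real \<Rightarrow> real) \<Rightarrow> bool" where
  "bounded_variation f \<longleftrightarrow>
     (\<exists>V. \<forall>(m::nat) x. (\<forall>i<m. x i \<le> x (Suc i)) \<longrightarrow> (\<Sum>i<m. \<bar>f (x (Suc i)) - f (x i)\<bar>) \<le> V)"

text \<open>The constant is one; the exponent is some \<open>\<beta>\<close> in \<open>(0,1]\<close>.\<close>

definition hoelder_constant_one :: "(real \<Rightarrow> real) \<Rightarrow> bool" where
  "hoelder_constant_one f \<longleftrightarrow>
     (\<exists>\<beta>. 0 < \<beta> \<and> \<beta> \<le> 1 \<and> (\<forall>x y. \<bar>f x - f y\<bar> \<le> \<bar>x - y\<bar> powr \<beta>))"

definition scaled_kernel :: "(real \<Rightarrow> real) \<Rightarrow> real \<Rightarrow> real \<Rightarrow> real \<Rightarrow> real" where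
  "scaled_kernel \<psi> t h s = \<psi> ((s - t) / h)"

definition lam :: "(real \<Rightarrow> real) \<Rightarrow> nat \<Rightarrow> real \<Rightarrow> real \<Rightarrow> nat \<Rightarrow> real" where
  "lam \<psi> n t h k =
     sqrt (real n) * (LBINT s:{(real k - 1) / real n..real k / real n}. scaled_kernel \<psi> t h s)"

definition Lam :: "(real \<Rightarrow> real) \<Rightarrow> nat \<Rightarrow> real \<Rightarrow> real \<Rightarrow> real" where
  "Lam \<psi> n t h = sqrt (\<Sum>k=1..n. (lam \<psi> n t h k)\<^sup>2)"

definition loc_scales :: "nat \<Rightarrow> real \<Rightarrow> (real \<times> real) set" where
  "loc_scales n K = {(t, h). K / real n \<le> h \<and> h < 1 / 2 \<and> h \<le> t \<and> t \<le> 1 - h}"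

text \<open>The local statistic as a function of the observation vector \<open>z\<close>; the parameter \<open>v\<close> stands
  for \<open>c\<^sup>2\<close>, so that the squared volatility may be replaced by its estimator.\<close>

definition Psi_hat ::
  "(real \<Rightarrow> real) \<Rightarrow> nat \<Rightarrow> real \<Rightarrow> real \<Rightarrow> real \<Rightarrow> (nat \<Rightarrow> real) \<Rightarrow> real" where
  "Psi_hat \<psi> n t h v z =
     (1 / sqrt 2 * (\<Sum>k=1..n. lam \<psi> n t h k * (real n * (z k - z (k - 1))\<^sup>2 - v)))
     / (v * Lam \<psi> n t h)"

definition c_hat_sq :: "nat \<Rightarrow> (nat \<Rightarrow> real) \<Rightarrow> real" where
  "c_hat_sq n z = (\<Sum>k=1..n. (z k - z (k - 1))\<^sup>2)"

definition G :: "nat \<Rightarrow> real \<Rightarrow> real \<Rightarrow> real" where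
  "G n \<eta> \<delta> = sqrt (2 * \<eta>) + 2 * \<eta> / max 1 (sqrt (real n) * \<delta>)"

text \<open>The supremum is taken in the extended reals, so that it is the genuine supremum without a
  prior proof that the set is bounded above.\<close>

definition calibrated_sup ::
  "(real \<Rightarrow> real) \<Rightarrow> real \<Rightarrow> nat \<Rightarrow> (nat \<Rightarrow> real) \<Rightarrow> ereal" where
  "calibrated_sup \<psi> K n z =
     (SUP (t, h)\<in>loc_scales n K.
        ereal (\<bar>Psi_hat \<psi> n t h (c_hat_sq n z) z\<bar> - G n (2 * ln (1 / Lam \<psi> n t h)) (Lam \<psi> n t h)))"

text \<open>Measurability is part of the definition, since \<open>measure\<close> vanishes on non-measurable sets.
  Extended real values are allowed; a value \<open>\<plusminus>\<infinity>\<close> counts as exceeding every bound \<open>C\<close>.\<close>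

definition tight_family :: "'a measure \<Rightarrow> 'i set \<Rightarrow> ('i \<Rightarrow> 'a \<Rightarrow> ereal) \<Rightarrow> bool" where
  "tight_family M I X \<longleftrightarrow>
     (\<forall>i\<in>I. X i \<in> borel_measurable M) \<and>
     (\<forall>\<epsilon>>0. \<exists>C::real. \<forall>i\<in>I. measure M {\<omega>\<in>space M. \<bar>X i \<omega>\<bar> > ereal C} \<le> \<epsilon>)"

end

theory Submission
  imports Defs
begin

text \<open>
  Under constant volatility \<open>c\<close> the variables \<open>\<xi>\<^sub>k = \<surd>n (Z\<^bsub>k/n\<^esub> - Z\<^bsub>(k-1)/n\<^esub>) / c\<close> are independent standard
  normal. Put \<open>y\<^sub>k = \<xi>\<^sub>k\<^sup>2 - 1\<close>, let \<open>S\<close> be the mean of the \<open>\<xi>\<^sub>k\<^sup>2\<close>, and let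
  \<open>T(t,h) = (\<Sum>\<^sub>k \<lambda>\<^sub>k y\<^sub>k) / (\<surd>2 \<Lambda>)\<close> be the statistic for known volatility (\<open>lin_stat\<close>). The statistic
  with estimated volatility is \<open>T / S - (S - 1) (\<Sum>\<^sub>k \<lambda>\<^sub>k) / (\<surd>2 \<Lambda> S)\<close>. Since \<open>S - 1\<close> has the order
  \<open>1/\<surd>n\<close>, while \<open>\<Sum>\<^sub>k \<lambda>\<^sub>k \<le> \<surd>n \<Lambda>\<close> and the calibration term is at most \<open>6 \<surd>n\<close>, replacing \<open>c\<close> by its
  estimator changes the statistic by a bounded amount (\<open>Psi_hat_le\<close>), and the task is to bound
  \<open>\<bar>T\<bar> - G\<close> from above simultaneously in \<open>(t,h)\<close>.

  For a single \<open>(t,h)\<close> the exponential inequality for centred chi-square sums shows that \<open>\<bar>T\<bar>\<close>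
  exceeds \<open>G + 2m + 6m\<^sup>2\<close> with probability at most \<open>2 \<Lambda>\<^sup>2 exp (- m\<^sup>2 - 2m \<surd>\<eta>)\<close>, where
  \<open>\<eta> = 2 ln (1/\<Lambda>)\<close> (\<open>exceedance_prob\<close>). This is what the calibration is made for: as \<open>\<Lambda>\<^sup>2 \<le> 2h\<close>, the
  factor \<open>\<Lambda>\<^sup>2\<close> compensates for the roughly \<open>1/h\<close> essentially different locations at scale \<open>h\<close>. At
  \<open>h \<approx> 2\<^bsup>-j\<^esup>\<close> the other factor decays like \<open>exp (- m \<surd>j)\<close>. It pays for a net with mesh
  \<open>2\<^bsup>-j - \<surd>j\<^esup>\<close>, finer than the scale by more than any power of \<open>j\<close>, and it makes the sum over all
  dyadic levels \<open>j\<close> converge, with a bound that does not involve \<open>n\<close> (\<open>net_exceedance_prob\<close>).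

  Between the points of the net no further union bound is needed. As \<open>\<psi>\<close> has bounded variation and
  vanishes at \<open>\<plusminus>1\<close>, summation by parts bounds the difference of two numerators
  \<open>\<Sum>\<^sub>k \<lambda>\<^sub>k y\<^sub>k\<close> by the variation of \<open>\<psi>\<close> times the oscillation of the interpolated partial sum process of the
  \<open>y\<^sub>k\<close> over short intervals (\<open>lam_sum_diff_le\<close>). Dyadic chaining, outside an event of small
  probability, bounds this oscillation over length \<open>2\<^bsup>-L\<^esup>\<close> by a multiple of
  \<open>\<surd>n (L + 10) 2\<^bsup>-L/2\<^esup>\<close> (\<open>smooth_walk\<close>). For \<open>L \<approx> j + \<surd>j\<close> this is \<open>O(\<surd>n 2\<^bsup>-j/2\<^esup>)\<close>, the order of \<open>\<surd>n \<Lambda>\<close>.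
  Hoelder continuity supplies the two facts needed about \<open>\<Lambda>\<close>: it is at least a constant times
  \<open>\<surd>h\<close>, which also yields \<open>\<Lambda>\<^sup>2 \<ge> 1/n\<close> once \<open>nh\<close> is large, and neighbouring values of it are so close
  that the values of \<open>G\<close> differ by a bounded amount (\<open>net_comparison\<close>).

  The supremum cannot be very negative because it dominates its value at one pair with \<open>h \<ge> 1/4\<close>
  (\<open>large_scale_exists\<close>). It is measurable because the statistic is continuous in \<open>(t,h)\<close>, so that
  a countable dense set of pairs suffices.
\<close>

section \<open>Weights of the local averages and their norms\<close>

text \<open>The exponent \<open>\<beta>\<close> and a bound \<open>V\<close> for the variation are fixed as parameters, so that constants
  may depend on them but on nothing else. That \<open>\<psi>\<close> vanishes at \<open>\<plusminus>1\<close> as well follows from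
  continuity and the support condition; summation by parts then has no boundary terms.\<close>

locale kernel =
  fixes \<psi> :: "real \<Rightarrow> real" and \<beta> V :: real
  assumes nonneg: "0 \<le> \<psi> x"
    and at_zero: "\<psi> 0 = 1"
    and le_one: "\<psi> x \<le> 1"
    and vanishes: "1 \<le> \<bar>x\<bar> \<Longrightarrow> \<psi> x = 0"
    and beta_pos: "0 < \<beta>"
    and hoelder: "\<bar>\<psi> x - \<psi> y\<bar> \<le> \<bar>x - y\<bar> powr \<beta>"
    and variation: "(\<And>i. i < m \<Longrightarrow> p i \<le> p (Suc i)) \<Longrightarrow>
      (\<Sum>i<m. \<bar>\<psi> (p (Suc i)) - \<psi> (p i)\<bar>) \<le> V"

lemma hoelder_imp_continuous:
  fixes f :: "real \<Rightarrow> real"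
  assumes "0 < \<beta>" "\<And>x y. \<bar>f x - f y\<bar> \<le> \<bar>x - y\<bar> powr \<beta>"
  shows "continuous_on A f"
proof (rule continuous_at_imp_continuous_on, rule ballI)
  fix x
  have "((\<lambda>y. \<bar>y - x\<bar> powr \<beta>) \<longlongrightarrow> 0) (at x)"
    by (rule tendsto_zero_powrI) (use assms(1) in \<open>auto intro!: tendsto_eq_intros\<close>)
  then have "((\<lambda>y. f y - f x) \<longlongrightarrow> 0) (at x)"
    by (rule Lim_null_comparison[rotated]) (use assms(2) in auto)
  then show "isCont f x"
    unfolding isCont_def by (simp add: LIM_zero_iff)
qed

abbreviation time_cell :: "nat \<Rightarrow> nat \<Rightarrow> real set" where
  "time_cell n k \<equiv> {(real k - 1) / real n..real k / real n}"

lemma sum_integral_time_cells: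
  fixes g :: "real \<Rightarrow> real"
  assumes "continuous_on UNIV g" "n \<ge> 1"
  shows "(\<Sum>k=1..m. integral (time_cell n k) g) = integral {0..real m / real n} g"
proof (induction m)
  case (Suc m)
  have "integral {0..real m / real n} g + integral {real m / real n..real (Suc m) / real n} g
     = integral {0..real (Suc m) / real n} g"
    by (rule Henstock_Kurzweil_Integration.integral_combine)
       (use assms in \<open>auto intro!: integrable_continuous_real continuous_on_subset[OF assms(1)] divide_right_mono\<close>)
  then show ?case using Suc by simp
qed simp

text \<open>A bound of order \<open>b\<^sup>2\<close> times the length of the support, uniformly in \<open>n\<close>: one factor
  \<open>n \<bar>\<integral>f\<bar> \<le> b\<close> is a mean over a cell, and the remaining factors \<open>\<bar>\<integral>f\<bar>\<close> add up to at most the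
  integral of \<open>\<bar>f\<bar>\<close>. Applied to a rescaled kernel it bounds \<open>\<Lambda>\<^sup>2\<close>, applied to a difference of two
  rescaled kernels it bounds a variation of \<open>\<Lambda>\<close>.\<close>

lemma sum_square_cell_integrals_le:
  fixes f :: "real \<Rightarrow> real"
  assumes cont: "continuous_on UNIV f" and n: "n \<ge> 1"
    and b: "\<And>s. \<bar>f s\<bar> \<le> b" and z: "\<And>s. s \<notin> {p..q} \<Longrightarrow> f s = 0" and pq: "p \<le> q"
  shows "(\<Sum>k=1..n. real n * (integral (time_cell n k) f)\<^sup>2) \<le> b\<^sup>2 * (q - p)"
proof -
  have b0: "0 \<le> b" using b[of 0] by linarith
  have cab: "continuous_on UNIV (\<lambda>s. \<bar>f s\<bar>)" using cont by (intro continuous_intros)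
  have ic: "g integrable_on {u..v}" if "continuous_on UNIV g" for g :: "real \<Rightarrow> real" and u v
    using that by (meson continuous_on_subset integrable_continuous_real subset_UNIV)
  have one: "real n * (integral (time_cell n k) f)\<^sup>2 \<le> b * integral (time_cell n k) (\<lambda>s. \<bar>f s\<bar>)" for k
  proof -
    let ?I = "integral (time_cell n k) f"
    have le: "(real k - 1) / real n \<le> real k / real n" using n by (simp add: divide_right_mono)
    have A: "\<bar>?I\<bar> \<le> integral (time_cell n k) (\<lambda>s. \<bar>f s\<bar>)"
      using integral_norm_bound_integral[OF ic[OF cont] ic[OF cab]] by auto
    have B: "norm ?I \<le> b * (real k / real n - (real k - 1) / real n)"
      by (rule integral_bound) (use le b continuous_on_subset[OF cont] in auto)
    have B': "\<bar>?I\<bar> \<le> b / real n" using B n by (simp add: field_simps)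
    have "real n * ?I\<^sup>2 = (real n * \<bar>?I\<bar>) * \<bar>?I\<bar>" by (simp add: power2_eq_square)
    also have "\<dots> \<le> b * integral (time_cell n k) (\<lambda>s. \<bar>f s\<bar>)"
      using A B' n b0 by (intro mult_mono) (auto simp: field_simps)
    finally show ?thesis .
  qed
  have "(\<Sum>k=1..n. real n * (integral (time_cell n k) f)\<^sup>2) \<le> (\<Sum>k=1..n. b * integral (time_cell n k) (\<lambda>s. \<bar>f s\<bar>))"
    by (intro sum_mono one)
  also have "\<dots> = b * integral {0..1} (\<lambda>s. \<bar>f s\<bar>)"
    using sum_integral_time_cells[OF cab n, of n] n by (simp add: sum_distrib_left[symmetric])
  also have "integral {0..1} (\<lambda>s. \<bar>f s\<bar>) \<le> b * (q - p)"
  proof -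
    have "integral {0..1} (\<lambda>s. \<bar>f s\<bar>) = integral {0..1} (\<lambda>s. if s \<in> {p..q} then \<bar>f s\<bar> else 0)"
      by (rule integral_cong) (use z in auto)
    also have "\<dots> = integral ({p..q} \<inter> {0..1}) (\<lambda>s. \<bar>f s\<bar>)"
      by (rule Henstock_Kurzweil_Integration.integral_restrict_Int)
    also have "{p..q} \<inter> {0..1} = {max 0 p..min 1 q}" by auto
    also have "integral {max 0 p..min 1 q} (\<lambda>s. \<bar>f s\<bar>) \<le> b * (q - p)"
    proof (cases "max 0 p \<le> min 1 q")
      case True
      have "norm (integral {max 0 p..min 1 q} (\<lambda>s. \<bar>f s\<bar>)) \<le> b * (min 1 q - max 0 p)"
        by (rule integral_bound) (use True b continuous_on_subset[OF cab] in auto)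
      also have "\<dots> \<le> b * (q - p)" using b0 by (intro mult_left_mono) auto
      finally show ?thesis by simp
    qed (use b0 pq in auto)
    finally show ?thesis .
  qed
  finally show ?thesis using b0 by (simp add: power2_eq_square mult.assoc mult_left_mono)
qed

context kernel
begin

lemma continuous: "continuous_on A \<psi>"
  using hoelder_imp_continuous beta_pos hoelder .

lemma continuous_scaled: "continuous_on A (scaled_kernel \<psi> t h)"
  unfolding scaled_kernel_def divide_inverse
  by (rule continuous_on_compose2[OF continuous[of UNIV]]) (auto intro!: continuous_intros)

lemma lam_eq_integral:
  "lam \<psi> n t h k = sqrt (real n) * integral (time_cell n k) (scaled_kernel \<psi> t h)"
  unfolding lam_def
  by (subst set_borel_integral_eq_integral(2))
     (auto intro!: borel_integrable_atLeastAtMost' continuous_scaled)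

lemma scaled_vanishes:
  assumes "h > 0" "s \<notin> {t - h..t + h}" shows "scaled_kernel \<psi> t h s = 0"
  unfolding scaled_kernel_def by (rule vanishes) (use assms in \<open>auto simp: field_simps abs_if\<close>)

lemma scaled_bounds: "0 \<le> scaled_kernel \<psi> t h s" "scaled_kernel \<psi> t h s \<le> 1"
  unfolding scaled_kernel_def using nonneg le_one by auto

lemma integrable_scaled: "scaled_kernel \<psi> t h integrable_on {u..v}"
  by (intro integrable_continuous_real continuous_scaled)

lemma lam_nonneg: "0 \<le> lam \<psi> n t h k"
  unfolding lam_eq_integral
  by (intro mult_nonneg_nonneg integral_nonneg integrable_scaled) (auto simp: scaled_bounds)

lemma lam_le:
  assumes "n \<ge> 1" shows "lam \<psi> n t h k \<le> 1 / sqrt (real n)"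
proof -
  have "norm (integral (time_cell n k) (scaled_kernel \<psi> t h)) \<le> 1 * (real k / real n - (real k - 1) / real n)"
    by (rule integral_bound) (use assms scaled_bounds continuous_scaled in \<open>auto simp: divide_right_mono\<close>)
  also have "\<dots> = 1 / real n" by (simp add: diff_divide_distrib)
  finally have "integral (time_cell n k) (scaled_kernel \<psi> t h) \<le> 1 / real n" by simp
  then have "lam \<psi> n t h k \<le> sqrt (real n) * (1 / real n)"
    unfolding lam_eq_integral by (intro mult_left_mono) auto
  also have "\<dots> = 1 / sqrt (real n)" using assms by (simp add: field_simps)
  finally show ?thesis .
qed

lemma Lam_nonneg: "0 \<le> Lam \<psi> n t h"
  unfolding Lam_def by (simp add: sum_nonneg)

lemma Lam_squared: "(Lam \<psi> n t h)\<^sup>2 = (\<Sum>k=1..n. (lam \<psi> n t h k)\<^sup>2)"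
  unfolding Lam_def by (simp add: sum_nonneg)

lemma Lam_squared_le:
  assumes "n \<ge> 1" "h > 0" shows "(Lam \<psi> n t h)\<^sup>2 \<le> 2 * h"
proof -
  have "(Lam \<psi> n t h)\<^sup>2 = (\<Sum>k=1..n. real n * (integral (time_cell n k) (scaled_kernel \<psi> t h))\<^sup>2)"
    unfolding Lam_squared lam_eq_integral by (simp add: power_mult_distrib)
  also have "\<dots> \<le> 1\<^sup>2 * ((t + h) - (t - h))"
    by (rule sum_square_cell_integrals_le)
       (use assms scaled_bounds continuous_scaled scaled_vanishes in auto)
  finally show ?thesis by simp
qed

text \<open>On \<open>[-r,r]\<close> with \<open>r\<^bsup>\<beta>\<^esup> = 1/2\<close>, Hoelder continuity with constant one keeps \<open>\<psi>\<close> above \<open>1/2\<close>.\<close>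

definition core_radius :: real where "core_radius = (1 / 2) powr (1 / \<beta>)"

lemma core_radius_pos: "0 < core_radius" and core_radius_less_one: "core_radius < 1"
  unfolding core_radius_def using beta_pos powr_less_mono2[of "1/\<beta>" "1/2" 1] by auto

lemma half_le_on_core:
  assumes "\<bar>x\<bar> \<le> core_radius" shows "1 / 2 \<le> \<psi> x"
proof -
  have "\<bar>x\<bar> powr \<beta> \<le> core_radius powr \<beta>"
    using assms beta_pos by (intro powr_mono2) auto
  also have "\<dots> = 1 / 2" unfolding core_radius_def using beta_pos by (simp add: powr_powr)
  finally show ?thesis using hoelder[of x 0] at_zero by auto
qed

text \<open>The constant \<open>K\<close> of the theorem. It makes the core \<open>[t - rh, t + rh]\<close> of the rescaled kernel,
  \<open>r\<close> being the core radius, at least 16 grid cells long.\<close>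

definition min_scale :: real where "min_scale = 8 / core_radius"

lemma min_scale_pos: "0 < min_scale"
  unfolding min_scale_def using core_radius_pos by simp

text \<open>Every cell whose right end point lies in the inner half of the core is contained in the core, so
  that its weight is at least \<open>1/(2\<surd>n)\<close>. There are at least \<open>nrh - 1\<close> such cells.\<close>

lemma Lam_squared_ge:
  assumes n: "n \<ge> 1" and th: "(t, h) \<in> loc_scales n min_scale"
  shows "(Lam \<psi> n t h)\<^sup>2 \<ge> core_radius * h / 8" "(Lam \<psi> n t h)\<^sup>2 \<ge> 1 / real n"
proof -
  define r where "r = core_radius"
  have r: "0 < r" "r < 1" unfolding r_def using core_radius_pos core_radius_less_one by auto
  have n0: "0 < real n" using n by simp
  have h1: "8 \<le> real n * r * h"
    using th r n0 unfolding loc_scales_def min_scale_def r_def by (auto simp: field_simps)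
  have h0: "0 < h" using h1 r n0
    by (metis less_le_trans mult_pos_pos zero_less_mult_pos zero_less_numeral)
  have t: "h \<le> t" "t \<le> 1 - h" using th unfolding loc_scales_def by auto
  have rh: "r * h \<le> h" using r h0 by (simp add: mult_le_cancel_right1)
  define x y where "x = real n * (t - r * h / 2)" and "y = real n * (t + r * h / 2)"
  have x0: "0 < x" unfolding x_def
  proof (rule mult_pos_pos)
    show "0 < t - r * h / 2" using rh h0 t by linarith
  qed (rule n0)
  have yn: "y \<le> real n" 
  proof -
    have "t + r * h / 2 \<le> 1" using rh h0 t by linarith
    then show ?thesis unfolding y_def using n0 by (simp add: mult_le_cancel_left1)
  qed
  have yx: "y - x = real n * r * h" unfolding x_def y_def by (simp add: algebra_simps)
  define A where "A = {nat \<lceil>x\<rceil>..nat \<lfloor>y\<rfloor>}"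
  have mem: "x \<le> real k" "real k \<le> y" if "k \<in> A" for k
  proof -
    have *: "nat \<lceil>x\<rceil> \<le> k" "k \<le> nat \<lfloor>y\<rfloor>" "0 < y" using that x0 yx h1 unfolding A_def by auto
    show "x \<le> real k" using *(1) by linarith
    show "real k \<le> y" using *(2,3) by linarith
  qed
  have Asub: "A \<subseteq> {1..n}"
  proof
    fix k assume "k \<in> A"
    then show "k \<in> {1..n}" using mem[of k] x0 yn by auto
  qed
  have card: "real (card A) \<ge> y - x - 1"
    unfolding A_def using x0 yx h1 by (simp, linarith)
  have big: "(lam \<psi> n t h k)\<^sup>2 \<ge> 1 / (4 * real n)" if "k \<in> A" for k
  proof -
    note k = mem[OF that]
    have lo: "t - r * h \<le> (real k - 1) / real n"
    proof -
      have "real n * (t - r * h) \<le> real k - 1" using k(1) h1 unfolding x_def by (simp add: algebra_simps)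
      then show ?thesis using n0 by (simp add: field_simps)
    qed
    have hi: "real k / real n \<le> t + r * h"
    proof -
      have "real k \<le> real n * (t + r * h)" using k(2) h1 unfolding y_def by (simp add: algebra_simps)
      then show ?thesis using n0 by (simp add: field_simps)
    qed
    have "integral (time_cell n k) (\<lambda>s. 1 / 2) \<le> integral (time_cell n k) (scaled_kernel \<psi> t h)"
    proof (rule integral_le)
      fix s assume s: "s \<in> time_cell n k"
      have "\<bar>s - t\<bar> \<le> r * h" using s lo hi by auto
      then have "\<bar>(s - t) / h\<bar> \<le> r" using h0 by (simp add: field_simps)
      then show "1 / 2 \<le> scaled_kernel \<psi> t h s"
        unfolding scaled_kernel_def r_def by (rule half_le_on_core)
    qed (auto intro!: integrable_scaled)
    then have "1 / 2 * (1 / real n) \<le> integral (time_cell n k) (scaled_kernel \<psi> t h)"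
      using n0 by (simp add: diff_divide_distrib divide_right_mono)
    then have "sqrt (real n) * (1 / 2 * (1 / real n)) \<le> lam \<psi> n t h k"
      unfolding lam_eq_integral by (intro mult_left_mono) auto
    then have "(sqrt (real n) * (1 / 2 * (1 / real n)))\<^sup>2 \<le> (lam \<psi> n t h k)\<^sup>2"
      by (rule power_mono) auto
    moreover have "(sqrt (real n) * (1 / 2 * (1 / real n)))\<^sup>2 = 1 / (4 * real n)"
      using n0 by (simp add: power_mult_distrib power_divide power2_eq_square)
    ultimately show ?thesis by simp
  qed
  have "(y - x - 1) * (1 / (4 * real n)) \<le> real (card A) * (1 / (4 * real n))"
    using card n0 by (intro mult_right_mono) auto
  also have "\<dots> \<le> (\<Sum>k\<in>A. (lam \<psi> n t h k)\<^sup>2)"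
    using sum_bounded_below[of A "1 / (4 * real n)", OF big] by simp
  also have "\<dots> \<le> (Lam \<psi> n t h)\<^sup>2"
    unfolding Lam_squared by (rule sum_mono2) (use Asub in auto)
  finally have L: "(real n * r * h - 1) / (4 * real n) \<le> (Lam \<psi> n t h)\<^sup>2" using yx by simp
  have "core_radius * h / 8 = (real n * r * h / 2) / (4 * real n)" using n0 unfolding r_def by simp
  also have "\<dots> \<le> (real n * r * h - 1) / (4 * real n)"
    by (rule divide_right_mono) (use h1 in linarith, simp)
  finally show "(Lam \<psi> n t h)\<^sup>2 \<ge> core_radius * h / 8" using L by linarith
  have "1 / real n = 4 / (4 * real n)" using n0 by simp
  also have "\<dots> \<le> (real n * r * h - 1) / (4 * real n)"
    by (rule divide_right_mono) (use h1 in linarith, simp)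
  finally show "(Lam \<psi> n t h)\<^sup>2 \<ge> 1 / real n" using L by linarith
qed

lemma lam_diff_integral:
  "lam \<psi> n t h k - lam \<psi> n t' h' k =
     sqrt (real n) * integral (time_cell n k) (\<lambda>s. scaled_kernel \<psi> t h s - scaled_kernel \<psi> t' h' s)"
  unfolding lam_eq_integral
  by (subst integral_diff) (auto intro!: integrable_scaled simp: algebra_simps)

end

lemma L2_set_diff_bound:
  fixes f g :: "'b \<Rightarrow> real"
  shows "\<bar>L2_set f A - L2_set g A\<bar> \<le> L2_set (\<lambda>i. f i - g i) A"
proof -
  have "L2_set f A \<le> L2_set (\<lambda>i. f i - g i) A + L2_set g A"
    using L2_set_triangle_ineq[of "\<lambda>i. f i - g i" g A] by simp
  moreover have "L2_set g A \<le> L2_set (\<lambda>i. f i - g i) A + L2_set f A"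
    using L2_set_triangle_ineq[of "\<lambda>i. g i - f i" f A] by (simp add: L2_set_def power2_commute)
  ultimately show ?thesis by linarith
qed

context kernel
begin

text \<open>\<open>\<Lambda>\<close> is the Euclidean norm of the weight vector, hence changes by at most the norm of the
  difference of the weight vectors. The arguments of \<open>\<psi>\<close> belonging to the two pairs differ by at most
  \<open>2w/d\<close> wherever one of the rescaled kernels is nonzero; elsewhere the difference is zero.\<close>

lemma Lam_diff_le:
  assumes n: "n \<ge> 1" and h: "0 < d" "d \<le> h" "d \<le> h'" "h \<le> 2 * d" "h' \<le> 2 * d"
    and w: "\<bar>t - t'\<bar> \<le> w" "\<bar>h - h'\<bar> \<le> w" "w \<le> d"
  shows "\<bar>Lam \<psi> n t h - Lam \<psi> n t' h'\<bar> \<le> (2 * w / d) powr \<beta> * sqrt (6 * d)"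
proof -
  define b where "b = (2 * w / d) powr \<beta>"
  define f where "f = (\<lambda>s. scaled_kernel \<psi> t h s - scaled_kernel \<psi> t' h' s)"
  have b0: "0 \<le> b" unfolding b_def by simp
  have w0: "0 \<le> w" using w(1) by linarith
  have hp: "0 < h" "0 < h'" using h by auto
  have inside: "\<bar>(s - t) / h - (s - t') / h'\<bar> \<le> 2 * w / d"
    if "\<bar>s - t\<bar> \<le> h" "0 < h" "d \<le> h'" "\<bar>t - t'\<bar> \<le> w" "\<bar>h - h'\<bar> \<le> w" for s t t' h h'
  proof -
    have h'p: "0 < h'" using that h by linarith
    have "(s - t) / h - (s - t') / h' = ((s - t) / h * (h' - h) + (t' - t)) / h'"
      using that h'p by (simp add: field_simps)
    also have "\<bar>\<dots>\<bar> \<le> (1 * w + w) / h'"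
    proof -
      have "\<bar>(s - t) / h\<bar> \<le> 1" using that by (simp add: field_simps)
      then have "\<bar>(s - t) / h * (h' - h)\<bar> \<le> 1 * w"
        unfolding abs_mult using that by (intro mult_mono) auto
      then have "\<bar>(s - t) / h * (h' - h) + (t' - t)\<bar> \<le> 1 * w + w"
        using that by (intro order_trans[OF abs_triangle_ineq add_mono]) auto
      then show ?thesis using h'p by (simp add: divide_right_mono)
    qed
    also have "\<dots> \<le> 2 * w / d" using that h w0 by (auto intro!: divide_left_mono)
    finally show ?thesis .
  qed
  have fb: "\<bar>f s\<bar> \<le> b" for s
  proof -
    have arg: "\<bar>f s\<bar> \<le> b" if "\<bar>(s - t) / h - (s - t') / h'\<bar> \<le> 2 * w / d"
    proof -
      have "\<bar>f s\<bar> \<le> \<bar>(s - t) / h - (s - t') / h'\<bar> powr \<beta>"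
        unfolding f_def scaled_kernel_def by (rule hoelder)
      also have "\<dots> \<le> b" unfolding b_def using that beta_pos by (intro powr_mono2) auto
      finally show ?thesis .
    qed
    consider "\<bar>s - t\<bar> \<le> h" | "\<bar>s - t'\<bar> \<le> h'" | "s \<notin> {t - h..t + h}" "s \<notin> {t' - h'..t' + h'}"
      by (fastforce simp: abs_le_iff)
    then show ?thesis
    proof cases
      case 1 then show ?thesis using inside[of s t h h' t'] w hp h arg by auto
    next
      case 2
      have "\<bar>(s - t') / h' - (s - t) / h\<bar> \<le> 2 * w / d"
        by (rule inside) (use 2 w hp h in auto)
      then show ?thesis by (intro arg) (simp add: abs_minus_commute)
    next
      case 3 then show ?thesis unfolding f_def using scaled_vanishes hp b0 by auto
    qed
  qed
  have fz: "f s = 0" if "s \<notin> {t - 3 * d..t + 3 * d}" for s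
  proof -
    have "s \<notin> {t - h..t + h}" "s \<notin> {t' - h'..t' + h'}" using that h w by auto
    then show ?thesis unfolding f_def using scaled_vanishes hp by auto
  qed
  have cf: "continuous_on UNIV f" unfolding f_def by (intro continuous_intros continuous_scaled)
  have "\<bar>Lam \<psi> n t h - Lam \<psi> n t' h'\<bar> \<le> L2_set (\<lambda>k. lam \<psi> n t h k - lam \<psi> n t' h' k) {1..n}"
    unfolding Lam_def using L2_set_diff_bound[of "lam \<psi> n t h" "{1..n}" "lam \<psi> n t' h'"]
    by (simp add: L2_set_def)
  also have "\<dots> = sqrt (\<Sum>k=1..n. real n * (integral (time_cell n k) f)\<^sup>2)"
    unfolding L2_set_def lam_diff_integral f_def by (simp add: power_mult_distrib)
  also have "\<dots> \<le> sqrt (b\<^sup>2 * ((t + 3 * d) - (t - 3 * d)))"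
    by (intro real_sqrt_le_mono sum_square_cell_integrals_le cf n fb fz) (use h in auto)
  also have "\<dots> = b * sqrt (6 * d)" using b0 by (simp add: real_sqrt_mult)
  finally show ?thesis unfolding b_def .
qed

end

section \<open>Summation by parts against the interpolated random walk\<close>

definition ramp :: "real \<Rightarrow> real" where "ramp u = max 0 (min 1 u)"

text \<open>The partial sum process of the \<open>y\<^sub>k\<close> in rescaled time, interpolated linearly between grid points:
  the \<open>k\<close>-th ramp rises from \<open>0\<close> to \<open>1\<close> over the \<open>k\<close>-th cell.\<close>

definition walk :: "nat \<Rightarrow> (nat \<Rightarrow> real) \<Rightarrow> real \<Rightarrow> real" where
  "walk n y s = (\<Sum>k=1..n. y k * ramp (real n * s - (real k - 1)))"

lemma sum_by_parts_bound:
  fixes a d :: "nat \<Rightarrow> real"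
  assumes "a 0 = 0" "a m = 0" and d: "\<And>i. i \<le> m \<Longrightarrow> \<bar>d i\<bar> \<le> B"
  shows "\<bar>\<Sum>i<m. a i * (d (Suc i) - d i)\<bar> \<le> B * (\<Sum>i<m. \<bar>a (Suc i) - a i\<bar>)"
proof -
  have *: "(\<Sum>i<k. a i * (d (Suc i) - d i)) = a k * d k - a 0 * d 0 - (\<Sum>i<k. d (Suc i) * (a (Suc i) - a i))" for k
    by (induction k) (auto simp: algebra_simps)
  have "\<bar>\<Sum>i<m. a i * (d (Suc i) - d i)\<bar> = \<bar>\<Sum>i<m. d (Suc i) * (a (Suc i) - a i)\<bar>"
    unfolding * using assms by simp
  also have "\<dots> \<le> (\<Sum>i<m. \<bar>d (Suc i) * (a (Suc i) - a i)\<bar>)" by (rule sum_abs)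
  also have "\<dots> \<le> (\<Sum>i<m. B * \<bar>a (Suc i) - a i\<bar>)"
    by (intro sum_mono) (auto simp: abs_mult d intro!: mult_right_mono)
  finally show ?thesis by (simp add: sum_distrib_left)
qed

context kernel
begin

text \<open>Written as \<open>n\<close> times an integral over the \<open>k\<close>-th cell, \<open>\<surd>n \<lambda>\<^sub>k\<close> is the Stieltjes integral of
  \<open>x \<mapsto> \<psi> x\<close> against \<open>x \<mapsto> c (t + h x)\<close>, where \<open>c\<close> is the ramp of that cell. The nodes
  \<open>-1 + 2i/m\<close> do not depend on \<open>(t,h)\<close>; this common parametrization is what allows the sums for two
  pairs to be compared node by node.\<close>

lemma riemann_stieltjes_cell:
  fixes n k m :: nat and t h :: real
  assumes n: "n \<ge> 1" and h: "h > 0" and m: "m \<ge> 1"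
  defines "x \<equiv> \<lambda>i::nat. -1 + 2 * real i / real m"
  defines "c \<equiv> \<lambda>s. ramp (real n * s - (real k - 1))"
  shows "\<bar>sqrt (real n) * lam \<psi> n t h k - (\<Sum>i<m. \<psi> (x i) * (c (t + h * x (Suc i)) - c (t + h * x i)))\<bar>
    \<le> (2 / real m) powr \<beta>"
proof -
  define l u where "l = (real k - 1) / real n" and "u = real k / real n"
  define f where "f = scaled_kernel \<psi> t h"
  \<comment> \<open>the nodes clipped to the cell, so that the ramp and the integral over the cell refer to the same points\<close>
  define p where "p = (\<lambda>i. max l (min u (t + h * x i)))"
  define e where "e = (2 / real m) powr \<beta>"
  have n0: "0 < real n" and m0: "0 < real m" using n m by auto
  have ul: "u - l = 1 / real n" unfolding u_def l_def by (simp add: diff_divide_distrib)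
  have lu: "l \<le> u" using ul n0 by (metis diff_ge_0_iff_ge divide_nonneg_pos zero_le_one)
  have xs: "x i \<le> x (Suc i)" for i unfolding x_def using m0 by (simp add: divide_right_mono)
  have as: "t + h * x i \<le> t + h * x (Suc i)" for i using xs h by simp
  have ps: "p i \<le> p (Suc i)" for i unfolding p_def using as[of i] by (auto simp: max_def min_def)
  have c_eq: "c (t + h * x i) = real n * (p i - l)" for i
  proof -
    have "ramp (real n * s - (real k - 1)) = real n * (max l (min u s) - l)" for s
      unfolding ramp_def l_def u_def using n0 by (auto simp: max_def min_def field_simps)
    then show ?thesis unfolding c_def p_def by simp
  qed
  have int: "f integrable_on {a..b}" for a b unfolding f_def by (rule integrable_scaled)
  have mono: "p i \<le> p j" if "i \<le> j" for i j using ps that by (rule lift_Suc_mono_le)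
  have split: "(\<Sum>i<j. integral {p i..p (Suc i)} f) = integral {p 0..p j} f" for j
  proof (induction j)
    case (Suc j)
    have "integral {p 0..p j} f + integral {p j..p (Suc j)} f = integral {p 0..p (Suc j)} f"
      by (rule Henstock_Kurzweil_Integration.integral_combine) (auto intro: mono ps int)
    then show ?case using Suc by simp
  qed simp
  have x0: "x 0 = -1" and xm: "x m = 1" unfolding x_def using m0 by auto
  have whole: "integral {l..u} f = integral {p 0..p m} f"
  proof -
    have b: "l \<le> p 0" "p m \<le> u" "p 0 \<le> p m" unfolding p_def[of] using lu mono[of 0 m] by (auto simp: p_def)
    have "integral {l..p 0} f = 0"
    proof -
      have "integral {l..p 0} f = integral {l..p 0} (\<lambda>_. 0)"
      proof (rule integral_spike[of "{p 0}"])
        fix s assume s: "s \<in> {l..p 0} - {p 0}"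
        then have "s < t - h" unfolding p_def x0 by (auto simp: max_def min_def split: if_splits)
        then show "0 = f s" unfolding f_def using scaled_vanishes[OF h, of s t] by auto
      qed auto
      then show ?thesis by simp
    qed
    moreover have "integral {p m..u} f = 0"
    proof -
      have "integral {p m..u} f = integral {p m..u} (\<lambda>_. 0)"
      proof (rule integral_spike[of "{p m}"])
        fix s assume s: "s \<in> {p m..u} - {p m}"
        then have "s > t + h" unfolding p_def xm using lu by (auto simp: max_def min_def split: if_splits)
        then show "0 = f s" unfolding f_def using scaled_vanishes[OF h, of s t] by auto
      qed auto
      then show ?thesis by simp
    qed
    moreover have "integral {l..p 0} f + integral {p 0..p m} f = integral {l..p m} f"
      "integral {l..p m} f + integral {p m..u} f = integral {l..u} f"
      using b by (auto intro!: Henstock_Kurzweil_Integration.integral_combine int)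
    ultimately show ?thesis by simp
  qed
  have piece: "\<bar>integral {p i..p (Suc i)} f - \<psi> (x i) * (p (Suc i) - p i)\<bar> \<le> e * (p (Suc i) - p i)" for i
  proof (cases "p i = p (Suc i)")
    case False
    then have lt: "p i < p (Suc i)" using ps[of i] by simp
    have rng: "t + h * x i \<le> p i" "p (Suc i) \<le> t + h * x (Suc i)"
      using lt lu as[of i] unfolding p_def by (auto simp: max_def min_def split: if_splits)
    have "integral {p i..p (Suc i)} f - \<psi> (x i) * (p (Suc i) - p i)
       = integral {p i..p (Suc i)} f - integral {p i..p (Suc i)} (\<lambda>_. \<psi> (x i))" using ps[of i] by simp
    also have "\<dots> = integral {p i..p (Suc i)} (\<lambda>s. f s - \<psi> (x i))"
      by (rule integral_diff[symmetric]) (auto intro: int)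
    also have "norm \<dots> \<le> e * (p (Suc i) - p i)"
    proof (rule integral_bound)
      show "p i \<le> p (Suc i)" by (rule ps)
      show "continuous_on {p i..p (Suc i)} (\<lambda>s. f s - \<psi> (x i))"
        unfolding f_def by (intro continuous_intros continuous_scaled)
      fix s assume s: "s \<in> {p i..p (Suc i)}"
      have "x i \<le> (s - t) / h" "(s - t) / h \<le> x (Suc i)"
        using s rng h by (auto simp: field_simps)
      moreover have "x (Suc i) - x i = 2 / real m" unfolding x_def using m0 by (simp add: field_simps)
      ultimately have "\<bar>(s - t) / h - x i\<bar> \<le> 2 / real m" by auto
      then have "\<bar>(s - t) / h - x i\<bar> powr \<beta> \<le> e"
        unfolding e_def using beta_pos by (intro powr_mono2) auto
      then show "norm (f s - \<psi> (x i)) \<le> e"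
        using hoelder[of "(s - t) / h" "x i"] unfolding f_def scaled_kernel_def by auto
    qed
    finally show ?thesis by simp
  qed auto
  have "sqrt (real n) * lam \<psi> n t h k = real n * integral {l..u} f"
    unfolding lam_eq_integral l_def u_def f_def by simp
  also have "\<dots> = real n * (\<Sum>i<m. integral {p i..p (Suc i)} f)" unfolding whole split ..
  finally have L: "sqrt (real n) * lam \<psi> n t h k = real n * (\<Sum>i<m. integral {p i..p (Suc i)} f)" .
  have "(\<Sum>i<m. \<psi> (x i) * (c (t + h * x (Suc i)) - c (t + h * x i))) = real n * (\<Sum>i<m. \<psi> (x i) * (p (Suc i) - p i))"
    unfolding c_eq sum_distrib_left by (intro sum.cong refl) (simp add: algebra_simps)
  with L have A: "sqrt (real n) * lam \<psi> n t h k - (\<Sum>i<m. \<psi> (x i) * (c (t + h * x (Suc i)) - c (t + h * x i)))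
     = real n * (\<Sum>i<m. integral {p i..p (Suc i)} f - \<psi> (x i) * (p (Suc i) - p i))"
    by (simp add: sum_subtractf right_diff_distrib)
  have "\<bar>\<Sum>i<m. integral {p i..p (Suc i)} f - \<psi> (x i) * (p (Suc i) - p i)\<bar> \<le> (\<Sum>i<m. e * (p (Suc i) - p i))"
    by (rule order_trans[OF sum_abs sum_mono]) (rule piece)
  also have "\<dots> = e * (p m - p 0)"
    unfolding sum_distrib_left[symmetric] by (simp add: sum_lessThan_telescope)
  also have "\<dots> \<le> e * (1 / real n)"
  proof (rule mult_left_mono)
    have "l \<le> p 0" "p m \<le> u" unfolding p_def using lu by auto
    then show "p m - p 0 \<le> 1 / real n" using ul by linarith
  qed (simp add: e_def)
  finally show ?thesis unfolding A e_def[symmetric] abs_mult using n0 by (simp add: field_simps)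
qed

text \<open>In the limit of fine nodes both numerators are Stieltjes integrals of \<open>\<psi>\<close>, against the walk read
  along \<open>t + hx\<close> and along \<open>t' + h'x\<close>. Summation by parts moves the increments onto \<open>\<psi>\<close>, whose
  variation is at most \<open>V\<close>.\<close>

lemma lam_sum_diff_le:
  assumes n: "n \<ge> 1" and h: "h > 0" "h' > 0"
    and B: "\<And>x. \<bar>x\<bar> \<le> 1 \<Longrightarrow> \<bar>walk n y (t + h * x) - walk n y (t' + h' * x)\<bar> \<le> B"
  shows "sqrt (real n) * \<bar>(\<Sum>k=1..n. lam \<psi> n t h k * y k) - (\<Sum>k=1..n. lam \<psi> n t' h' k * y k)\<bar> \<le> V * B"
proof -
  define Y where "Y = (\<Sum>k=1..n. \<bar>y k\<bar>)"
  let ?L = "\<lambda>t h. \<Sum>k=1..n. lam \<psi> n t h k * y k"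
  have bound: "sqrt (real n) * \<bar>?L t h - ?L t' h'\<bar> \<le> V * B + 2 * (Y * (2 / real m) powr \<beta>)" if m: "m \<ge> 1" for m
  proof -
    define x where "x = (\<lambda>i::nat. -1 + 2 * real i / real m)"
    define R where "R = (\<lambda>t h. \<Sum>i<m. \<psi> (x i) * (walk n y (t + h * x (Suc i)) - walk n y (t + h * x i)))"
    have approx: "\<bar>sqrt (real n) * ?L t h - R t h\<bar> \<le> Y * (2 / real m) powr \<beta>" if "h > 0" for t h
    proof -
      let ?c = "\<lambda>k s. ramp (real n * s - (real k - 1))"
      define S where "S = (\<lambda>k. \<Sum>i<m. \<psi> (x i) * (?c k (t + h * x (Suc i)) - ?c k (t + h * x i)))"
      have "R t h = (\<Sum>i<m. \<Sum>k=1..n. y k * (\<psi> (x i) * (?c k (t + h * x (Suc i)) - ?c k (t + h * x i))))"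
        unfolding R_def walk_def sum_subtractf[symmetric] sum_distrib_left
        by (intro sum.cong refl) (simp add: algebra_simps)
      also have "\<dots> = (\<Sum>k=1..n. y k * S k)"
        unfolding S_def by (subst sum.swap) (simp add: sum_distrib_left)
      finally have "sqrt (real n) * ?L t h - R t h = (\<Sum>k=1..n. y k * (sqrt (real n) * lam \<psi> n t h k - S k))"
        by (simp add: sum_distrib_left sum_subtractf algebra_simps)
      also have "\<bar>\<dots>\<bar> \<le> (\<Sum>k=1..n. \<bar>y k\<bar> * (2 / real m) powr \<beta>)"
      proof (rule order_trans[OF sum_abs sum_mono])
        fix k
        have "\<bar>sqrt (real n) * lam \<psi> n t h k - S k\<bar> \<le> (2 / real m) powr \<beta>"
          using riemann_stieltjes_cell[OF n that m, of t k] unfolding S_def x_def .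
        then show "\<bar>y k * (sqrt (real n) * lam \<psi> n t h k - S k)\<bar> \<le> \<bar>y k\<bar> * (2 / real m) powr \<beta>"
          unfolding abs_mult by (rule mult_left_mono) simp
      qed
      finally show ?thesis unfolding Y_def by (simp add: sum_distrib_right)
    qed
    have "\<bar>R t h - R t' h'\<bar> \<le> B * V"
    proof -
      define d where "d = (\<lambda>i. walk n y (t + h * x i) - walk n y (t' + h' * x i))"
      have "R t h - R t' h' = (\<Sum>i<m. \<psi> (x i) * (d (Suc i) - d i))"
        unfolding R_def d_def sum_subtractf[symmetric] by (simp add: algebra_simps)
      also have "\<bar>\<dots>\<bar> \<le> B * (\<Sum>i<m. \<bar>\<psi> (x (Suc i)) - \<psi> (x i)\<bar>)"
      proof (rule sum_by_parts_bound)
        show "\<psi> (x 0) = 0" "\<psi> (x m) = 0" using m by (auto simp: x_def intro!: vanishes)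
        fix i assume "i \<le> m"
        then have "\<bar>x i\<bar> \<le> 1" unfolding x_def using m by (auto simp: field_simps abs_le_iff)
        then show "\<bar>d i\<bar> \<le> B" unfolding d_def by (rule B)
      qed
      also have "\<dots> \<le> B * V"
      proof (rule mult_left_mono)
        show "(\<Sum>i<m. \<bar>\<psi> (x (Suc i)) - \<psi> (x i)\<bar>) \<le> V"
          by (rule variation) (simp add: x_def divide_right_mono)
        show "0 \<le> B" using B[of 0] by simp
      qed
      finally show ?thesis .
    qed
    moreover have "sqrt (real n) * \<bar>?L t h - ?L t' h'\<bar> = \<bar>sqrt (real n) * ?L t h - sqrt (real n) * ?L t' h'\<bar>"
      by (simp add: right_diff_distrib[symmetric] abs_mult)
    ultimately show ?thesis using approx[OF h(1), of t] approx[OF h(2), of t'] by (simp add: mult.commute)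
  qed
  have "(\<lambda>m. V * B + 2 * (Y * (2 / real m) powr \<beta>)) \<longlonglongrightarrow> V * B + 2 * (Y * 0)"
  proof -
    have "(\<lambda>m. (2 / real m) powr \<beta>) \<longlonglongrightarrow> 0"
      by (rule tendsto_zero_powrI[OF _ tendsto_const])
         (use beta_pos lim_const_over_n[of 2] in auto)
    then show ?thesis by (intro tendsto_intros)
  qed
  then have "sqrt (real n) * \<bar>?L t h - ?L t' h'\<bar> \<le> V * B + 2 * (Y * 0)"
    by (rule LIMSEQ_le_const) (use bound in blast)
  then show ?thesis by simp
qed

end

section \<open>Moduli of continuity from dyadic increments\<close>

definition dyadic_floor :: "nat \<Rightarrow> real \<Rightarrow> real" where
  "dyadic_floor l s = \<lfloor>s * 2 ^ l\<rfloor> / 2 ^ l"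

lemma dyadic_floor_bounds: "dyadic_floor l s \<le> s" "s < dyadic_floor l s + 1 / 2 ^ l"
  unfolding dyadic_floor_def by (auto simp: field_simps) linarith+

lemma dyadic_floor_tendsto: "(\<lambda>l. dyadic_floor l s) \<longlonglongrightarrow> s"
proof (rule tendsto_sandwich)
  show "(\<lambda>l. s - (1 / 2) ^ l) \<longlonglongrightarrow> s"
    using tendsto_diff[OF tendsto_const LIMSEQ_realpow_zero[of "1/2::real"], of s] by simp
  show "\<forall>\<^sub>F l in sequentially. s - (1 / 2) ^ l \<le> dyadic_floor l s"
    using less_imp_le[OF dyadic_floor_bounds(2)[of s]] by (auto simp: power_one_over algebra_simps)
qed (auto simp: dyadic_floor_bounds)

text \<open>Chaining along the dyadic floors: \<open>F\<close> at the floor of level \<open>L\<close> differs from \<open>F s\<close> by the increments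
  at all finer levels, whose sum is dominated by its first terms. Floors of level \<open>L\<close> of points
  at distance at most \<open>2\<^bsup>-L\<^esup>\<close> are equal or adjacent.\<close>

lemma dyadic_modulus_of_continuity:
  fixes F :: "real \<Rightarrow> real"
  assumes cont: "continuous_on {0..1} F" and A: "0 \<le> A"
    and inc: "\<And>l m. m < 2 ^ l \<Longrightarrow>
      \<bar>F ((real m + 1) / 2 ^ l) - F (real m / 2 ^ l)\<bar> \<le> A * (real l + 2) * sqrt (1 / 2) ^ l"
    and s: "s \<in> {0..1}" "s' \<in> {0..1}" "\<bar>s - s'\<bar> \<le> 1 / 2 ^ L"
  shows "\<bar>F s - F s'\<bar> \<le> 12 * A * (real L + 10) * sqrt (1 / 2) ^ L"
proof -
  define q where "q = sqrt (1 / 2 :: real)"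
  \<comment> \<open>a potential whose decrement from one level to the next dominates the increment bound, so that the chain telescopes\<close>
  define B where "B = (\<lambda>l::nat. 4 * A * (real l + 10) * q ^ l)"
  have q: "0 < q" "q \<le> 3 / 4"
    unfolding q_def by (simp, rule real_le_lsqrt) (auto simp: power2_eq_square)
  have adjacent: "\<bar>F u - F v\<bar> \<le> A * (real l + 2) * q ^ l"
    if uv: "u = of_int i / 2 ^ l" "v = of_int j / 2 ^ l" "i \<le> j" "j \<le> i + 1" "0 \<le> u" "v \<le> 1" for u v l i j
  proof (cases "i = j")
    case True then show ?thesis using uv A q by simp
  next
    case False
    then have j: "j = i + 1" using uv by simp
    have "0 \<le> u * 2 ^ l" using uv(5) by simp
    then have i: "0 \<le> i" using uv(1) by simp
    define m where "m = nat i"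
    have m: "of_int i = real m" unfolding m_def using i by simp
    have "v * 2 ^ l \<le> 1 * 2 ^ l" using uv(6) by (intro mult_right_mono) auto
    then have "real m + 1 \<le> 2 ^ l" using uv(2) m unfolding j by simp
    then have "real (Suc m) \<le> real (2 ^ l)" by simp
    then have "m < 2 ^ l" unfolding of_nat_le_iff by simp
    from inc[OF this] show ?thesis
      unfolding uv(1,2) j q_def using m by (simp add: abs_minus_commute)
  qed
  have range: "0 \<le> dyadic_floor l s" "dyadic_floor l s \<le> 1" if "s \<in> {0..1}" for l s
    using that order_trans[OF dyadic_floor_bounds(1)[of l s], of 1] by (auto simp: dyadic_floor_def)
  have step: "\<bar>F (dyadic_floor l s) - F (dyadic_floor (Suc l) s)\<bar> \<le> A * (real l + 3) * q ^ Suc l"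
    if "s \<in> {0..1}" for l s
  proof -
    have eq: "dyadic_floor l s = of_int (2 * \<lfloor>s * 2 ^ l\<rfloor>) / 2 ^ Suc l" unfolding dyadic_floor_def by simp
    have fl: "2 * \<lfloor>s * 2 ^ l\<rfloor> \<le> \<lfloor>s * 2 ^ Suc l\<rfloor>" "\<lfloor>s * 2 ^ Suc l\<rfloor> \<le> 2 * \<lfloor>s * 2 ^ l\<rfloor> + 1"
      by (simp_all add: mult.left_commute[of s]) linarith+
    have eq': "dyadic_floor (Suc l) s = of_int \<lfloor>s * 2 ^ Suc l\<rfloor> / 2 ^ Suc l" by (simp only: dyadic_floor_def)
    show ?thesis
      using adjacent[OF eq eq' fl range(1)[OF that] range(2)[OF that]] by (simp add: algebra_simps)
  qed
  have decr: "A * (real l + 3) * q ^ Suc l \<le> B l - B (Suc l)" for l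
  proof -
    have "q * (real l * 5 + 47) \<le> 3 / 4 * (real l * 5 + 47)" using q by (intro mult_right_mono) auto
    then have "q * (real l + 3) \<le> 4 * (real l + 10) - 4 * (real l + 11) * q" by (simp add: algebra_simps)
    then have "A * q ^ l * (q * (real l + 3)) \<le> A * q ^ l * (4 * (real l + 10) - 4 * (real l + 11) * q)"
      using A q by (intro mult_left_mono) auto
    then show ?thesis unfolding B_def by (simp add: algebra_simps)
  qed
  have B0: "0 \<le> B l" for l unfolding B_def using A q by simp
  have chain: "\<bar>F (dyadic_floor L s) - F (dyadic_floor (L + j) s)\<bar> \<le> B L - B (L + j)" if "s \<in> {0..1}" for s j
  proof (induction j)
    case (Suc j)
    then show ?case using step[OF that, of "L + j"] decr[of "L + j"] by simp
  qed simp
  have limit: "\<bar>F (dyadic_floor L s) - F s\<bar> \<le> B L" if s: "s \<in> {0..1}" for s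
  proof -
    have "(\<lambda>j. F (dyadic_floor (L + j) s)) \<longlonglongrightarrow> F s"
      by (rule continuous_on_tendsto_compose[OF cont])
         (use range s LIMSEQ_ignore_initial_segment[OF dyadic_floor_tendsto, of L s] in \<open>auto simp: add.commute\<close>)
    then have "(\<lambda>j. \<bar>F (dyadic_floor L s) - F (dyadic_floor (L + j) s)\<bar>) \<longlonglongrightarrow> \<bar>F (dyadic_floor L s) - F s\<bar>"
      by (intro tendsto_intros)
    then show ?thesis
      by (rule LIMSEQ_le_const2) (use chain[OF s] B0 in \<open>auto intro!: exI[of _ 0] order_trans[OF chain[OF s]]\<close>)
  qed
  have near: "\<bar>F (dyadic_floor L s) - F (dyadic_floor L s')\<bar> \<le> B L"
    if s: "s \<in> {0..1}" "s' \<in> {0..1}" "s \<le> s'" "s' - s \<le> 1 / 2 ^ L" for s s'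
  proof -
    have "s * 2 ^ L \<le> s' * 2 ^ L" using s by simp
    moreover have "s' * 2 ^ L \<le> s * 2 ^ L + 1" using s by (simp add: field_simps)
    ultimately have "\<lfloor>s * 2 ^ L\<rfloor> \<le> \<lfloor>s' * 2 ^ L\<rfloor>" "\<lfloor>s' * 2 ^ L\<rfloor> \<le> \<lfloor>s * 2 ^ L\<rfloor> + 1"
      by linarith+
    then have "\<bar>F (dyadic_floor L s) - F (dyadic_floor L s')\<bar> \<le> A * (real L + 2) * q ^ L"
      using range s unfolding dyadic_floor_def by (intro adjacent) auto
    also have "\<dots> \<le> B L" unfolding B_def using A q by (intro mult_right_mono) (auto intro: mult_mono simp: algebra_simps)
    finally show ?thesis .
  qed
  have "\<bar>F (dyadic_floor L s) - F (dyadic_floor L s')\<bar> \<le> B L"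
  proof (cases "s \<le> s'")
    case True then show ?thesis using near s by auto
  next
    case False then show ?thesis using near[of s' s] s by (auto simp: abs_minus_commute)
  qed
  with limit[OF s(1)] limit[OF s(2)] have "\<bar>F s - F s'\<bar> \<le> 3 * B L" by linarith
  then show ?thesis unfolding B_def q_def by simp
qed

section \<open>Exponential inequalities for squared Gaussian noise\<close>

text \<open>The cumulant bound behind the sub-gamma property of centred chi-square variables.\<close>

lemma neg_ln_one_minus_le:
  fixes u :: real
  assumes "\<bar>u\<bar> < 1"
  shows "- ln (1 - u) \<le> u + u\<^sup>2 / (2 * (1 - \<bar>u\<bar>))"
proof (cases "0 \<le> u")
  case True
  define g where "g = (\<lambda>u::real. u + (inverse (1 - u) - 1 - u) / 2 + ln (1 - u))"
  have "g 0 \<le> g u"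
  proof (rule DERIV_nonneg_imp_nondecreasing[OF True])
    fix x assume x: "0 \<le> x" "x \<le> u"
    then have x1: "x < 1" using assms True by auto
    have lin: "((\<lambda>u. 1 - u) has_real_derivative - 1) (at x)"
      using DERIV_diff[OF DERIV_const[of 1] DERIV_ident] by simp
    have d1: "((\<lambda>u. inverse (1 - u)) has_real_derivative inverse (1 - x) * inverse (1 - x)) (at x)"
      using DERIV_inverse'[OF lin] x1 by simp
    have d2: "((\<lambda>u. ln (1 - u)) has_real_derivative - inverse (1 - x)) (at x)"
      using DERIV_chain2[OF DERIV_ln lin] x1 by simp
    have "(g has_real_derivative 1 + (inverse (1 - x) * inverse (1 - x) - 1) / 2 - inverse (1 - x)) (at x)"
      using DERIV_add[OF DERIV_add[OF DERIV_ident DERIV_cdivide[OF DERIV_diff[OF DERIV_diff[OF d1 DERIV_const[of 1]] DERIV_ident], of 2]] d2]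
      unfolding g_def by simp
    moreover have "1 + (v * v - 1) / 2 - v = (1 - v)\<^sup>2 / 2" for v :: real
      by (simp add: power2_eq_square field_simps)
    ultimately have "(g has_real_derivative (1 - inverse (1 - x))\<^sup>2 / 2) (at x)" by simp
    then show "\<exists>y. (g has_real_derivative y) (at x) \<and> 0 \<le> y" by (intro exI[of _ "(1 - inverse (1 - x))\<^sup>2 / 2"]) auto
  qed
  moreover have "g u = u + u\<^sup>2 / (2 * (1 - \<bar>u\<bar>)) + ln (1 - u)"
    using True assms unfolding g_def by (simp add: divide_simps power2_eq_square) (simp add: algebra_simps)
  ultimately show ?thesis unfolding g_def by simp
next
  case False
  define w where "w = - u"
  have w: "0 \<le> w" "w < 1" using False assms unfolding w_def by auto
  define g where "g = (\<lambda>w::real. ln (1 + w) - w + w\<^sup>2 / 2)"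
  have "g 0 \<le> g w"
  proof (rule DERIV_nonneg_imp_nondecreasing[OF w(1)])
    fix x assume x: "0 \<le> x" "x \<le> w"
    have "(g has_real_derivative 1 / (1 + x) - 1 + x) (at x)"
      unfolding g_def using x by (auto intro!: derivative_eq_intros)
    moreover have "1 / (1 + x) - 1 + x = x\<^sup>2 / (1 + x)"
      using x by (simp add: field_simps power2_eq_square)
    ultimately show "\<exists>y. (g has_real_derivative y) (at x) \<and> 0 \<le> y" using x by auto
  qed
  then have "- ln (1 + w) \<le> - w + w\<^sup>2 / 2" unfolding g_def by simp
  also have "w\<^sup>2 / 2 \<le> w\<^sup>2 / (2 * (1 - w))" using w by (intro divide_left_mono) auto
  finally show ?thesis using False unfolding w_def by simp
qed

context prob_space
begin

text \<open>Multiplying a centred normal density by \<open>exp (\<theta> (x/\<sigma>)\<^sup>2)\<close> gives a multiple of another centred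
  normal density, with variance \<open>\<sigma>\<^sup>2 / (1 - 2\<theta>)\<close>.\<close>

lemma normal_square_exponential_moment:
  assumes X: "distributed M lborel X (normal_density 0 \<sigma>)" and \<sigma>: "0 < \<sigma>" and \<theta>: "2 * \<theta> < 1"
  shows "integrable M (\<lambda>\<omega>. exp (\<theta> * (X \<omega> / \<sigma>)\<^sup>2))"
    and "expectation (\<lambda>\<omega>. exp (\<theta> * (X \<omega> / \<sigma>)\<^sup>2)) = 1 / sqrt (1 - 2 * \<theta>)"
proof -
  define \<tau> where "\<tau> = \<sigma> / sqrt (1 - 2 * \<theta>)"
  have \<tau>: "0 < \<tau>" unfolding \<tau>_def using \<sigma> \<theta> by simp
  have eq: "normal_density 0 \<sigma> x * exp (\<theta> * (x / \<sigma>)\<^sup>2) = 1 / sqrt (1 - 2 * \<theta>) * normal_density 0 \<tau> x" for x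
  proof -
    have "exp (- (x\<^sup>2) / (2 * \<sigma>\<^sup>2)) * exp (\<theta> * (x / \<sigma>)\<^sup>2) = exp (- (x\<^sup>2) / (2 * \<tau>\<^sup>2))"
      unfolding exp_add[symmetric] \<tau>_def using \<sigma> \<theta> by (simp add: power_divide field_simps)
    moreover have "1 / sqrt (2 * pi * \<sigma>\<^sup>2) = 1 / sqrt (1 - 2 * \<theta>) * (1 / sqrt (2 * pi * \<tau>\<^sup>2))"
      unfolding \<tau>_def using \<sigma> \<theta> by (simp add: power_divide real_sqrt_divide real_sqrt_mult field_simps)
    ultimately show ?thesis unfolding normal_density_def by (simp add: mult.assoc)
  qed
  have m: "(\<lambda>x. exp (\<theta> * (x / \<sigma>)\<^sup>2)) \<in> borel_measurable lborel" by measurable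
  have int: "integrable lborel (\<lambda>x. normal_density 0 \<sigma> x * exp (\<theta> * (x / \<sigma>)\<^sup>2))"
    unfolding eq using \<tau> by (intro integrable_mult_right) simp
  show "integrable M (\<lambda>\<omega>. exp (\<theta> * (X \<omega> / \<sigma>)\<^sup>2))"
    using distributed_integrable[OF X m] int by simp
  have "expectation (\<lambda>\<omega>. exp (\<theta> * (X \<omega> / \<sigma>)\<^sup>2)) = (\<integral>x. normal_density 0 \<sigma> x * exp (\<theta> * (x / \<sigma>)\<^sup>2) \<partial>lborel)"
    using distributed_integral[OF X m] by simp
  also have "\<dots> = 1 / sqrt (1 - 2 * \<theta>)" unfolding eq using \<tau> by simp
  finally show "expectation (\<lambda>\<omega>. exp (\<theta> * (X \<omega> / \<sigma>)\<^sup>2)) = 1 / sqrt (1 - 2 * \<theta>)" .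
qed

lemma chi_square_exponential_moment:
  assumes X: "distributed M lborel X (normal_density 0 \<sigma>)" and \<sigma>: "0 < \<sigma>" and \<theta>: "2 * \<bar>\<theta>\<bar> < 1"
  shows "integrable M (\<lambda>\<omega>. exp (\<theta> * ((X \<omega> / \<sigma>)\<^sup>2 - 1)))"
    and "expectation (\<lambda>\<omega>. exp (\<theta> * ((X \<omega> / \<sigma>)\<^sup>2 - 1))) \<le> exp (\<theta>\<^sup>2 / (1 - 2 * \<bar>\<theta>\<bar>))"
proof -
  have \<theta>': "2 * \<theta> < 1" using \<theta> by linarith
  have eq: "exp (\<theta> * ((X \<omega> / \<sigma>)\<^sup>2 - 1)) = exp (\<theta> * (X \<omega> / \<sigma>)\<^sup>2) * exp (- \<theta>)" for \<omega>
    by (simp add: exp_add[symmetric] algebra_simps)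
  show "integrable M (\<lambda>\<omega>. exp (\<theta> * ((X \<omega> / \<sigma>)\<^sup>2 - 1)))"
    unfolding eq by (intro integrable_mult_left normal_square_exponential_moment[OF X \<sigma> \<theta>'])
  have "expectation (\<lambda>\<omega>. exp (\<theta> * ((X \<omega> / \<sigma>)\<^sup>2 - 1))) = exp (- \<theta>) / sqrt (1 - 2 * \<theta>)"
    unfolding eq using normal_square_exponential_moment[OF X \<sigma> \<theta>'] by simp
  also have "\<dots> = exp (- \<theta> - ln (1 - 2 * \<theta>) / 2)"
    using \<theta>' by (simp add: exp_diff ln_sqrt[symmetric])
  also have "\<dots> \<le> exp (\<theta>\<^sup>2 / (1 - 2 * \<bar>\<theta>\<bar>))"
  proof -
    have "- ln (1 - 2 * \<theta>) \<le> 2 * \<theta> + (2 * \<theta>)\<^sup>2 / (2 * (1 - \<bar>2 * \<theta>\<bar>))"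
      by (rule neg_ln_one_minus_le) (use \<theta> in auto)
    also have "(2 * \<theta>)\<^sup>2 / (2 * (1 - \<bar>2 * \<theta>\<bar>)) = 2 * (\<theta>\<^sup>2 / (1 - 2 * \<bar>\<theta>\<bar>))"
      using \<theta> by (simp add: power2_eq_square abs_mult divide_simps)
    finally show ?thesis by simp
  qed
  finally show "expectation (\<lambda>\<omega>. exp (\<theta> * ((X \<omega> / \<sigma>)\<^sup>2 - 1))) \<le> exp (\<theta>\<^sup>2 / (1 - 2 * \<bar>\<theta>\<bar>))" .
qed

text \<open>Keeps the volatility estimator away from zero for small \<open>n\<close>, where the law of large numbers does
  not.\<close>

lemma normal_small_ball:
  assumes X: "distributed M lborel X (normal_density 0 \<sigma>)" and \<sigma>: "0 < \<sigma>" and s: "0 \<le> s"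
  shows "prob {\<omega>\<in>space M. (X \<omega> / \<sigma>)\<^sup>2 < s} \<le> 2 * sqrt s"
proof -
  let ?J = "{- \<sigma> * sqrt s..\<sigma> * sqrt s}"
  have Xm: "X \<in> borel_measurable M" using distributed_measurable[OF X] by simp
  have "prob {\<omega>\<in>space M. (X \<omega> / \<sigma>)\<^sup>2 < s} \<le> prob (X -` ?J \<inter> space M)"
  proof (rule finite_measure_mono)
    show "{\<omega>\<in>space M. (X \<omega> / \<sigma>)\<^sup>2 < s} \<subseteq> X -` ?J \<inter> space M"
    proof
      fix \<omega> assume \<omega>: "\<omega> \<in> {\<omega>\<in>space M. (X \<omega> / \<sigma>)\<^sup>2 < s}"
      then have "sqrt ((X \<omega> / \<sigma>)\<^sup>2) \<le> sqrt s" by (intro real_sqrt_le_mono) auto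
      then have "\<bar>X \<omega> / \<sigma>\<bar> \<le> sqrt s" unfolding real_sqrt_abs .
      then have "\<bar>X \<omega>\<bar> \<le> \<sigma> * sqrt s" using \<sigma> by (simp add: field_simps)
      then show "\<omega> \<in> X -` ?J \<inter> space M" using \<omega> by auto
    qed
  qed (use Xm in measurable)
  also have "\<dots> = (\<integral>x. normal_density 0 \<sigma> x * indicator ?J x \<partial>lborel)"
  proof -
    have "(\<integral>x. normal_density 0 \<sigma> x * indicator ?J x \<partial>lborel) = expectation (\<lambda>\<omega>. indicator ?J (X \<omega>))"
      by (rule distributed_integral[OF X]) auto
    also have "\<dots> = expectation (indicator (X -` ?J \<inter> space M))"
      by (rule Bochner_Integration.integral_cong) (auto simp: indicator_def)
    finally show ?thesis using Xm by simp
  qed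
  also have "\<dots> \<le> (\<integral>x. 1 / \<sigma> * indicator ?J x \<partial>lborel)"
  proof (rule integral_mono)
    show "integrable lborel (\<lambda>x. normal_density 0 \<sigma> x * indicat_real ?J x)"
      using \<sigma> by (intro integrable_real_mult_indicator) auto
    fix x
    have "1 \<le> sqrt (2 * pi)" using pi_ge_two by simp
    then have "1 / (sqrt (2 * pi) * \<sigma>) \<le> 1 / \<sigma>" using \<sigma> by (intro divide_left_mono) auto
    moreover have "normal_density 0 \<sigma> x \<le> 1 / (sqrt (2 * pi) * \<sigma>) * 1"
      unfolding normal_density_def using \<sigma> by (intro mult_mono) (auto simp: real_sqrt_mult)
    ultimately show "normal_density 0 \<sigma> x * indicat_real ?J x \<le> 1 / \<sigma> * indicat_real ?J x"
      by (intro mult_right_mono) auto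
  qed (intro integrable_mult_right integrable_real_indicator, auto simp: emeasure_lborel_Icc_eq)
  also have "\<dots> = 2 * sqrt s" using \<sigma> s by simp
  finally show ?thesis .
qed

end

text \<open>The stochastic input of all later estimates: independence and the exponential moments of a centred
  chi-square variable as upper bounds.\<close>

locale subgamma_noise = prob_space M for M :: "'a measure" +
  fixes n :: nat and y :: "nat \<Rightarrow> 'a \<Rightarrow> real"
  assumes n_pos: "1 \<le> n"
    and indep: "indep_vars (\<lambda>_. borel) y {1..n}"
    and moment_integrable: "\<And>k \<theta>. k \<in> {1..n} \<Longrightarrow> 2 * \<bar>\<theta>\<bar> < 1 \<Longrightarrow> integrable M (\<lambda>\<omega>. exp (\<theta> * y k \<omega>))"
    and moment_le: "\<And>k \<theta>. k \<in> {1..n} \<Longrightarrow> 2 * \<bar>\<theta>\<bar> < 1 \<Longrightarrow>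
      expectation (\<lambda>\<omega>. exp (\<theta> * y k \<omega>)) \<le> exp (\<theta>\<^sup>2 / (1 - 2 * \<bar>\<theta>\<bar>))"
begin

lemma noise_measurable: "k \<in> {1..n} \<Longrightarrow> y k \<in> borel_measurable M"
  using indep unfolding indep_vars_def by auto

text \<open>Chernoff's method. The factor \<open>2 b x\<close> in the threshold reflects that the exponential moments exist
  only up to \<open>1 / (2b)\<close>.\<close>

lemma weighted_sum_upper_tail:
  assumes v: "0 < v" "(\<Sum>k=1..n. (a k)\<^sup>2) \<le> v" and b: "\<And>k. k \<in> {1..n} \<Longrightarrow> \<bar>a k\<bar> \<le> b" and x: "0 \<le> x"
  shows "prob {\<omega>\<in>space M. 2 * sqrt (v * x) + 2 * b * x \<le> (\<Sum>k=1..n. a k * y k \<omega>)} \<le> exp (- x)"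
proof -
  have b0: "0 \<le> b" using b[of 1] n_pos by auto
  define w where "w = sqrt v"
  define z where "z = sqrt x"
  have wz: "0 < w" "0 \<le> z" "v = w\<^sup>2" "x = z\<^sup>2" unfolding w_def z_def using v x by auto
  \<comment> \<open>with this exponent the Chernoff bound is exactly \<open>exp (- x)\<close>\<close>
  define \<theta> where "\<theta> = z / (w + 2 * b * z)"
  define t where "t = 2 * sqrt (v * x) + 2 * b * x"
  have D: "0 < w + 2 * b * z" using wz b0 by (intro add_pos_nonneg) auto
  have \<theta>0: "0 \<le> \<theta>" unfolding \<theta>_def using wz D by simp
  have \<theta>b: "1 - 2 * b * \<theta> = w / (w + 2 * b * z)" unfolding \<theta>_def using D by (simp add: field_simps)
  have small: "2 * \<bar>\<theta> * a k\<bar> \<le> 2 * b * \<theta>" "2 * \<bar>\<theta> * a k\<bar> < 1" if "k \<in> {1..n}" for k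
  proof -
    have "\<theta> * \<bar>a k\<bar> \<le> \<theta> * b" using b[OF that] \<theta>0 by (rule mult_left_mono)
    then show "2 * \<bar>\<theta> * a k\<bar> \<le> 2 * b * \<theta>" using \<theta>0 by (simp add: abs_mult mult.commute)
    moreover have "0 < 1 - 2 * b * \<theta>" unfolding \<theta>b using wz D by simp
    ultimately show "2 * \<bar>\<theta> * a k\<bar> < 1" by linarith
  qed
  have ind: "indep_vars (\<lambda>_. borel) (\<lambda>k \<omega>. exp (\<theta> * a k * y k \<omega>)) {1..n}"
    by (rule indep_vars_compose2[OF indep, where Y = "\<lambda>k u. exp (\<theta> * a k * u)"]) auto
  have prod_eq: "exp (\<theta> * (\<Sum>k=1..n. a k * y k \<omega>)) = (\<Prod>k=1..n. exp (\<theta> * a k * y k \<omega>))" for \<omega>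
    by (simp add: exp_sum[symmetric] sum_distrib_left mult.assoc)
  have int: "integrable M (\<lambda>\<omega>. exp (\<theta> * (\<Sum>k=1..n. a k * y k \<omega>)))"
    unfolding prod_eq by (rule indep_vars_integrable[OF _ ind]) (use moment_integrable small in auto)
  have "expectation (\<lambda>\<omega>. exp (\<theta> * (\<Sum>k=1..n. a k * y k \<omega>))) = (\<Prod>k=1..n. expectation (\<lambda>\<omega>. exp (\<theta> * a k * y k \<omega>)))"
    unfolding prod_eq by (rule indep_vars_lebesgue_integral[OF _ ind]) (use moment_integrable small in auto)
  also have "\<dots> \<le> (\<Prod>k=1..n. exp ((\<theta> * a k)\<^sup>2 / (1 - 2 * b * \<theta>)))"
  proof (rule prod_mono, rule conjI)
    fix k assume k: "k \<in> {1..n}"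
    show "0 \<le> expectation (\<lambda>\<omega>. exp (\<theta> * a k * y k \<omega>))" by (rule integral_nonneg_AE) simp
    have "expectation (\<lambda>\<omega>. exp (\<theta> * a k * y k \<omega>)) \<le> exp ((\<theta> * a k)\<^sup>2 / (1 - 2 * \<bar>\<theta> * a k\<bar>))"
      by (rule moment_le) (use small k in auto)
    also have "\<dots> \<le> exp ((\<theta> * a k)\<^sup>2 / (1 - 2 * b * \<theta>))"
    proof -
      have "0 < 1 - 2 * b * \<theta>" unfolding \<theta>b using wz D by simp
      then have "(\<theta> * a k)\<^sup>2 / (1 - 2 * \<bar>\<theta> * a k\<bar>) \<le> (\<theta> * a k)\<^sup>2 / (1 - 2 * b * \<theta>)"
        using small[OF k] by (intro divide_left_mono mult_pos_pos) auto
      then show ?thesis by simp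
    qed
    finally show "expectation (\<lambda>\<omega>. exp (\<theta> * a k * y k \<omega>)) \<le> exp ((\<theta> * a k)\<^sup>2 / (1 - 2 * b * \<theta>))" .
  qed
  also have "\<dots> = exp (\<theta>\<^sup>2 * (\<Sum>k=1..n. (a k)\<^sup>2) / (1 - 2 * b * \<theta>))"
    by (simp add: exp_sum[symmetric] power_mult_distrib sum_distrib_left sum_divide_distrib)
  also have "\<dots> \<le> exp (\<theta>\<^sup>2 * v / (1 - 2 * b * \<theta>))"
  proof -
    have "\<theta>\<^sup>2 * (\<Sum>k=1..n. (a k)\<^sup>2) \<le> \<theta>\<^sup>2 * v" using v by (intro mult_left_mono) auto
    moreover have "0 < 1 - 2 * b * \<theta>" unfolding \<theta>b using wz D by simp
    ultimately show ?thesis by (simp add: divide_right_mono)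
  qed
  finally have E: "expectation (\<lambda>\<omega>. exp (\<theta> * (\<Sum>k=1..n. a k * y k \<omega>))) \<le> exp (\<theta>\<^sup>2 * v / (1 - 2 * b * \<theta>))" .
  have expo: "\<theta>\<^sup>2 * v / (1 - 2 * b * \<theta>) - \<theta> * t = - x"
  proof -
    have "sqrt (v * x) = w * z" unfolding wz using wz by (simp add: real_sqrt_mult)
    then have t: "t = 2 * w * z + 2 * b * z\<^sup>2" unfolding t_def wz(4) by simp
    have "\<theta>\<^sup>2 * v / (1 - 2 * b * \<theta>) = z\<^sup>2 * w / (w + 2 * b * z)"
      unfolding \<theta>b wz(3) unfolding \<theta>_def using wz D by (simp add: power2_eq_square divide_simps)
    moreover have "\<theta> * t = z\<^sup>2 * (2 * w + 2 * b * z) / (w + 2 * b * z)"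
    proof -
      have "z * (2 * w * z + 2 * b * z\<^sup>2) = z\<^sup>2 * (2 * w + 2 * b * z)" by (simp add: power2_eq_square algebra_simps)
      then show ?thesis unfolding \<theta>_def t times_divide_eq_left by simp
    qed
    ultimately have "\<theta>\<^sup>2 * v / (1 - 2 * b * \<theta>) - \<theta> * t = (z\<^sup>2 * w - z\<^sup>2 * (2 * w + 2 * b * z)) / (w + 2 * b * z)"
      by (simp add: diff_divide_distrib)
    also have "\<dots> = - z\<^sup>2" using D by (simp add: field_simps)
    finally show ?thesis unfolding wz(4) .
  qed
  have "{\<omega>\<in>space M. t \<le> (\<Sum>k=1..n. a k * y k \<omega>)} \<subseteq> {\<omega>\<in>space M. exp (\<theta> * t) \<le> exp (\<theta> * (\<Sum>k=1..n. a k * y k \<omega>))}"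
    using \<theta>0 by (auto intro: mult_left_mono)
  then have "prob {\<omega>\<in>space M. t \<le> (\<Sum>k=1..n. a k * y k \<omega>)}
     \<le> prob {\<omega>\<in>space M. exp (\<theta> * t) \<le> exp (\<theta> * (\<Sum>k=1..n. a k * y k \<omega>))}"
    by (rule finite_measure_mono) (use borel_measurable_integrable[OF int] in measurable)
  also have "\<dots> \<le> expectation (\<lambda>\<omega>. exp (\<theta> * (\<Sum>k=1..n. a k * y k \<omega>))) / exp (\<theta> * t)"
    by (rule integral_Markov_inequality_measure[OF int, where A = "{}"]) auto
  also have "\<dots> \<le> exp (\<theta>\<^sup>2 * v / (1 - 2 * b * \<theta>)) / exp (\<theta> * t)" using E by (simp add: divide_right_mono)
  also have "\<dots> = exp (- x)" unfolding exp_diff[symmetric] expo ..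
  finally show ?thesis unfolding t_def .
qed

lemma weighted_sum_tail:
  assumes v: "0 < v" "(\<Sum>k=1..n. (a k)\<^sup>2) \<le> v" and b: "\<And>k. k \<in> {1..n} \<Longrightarrow> \<bar>a k\<bar> \<le> b" and x: "0 \<le> x"
  shows "prob {\<omega>\<in>space M. 2 * sqrt (v * x) + 2 * b * x \<le> \<bar>\<Sum>k=1..n. a k * y k \<omega>\<bar>} \<le> 2 * exp (- x)"
proof -
  let ?t = "2 * sqrt (v * x) + 2 * b * x"
  let ?S = "\<lambda>\<omega>. \<Sum>k=1..n. a k * y k \<omega>"
  have meas[measurable]: "?S \<in> borel_measurable M"
    by (intro borel_measurable_sum borel_measurable_times noise_measurable) auto
  have "prob {\<omega>\<in>space M. ?t \<le> \<bar>?S \<omega>\<bar>} \<le> prob ({\<omega>\<in>space M. ?t \<le> ?S \<omega>} \<union> {\<omega>\<in>space M. ?t \<le> - ?S \<omega>})"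
  proof (rule finite_measure_mono)
    show "{\<omega>\<in>space M. ?t \<le> ?S \<omega>} \<union> {\<omega>\<in>space M. ?t \<le> - ?S \<omega>} \<in> events" by measurable
  qed (auto simp: abs_real_def split: if_splits)
  also have "\<dots> \<le> prob {\<omega>\<in>space M. ?t \<le> ?S \<omega>} + prob {\<omega>\<in>space M. ?t \<le> - ?S \<omega>}"
    by (rule measure_Un_le) measurable
  also have "prob {\<omega>\<in>space M. ?t \<le> ?S \<omega>} \<le> exp (- x)" by (rule weighted_sum_upper_tail) (use assms in auto)
  also have "prob {\<omega>\<in>space M. ?t \<le> - ?S \<omega>} \<le> exp (- x)"
    using weighted_sum_upper_tail[of v "\<lambda>k. - a k" b x] assms by (simp add: sum_negf)
  finally show ?thesis by simp
qed

end

section \<open>Oscillation of the random walk\<close>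

lemma multiscale_union_bound:
  fixes A :: "nat \<Rightarrow> 'i \<Rightarrow> 'a set"
  assumes M: "prob_space M" and fin: "\<And>j. finite (I j)"
    and A: "\<And>j i. i \<in> I j \<Longrightarrow> A j i \<in> sets M"
    and p: "\<And>j i. i \<in> I j \<Longrightarrow> measure M (A j i) \<le> p j"
    and s: "\<And>j. real (card (I j)) * p j \<le> s j" and sum: "summable s"
  shows "(\<Union>j. \<Union>i\<in>I j. A j i) \<in> sets M" "measure M (\<Union>j. \<Union>i\<in>I j. A j i) \<le> suminf s"
proof -
  interpret prob_space M by fact
  have meas: "(\<Union>i\<in>I j. A j i) \<in> sets M" for j using fin A by auto
  then show "(\<Union>j. \<Union>i\<in>I j. A j i) \<in> sets M" by auto
  have level: "prob (\<Union>i\<in>I j. A j i) \<le> s j" for j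
  proof -
    have "prob (\<Union>i\<in>I j. A j i) \<le> (\<Sum>i\<in>I j. prob (A j i))"
      by (rule measure_UNION_le) (use fin A in auto)
    also have "\<dots> \<le> real (card (I j)) * p j"
      by (rule sum_bounded_above) (rule p)
    finally show ?thesis using s[of j] by linarith
  qed
  have sm: "summable (\<lambda>j. prob (\<Union>i\<in>I j. A j i))"
    by (rule summable_comparison_test'[OF sum, of 0]) (use level in auto)
  have "prob (\<Union>j. \<Union>i\<in>I j. A j i) \<le> (\<Sum>j. prob (\<Union>i\<in>I j. A j i))"
    by (rule finite_measure_subadditive_countably) (use meas sm in auto)
  also have "\<dots> \<le> suminf s" by (rule suminf_le[OF level sm sum])
  finally show "prob (\<Union>j. \<Union>i\<in>I j. A j i) \<le> suminf s" .
qed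

lemma ramp_mono: "u \<le> v \<Longrightarrow> ramp u \<le> ramp v"
  unfolding ramp_def by (auto simp: max_def min_def)

lemma ramp_diff_le: "u \<le> v \<Longrightarrow> ramp v - ramp u \<le> min 1 (v - u)"
  unfolding ramp_def by (auto simp: max_def min_def)

lemma sum_ramp: "0 \<le> u \<Longrightarrow> (\<Sum>k=1..n. ramp (u - (real k - 1))) = min u (real n)"
  by (induction n) (auto simp: ramp_def max_def min_def)

lemma continuous_walk: "continuous_on A (walk n y)"
  unfolding walk_def ramp_def by (intro continuous_intros)

lemma walk_zero: "walk n y 0 = 0"
  unfolding walk_def ramp_def by (intro sum.neutral) auto

lemma walk_one: "walk n y 1 = (\<Sum>k=1..n. y k)"
  unfolding walk_def ramp_def by (intro sum.cong) auto

context subgamma_noise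
begin

text \<open>An increment over length \<open>s' - s\<close> is a weighted sum with weights at most \<open>min 1 N\<close> and sum of squares
  at most \<open>N = n (s' - s)\<close>. Because of \<open>min 1 N \<le> \<surd>N\<close> one bound covers both intervals of many cells and
  intervals inside a single cell.\<close>

lemma walk_increment_tail:
  assumes s: "0 \<le> s" "s < s'" "s' \<le> 1" and x: "1 \<le> x"
  shows "prob {\<omega>\<in>space M. 4 * sqrt (real n * (s' - s)) * x \<le> \<bar>walk n (\<lambda>k. y k \<omega>) s' - walk n (\<lambda>k. y k \<omega>) s\<bar>}
    \<le> 2 * exp (- x)"
proof -
  define a where "a = (\<lambda>k::nat. ramp (real n * s' - (real k - 1)) - ramp (real n * s - (real k - 1)))"
  define N where "N = real n * (s' - s)"
  have n0: "0 < real n" using n_pos by simp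
  have N0: "0 < N" unfolding N_def using s n0 by simp
  have le: "real n * s \<le> real n * s'" using s n0 by simp
  have a0: "0 \<le> a k" and aN: "a k \<le> min 1 N" for k
    unfolding a_def N_def using ramp_mono[of "real n * s - (real k - 1)" "real n * s' - (real k - 1)"]
      ramp_diff_le[of "real n * s - (real k - 1)" "real n * s' - (real k - 1)"] le
    by (auto simp: right_diff_distrib)
  have min1: "min 1 N \<le> sqrt N"
  proof (cases "N \<le> 1")
    case True
    have "N\<^sup>2 \<le> N" using True N0 by (simp add: power2_eq_square mult_le_cancel_left1)
    then show ?thesis using True by (auto intro: real_le_rsqrt)
  next
    case False
    then show ?thesis by (auto simp: min_def)
  qed
  have sum_a: "(\<Sum>k=1..n. a k) \<le> N"
  proof -
    have "(\<Sum>k=1..n. a k) = min (real n * s') (real n) - min (real n * s) (real n)"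
      unfolding a_def sum_subtractf using s n0 by (subst (1 2) sum_ramp) auto
    also have "\<dots> = N" unfolding N_def using s n0 by (auto simp: min_def right_diff_distrib mult_le_cancel_left1)
    finally show ?thesis by simp
  qed
  have "(\<Sum>k=1..n. (a k)\<^sup>2) \<le> (\<Sum>k=1..n. a k)"
    by (rule sum_mono) (use a0 aN in \<open>auto simp: power2_eq_square intro!: mult_left_le\<close>)
  then have sq: "(\<Sum>k=1..n. (a k)\<^sup>2) \<le> N" using sum_a by linarith
  have ab: "\<bar>a k\<bar> \<le> min 1 N" for k using a0 aN by simp
  have diff: "walk n (\<lambda>k. y k \<omega>) s' - walk n (\<lambda>k. y k \<omega>) s = (\<Sum>k=1..n. a k * y k \<omega>)" for \<omega>
    unfolding walk_def a_def sum_subtractf[symmetric] by (simp add: algebra_simps)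
  have meas[measurable]: "(\<lambda>\<omega>. \<Sum>k=1..n. a k * y k \<omega>) \<in> borel_measurable M"
    by (intro borel_measurable_sum borel_measurable_times noise_measurable) auto
  have thr: "2 * sqrt (N * x) + 2 * min 1 N * x \<le> 4 * sqrt N * x"
  proof -
    have "sqrt x \<le> x" using x by (intro real_le_lsqrt) (auto simp: power2_eq_square mult_le_cancel_left1)
    then have "sqrt N * sqrt x \<le> sqrt N * x" using N0 by (intro mult_left_mono) auto
    moreover have "min 1 N * x \<le> sqrt N * x" using min1 x by (intro mult_right_mono) auto
    ultimately show ?thesis by (simp add: real_sqrt_mult)
  qed
  have "prob {\<omega>\<in>space M. 4 * sqrt N * x \<le> \<bar>\<Sum>k=1..n. a k * y k \<omega>\<bar>}
     \<le> prob {\<omega>\<in>space M. 2 * sqrt (N * x) + 2 * min 1 N * x \<le> \<bar>\<Sum>k=1..n. a k * y k \<omega>\<bar>}"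
  proof (rule finite_measure_mono)
    show "{\<omega>\<in>space M. 2 * sqrt (N * x) + 2 * min 1 N * x \<le> \<bar>\<Sum>k=1..n. a k * y k \<omega>\<bar>} \<in> events" by measurable
  qed (use thr in auto)
  also have "\<dots> \<le> 2 * exp (- x)"
    by (rule weighted_sum_tail) (use N0 sq ab x in auto)
  finally show ?thesis unfolding diff N_def .
qed

text \<open>The event that some dyadic increment of the walk is too large. All levels \<open>l\<close> are included, also
  those finer than the grid.\<close>

definition rough_walk :: "real \<Rightarrow> 'a set" where
  "rough_walk C = (\<Union>l. \<Union>m\<in>{..<2 ^ l}. {\<omega>\<in>space M.
     4 * C * sqrt (real n) * (real l + 2) * sqrt (1 / 2) ^ l
     \<le> \<bar>walk n (\<lambda>k. y k \<omega>) ((real m + 1) / 2 ^ l) - walk n (\<lambda>k. y k \<omega>) (real m / 2 ^ l)\<bar>})"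

text \<open>Level \<open>l\<close> has \<open>2\<^sup>l\<close> increments, and the threshold with the factor \<open>l + 2\<close> makes each of them large with
  probability at most \<open>2 exp (- C (l + 2))\<close>.\<close>

lemma rough_walk_prob:
  assumes C: "2 \<le> C"
  shows "rough_walk C \<in> events" "prob (rough_walk C) \<le> 4 * exp (- 2 * C)"
proof -
  let ?W = "\<lambda>\<omega>. walk n (\<lambda>k. y k \<omega>)"
  define A where "A = (\<lambda>l m. {\<omega>\<in>space M. 4 * C * sqrt (real n) * (real l + 2) * sqrt (1 / 2) ^ l
     \<le> \<bar>?W \<omega> ((real m + 1) / 2 ^ l) - ?W \<omega> (real m / 2 ^ l)\<bar>})"
  have Wm[measurable]: "(\<lambda>\<omega>. ?W \<omega> s) \<in> borel_measurable M" for s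
    unfolding walk_def by (intro borel_measurable_sum borel_measurable_times noise_measurable) auto
  have meas: "A l m \<in> events" for l m unfolding A_def by measurable
  have p: "prob (A l m) \<le> 2 * exp (- (C * (real l + 2)))" if m: "m \<in> {..<2 ^ l}" for l m
  proof -
    have "real (Suc m) \<le> real (2 ^ l)" unfolding of_nat_le_iff using m by auto
    then have m1: "(real m + 1) / 2 ^ l \<le> 1" by (simp add: add.commute)
    have len: "(real m + 1) / 2 ^ l - real m / 2 ^ l = 1 / 2 ^ l" by (simp add: diff_divide_distrib[symmetric])
    have "1 * 1 \<le> C * (real l + 2)" using C by (intro mult_mono) auto
    then have "prob {\<omega>\<in>space M. 4 * sqrt (real n * ((real m + 1) / 2 ^ l - real m / 2 ^ l)) * (C * (real l + 2))
        \<le> \<bar>?W \<omega> ((real m + 1) / 2 ^ l) - ?W \<omega> (real m / 2 ^ l)\<bar>} \<le> 2 * exp (- (C * (real l + 2)))"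
      by (intro walk_increment_tail m1) (auto simp: divide_strict_right_mono)
    moreover have "4 * sqrt (real n * ((real m + 1) / 2 ^ l - real m / 2 ^ l)) * (C * (real l + 2))
       = 4 * C * sqrt (real n) * (real l + 2) * sqrt (1 / 2) ^ l"
    proof -
      have "sqrt (real n * (1 / 2 ^ l)) = sqrt (real n) * sqrt (1 / 2) ^ l"
        unfolding real_sqrt_mult real_sqrt_power[symmetric] power_one_over ..
      then show ?thesis unfolding len by (simp only: mult_ac)
    qed
    ultimately show ?thesis unfolding A_def by simp
  qed
  have s: "real (card {..<(2::nat) ^ l}) * (2 * exp (- (C * (real l + 2)))) \<le> 2 * exp (- 2 * C) * (1 / 2) ^ l" for l
  proof -
    have "exp (- C) \<le> exp (- (ln 4))"
    proof -
      have "(1 + 1 :: real) \<le> exp 1" by (rule exp_ge_add_one_self)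
      then have "(2::real)\<^sup>2 \<le> (exp 1)\<^sup>2" by (intro power_mono) auto
      moreover have "(exp 1)\<^sup>2 = exp (2::real)" using exp_double[of "1::real"] by simp
      ultimately have "ln 4 \<le> ln (exp (2::real))" by (subst ln_le_cancel_iff) auto
      then show ?thesis using C by simp
    qed
    then have "exp (- C) ^ l \<le> (1 / 4) ^ l" by (intro power_mono) (auto simp: exp_minus inverse_eq_divide)
    then have "2 ^ l * exp (- C) ^ l \<le> 2 ^ l * (1 / 4) ^ l" by (intro mult_left_mono) auto
    also have "\<dots> = (1 / 2 :: real) ^ l" by (simp add: power_mult_distrib[symmetric])
    finally have *: "2 ^ l * exp (- C) ^ l \<le> (1 / 2 :: real) ^ l" .
    have "exp (- (C * (real l + 2))) = exp (- 2 * C) * exp (- C) ^ l"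
      by (simp add: exp_of_nat_mult[symmetric] exp_add[symmetric] algebra_simps)
    then have "real (card {..<(2::nat) ^ l}) * (2 * exp (- (C * (real l + 2)))) = 2 * exp (- 2 * C) * (2 ^ l * exp (- C) ^ l)"
      by simp
    also have "\<dots> \<le> 2 * exp (- 2 * C) * (1 / 2) ^ l" using * by (intro mult_left_mono) auto
    finally show ?thesis .
  qed
  have eq: "rough_walk C = (\<Union>l. \<Union>m\<in>{..<2 ^ l}. A l m)" unfolding rough_walk_def A_def ..
  have sm: "summable (\<lambda>l. 2 * exp (- 2 * C) * (1 / 2 :: real) ^ l)" by (intro summable_mult summable_geometric) simp
  show "rough_walk C \<in> events" unfolding eq
    by (rule multiscale_union_bound(1)[OF prob_space_axioms _ _ p s sm]) (use meas in auto)
  have "prob (rough_walk C) \<le> (\<Sum>l. 2 * exp (- 2 * C) * (1 / 2 :: real) ^ l)" unfolding eq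
    by (rule multiscale_union_bound(2)[OF prob_space_axioms _ _ p s sm]) (use meas in auto)
  also have "\<dots> = 4 * exp (- 2 * C)" by (subst suminf_mult) (auto simp: suminf_geometric)
  finally show "prob (rough_walk C) \<le> 4 * exp (- 2 * C)" .
qed

lemma not_rough_walkD:
  assumes \<omega>: "\<omega> \<in> space M - rough_walk C" and m: "m < 2 ^ l"
  shows "\<bar>walk n (\<lambda>k. y k \<omega>) ((real m + 1) / 2 ^ l) - walk n (\<lambda>k. y k \<omega>) (real m / 2 ^ l)\<bar>
      \<le> 4 * C * sqrt (real n) * (real l + 2) * sqrt (1 / 2) ^ l"
proof (rule ccontr)
  assume "\<not> ?thesis"
  then have "4 * C * sqrt (real n) * (real l + 2) * sqrt (1 / 2) ^ l
      \<le> \<bar>walk n (\<lambda>k. y k \<omega>) ((real m + 1) / 2 ^ l) - walk n (\<lambda>k. y k \<omega>) (real m / 2 ^ l)\<bar>"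
    by linarith
  with \<omega> m have "\<omega> \<in> rough_walk C"
    unfolding rough_walk_def by (intro UN_I[of l] UN_I[of m]) simp_all
  with \<omega> show False by simp
qed

lemma smooth_walk:
  assumes C: "0 \<le> C" and \<omega>: "\<omega> \<in> space M - rough_walk C"
    and s: "s \<in> {0..1}" "s' \<in> {0..1}" "\<bar>s - s'\<bar> \<le> 1 / 2 ^ L"
  shows "\<bar>walk n (\<lambda>k. y k \<omega>) s - walk n (\<lambda>k. y k \<omega>) s'\<bar> \<le> 12 * (4 * C * sqrt (real n)) * (real L + 10) * sqrt (1 / 2) ^ L"
  by (rule dyadic_modulus_of_continuity[OF continuous_walk _ not_rough_walkD[OF \<omega>] s]) (use C in simp_all)

text \<open>The increment over \<open>[0,1]\<close> is the sum of all \<open>y\<^sub>k\<close>; this gives the deviation of the volatility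
  estimator.\<close>

lemma smooth_walk_total:
  assumes \<omega>: "\<omega> \<in> space M - rough_walk C"
  shows "\<bar>\<Sum>k=1..n. y k \<omega>\<bar> \<le> 8 * C * sqrt (real n)"
  using not_rough_walkD[OF \<omega>, of 0 0] by (simp add: walk_zero walk_one)

end

section \<open>The calibration function\<close>

lemma G_eq:
  assumes "1 \<le> sqrt (real n) * \<delta>"
  shows "G n (2 * ln (1 / \<delta>)) \<delta> = 2 * sqrt (ln (1 / \<delta>)) + 4 * ln (1 / \<delta>) / (sqrt (real n) * \<delta>)"
proof -
  have "sqrt (2 * (2 * ln (1 / \<delta>))) = sqrt (2\<^sup>2 * ln (1 / \<delta>))" by simp
  also have "\<dots> = 2 * sqrt (ln (1 / \<delta>))" by (simp only: real_sqrt_mult real_sqrt_power) simp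
  finally show ?thesis unfolding G_def using assms by (simp add: max_absorb2)
qed

text \<open>\<open>\<rho>\<close> bounds the relative difference of the two scales. Multiplying the leading term of \<open>G\<close>, of order
  \<open>\<surd>ln (1/\<delta>')\<close>, by \<open>\<delta>' / \<delta>\<close> costs at most \<open>\<rho>\<close> times this term, which the hypothesis on \<open>D\<close> keeps
  bounded. The second term has \<open>\<delta>'\<close> in the denominator, so the same factor replaces it by \<open>\<delta>\<close>, and the
  logarithms differ by at most \<open>\<rho>\<close>.\<close>

lemma G_nearby_scale:
  assumes \<delta>: "0 < \<delta>" "\<delta> \<le> 1" "0 < \<delta>'" "\<delta>' \<le> 1"
    and n: "1 \<le> sqrt (real n) * \<delta>" "1 \<le> sqrt (real n) * \<delta>'"
    and \<rho>: "0 \<le> \<rho>" "\<bar>\<delta> - \<delta>'\<bar> \<le> \<rho> * \<delta>" "\<bar>\<delta> - \<delta>'\<bar> \<le> \<rho> * \<delta>'"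
    and D: "\<rho> * (1 + ln (1 / \<delta>')) \<le> D" and M: "0 \<le> M"
  shows "(G n (2 * ln (1 / \<delta>')) \<delta>' + M) * (\<delta>' / \<delta>) \<le> G n (2 * ln (1 / \<delta>)) \<delta> + 8 * D + 2 + M * (1 + D)"
proof -
  define a where "a = ln (1 / \<delta>)"
  define a' where "a' = ln (1 / \<delta>')"
  have a0: "0 \<le> a" "0 \<le> a'" unfolding a_def a'_def using \<delta> by auto
  have "\<rho> * 1 \<le> \<rho> * (1 + a')" using \<rho> a0 by (intro mult_left_mono) auto
  then have \<rho>D: "\<rho> \<le> D" using D unfolding a'_def by simp
  have ratio: "\<delta>' / \<delta> \<le> 1 + \<rho>" "0 \<le> \<delta>' / \<delta>" using \<rho>(2) \<delta> by (auto simp: field_simps abs_le_iff)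
  have aa: "a' \<le> a + \<rho>"
  proof -
    have "ln (\<delta> / \<delta>') \<le> \<delta> / \<delta>' - 1" using \<delta> by (intro ln_le_minus_one) auto
    also have "\<dots> \<le> \<rho>" using \<rho>(3) \<delta> by (simp add: field_simps abs_le_iff)
    finally show ?thesis unfolding a_def a'_def using \<delta> by (simp add: ln_div)
  qed
  have sqrt_le: "sqrt u \<le> 1 + u" if "0 \<le> u" for u :: real
    using that by (intro real_le_lsqrt) (auto simp: power2_eq_square algebra_simps)
  have s1: "sqrt a' * (\<delta>' / \<delta>) \<le> sqrt a + (1 + D) + D"
  proof -
    have "sqrt a' * (\<delta>' / \<delta>) \<le> sqrt a' * (1 + \<rho>)" using ratio a0 by (intro mult_left_mono) auto
    also have "\<dots> = sqrt a' + \<rho> * sqrt a'" by (simp add: algebra_simps)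
    also have "\<rho> * sqrt a' \<le> \<rho> * (1 + a')" using \<rho> a0 sqrt_le by (intro mult_left_mono) auto
    also have "\<dots> \<le> D" using D unfolding a'_def .
    also have "sqrt a' \<le> sqrt (a + \<rho>)" using aa by simp
    also have "\<dots> \<le> sqrt a + sqrt \<rho>" by (rule sqrt_add_le_add_sqrt) (use a0 \<rho> in auto)
    also have "sqrt \<rho> \<le> 1 + D" using sqrt_le[of \<rho>] \<rho> \<rho>D by linarith
    finally show ?thesis by simp
  qed
  have s2: "4 * a' / (sqrt (real n) * \<delta>') * (\<delta>' / \<delta>) \<le> 4 * a / (sqrt (real n) * \<delta>) + 4 * D"
  proof -
    have "4 * a' / (sqrt (real n) * \<delta>') * (\<delta>' / \<delta>) = 4 * a' / (sqrt (real n) * \<delta>)"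
      using \<delta> by simp
    also have "\<dots> \<le> 4 * (a + \<rho>) / (sqrt (real n) * \<delta>)"
      using aa n by (intro divide_right_mono) auto
    also have "\<dots> = 4 * a / (sqrt (real n) * \<delta>) + 4 * \<rho> / (sqrt (real n) * \<delta>)"
      by (simp add: add_divide_distrib distrib_left)
    also have "4 * \<rho> / (sqrt (real n) * \<delta>) \<le> 4 * \<rho> / 1"
      using n \<rho> by (intro divide_left_mono) auto
    finally show ?thesis using \<rho>D by linarith
  qed
  have s3: "M * (\<delta>' / \<delta>) \<le> M * (1 + D)" using ratio \<rho>D M by (intro mult_left_mono) auto
  have "(G n (2 * ln (1 / \<delta>')) \<delta>' + M) * (\<delta>' / \<delta>)
     = 2 * (sqrt a' * (\<delta>' / \<delta>)) + 4 * a' / (sqrt (real n) * \<delta>') * (\<delta>' / \<delta>) + M * (\<delta>' / \<delta>)"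
    unfolding G_eq[OF n(2)] a'_def by (simp only: distrib_right mult.assoc)
  also have "\<dots> \<le> 2 * (sqrt a + (1 + D) + D) + (4 * a / (sqrt (real n) * \<delta>) + 4 * D) + M * (1 + D)"
    by (intro add_mono s2 s3 mult_left_mono s1) simp
  also have "\<dots> = G n (2 * ln (1 / \<delta>)) \<delta> + 8 * D + 2 + M * (1 + D)"
    unfolding G_eq[OF n(1)] a_def by simp
  finally show ?thesis .
qed

lemma G_upper_bound:
  assumes \<delta>: "0 < \<delta>" "\<delta> \<le> 1" and n: "1 \<le> sqrt (real n) * \<delta>"
  shows "G n (2 * ln (1 / \<delta>)) \<delta> \<le> 6 * ln (1 / \<delta>) + 2"
    "G n (2 * ln (1 / \<delta>)) \<delta> \<le> 6 * sqrt (real n)"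
proof -
  define a where "a = ln (1 / \<delta>)"
  have a0: "0 \<le> a" unfolding a_def using \<delta> by auto
  have n1: "1 \<le> n" using n by (cases n) auto
  have q: "4 * a / (sqrt (real n) * \<delta>) \<le> 4 * a / 1" using n a0 by (intro divide_left_mono) auto
  have "sqrt a \<le> 1 + a" using a0 by (intro real_le_lsqrt) (auto simp: power2_eq_square algebra_simps)
  then have le: "G n (2 * ln (1 / \<delta>)) \<delta> \<le> 6 * a + 2" unfolding G_eq[OF n] unfolding a_def[symmetric] using q by linarith
  then show "G n (2 * ln (1 / \<delta>)) \<delta> \<le> 6 * ln (1 / \<delta>) + 2" unfolding a_def .
  have "1 / \<delta> \<le> sqrt (real n)" using n \<delta> by (simp add: field_simps)
  then have "a \<le> ln (sqrt (real n))" unfolding a_def using \<delta> n1 by (subst ln_le_cancel_iff) auto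
  also have "\<dots> \<le> sqrt (real n) - 1" using n1 by (intro ln_le_minus_one) auto
  finally show "G n (2 * ln (1 / \<delta>)) \<delta> \<le> 6 * sqrt (real n)" using le by linarith
qed

section \<open>Passing from a net to all locations and scales\<close>

text \<open>The refinement at level \<open>j\<close> is about \<open>r = \<surd>j\<close>. Hence terms growing linearly in \<open>j\<close> are quadratic in
  \<open>r\<close> and are absorbed by a geometric factor in \<open>r\<close>.\<close>

lemma quadratic_times_geometric_bounded:
  fixes x c :: real
  assumes x: "0 < x" "x < 1"
  obtains D where "0 \<le> D" "\<And>r::nat. ((real r)\<^sup>2 + real r + c) * x ^ r \<le> D"
proof -
  have "(\<lambda>r. (real r * sqrt x ^ r)\<^sup>2 + real r * x ^ r + c * x ^ r) \<longlonglongrightarrow> 0\<^sup>2 + 0 + c * 0"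
    by (intro tendsto_intros powser_times_n_limit_0 LIMSEQ_realpow_zero) (use x in auto)
  then have "Bseq (\<lambda>r. (real r * sqrt x ^ r)\<^sup>2 + real r * x ^ r + c * x ^ r)"
    by (intro convergent_imp_Bseq convergentI)
  then obtain D where D: "0 < D" "\<And>r. norm ((real r * sqrt x ^ r)\<^sup>2 + real r * x ^ r + c * x ^ r) \<le> D"
    unfolding Bseq_def by blast
  have "(real r * sqrt x ^ r)\<^sup>2 = (real r)\<^sup>2 * x ^ r" for r
    using x by (simp add: power_mult_distrib real_sqrt_power[symmetric])
  then have "((real r)\<^sup>2 + real r + c) * x ^ r \<le> D" for r
    using D(2)[of r] by (simp add: distrib_right abs_le_iff)
  then show thesis using D(1) that[of D] by simp
qed

text \<open>Any refinement growing faster than \<open>ln j\<close> makes the steps between net points negligible, and any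
  refinement up to a multiple of \<open>\<surd>j\<close> is affordable in the union bound.\<close>

definition refinement :: "nat \<Rightarrow> nat" where "refinement j = nat \<lceil>sqrt (real j)\<rceil>"

definition mesh :: "nat \<Rightarrow> real" where "mesh j = 1 / 2 ^ (j + refinement j)"

lemma refinement_bounds:
  "real j \<le> (real (refinement j))\<^sup>2" "real (refinement j) \<le> sqrt (real j) + 1" "1 \<le> j \<Longrightarrow> 1 \<le> refinement j"
proof -
  have r: "real (refinement j) = real_of_int \<lceil>sqrt (real j)\<rceil>" unfolding refinement_def by simp
  have ge: "sqrt (real j) \<le> real (refinement j)" unfolding r by linarith
  then have "(sqrt (real j))\<^sup>2 \<le> (real (refinement j))\<^sup>2" by (intro power_mono) auto
  then show "real j \<le> (real (refinement j))\<^sup>2" by simp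
  show "real (refinement j) \<le> sqrt (real j) + 1" unfolding r by linarith
  show "1 \<le> refinement j" if "1 \<le> j"
  proof -
    have "1 \<le> sqrt (real j)" using that by simp
    then have "1 \<le> real (refinement j)" using ge by linarith
    then show ?thesis by simp
  qed
qed

definition lin_stat :: "(real \<Rightarrow> real) \<Rightarrow> nat \<Rightarrow> (nat \<Rightarrow> real) \<Rightarrow> real \<Rightarrow> real \<Rightarrow> real" where
  "lin_stat \<psi> n y t h = (\<Sum>k=1..n. lam \<psi> n t h k * y k) / (sqrt 2 * Lam \<psi> n t h)"

context kernel
begin

lemma Lam_bounds:
  assumes n: "n \<ge> 1" and th: "(t, h) \<in> loc_scales n min_scale"
  shows "0 < h" "0 < Lam \<psi> n t h" "Lam \<psi> n t h \<le> 1" "1 \<le> sqrt (real n) * Lam \<psi> n t h"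
proof -
  show h: "0 < h" using th min_scale_pos n unfolding loc_scales_def
    by (auto intro: less_le_trans[of 0 "min_scale / real n"])
  have ge: "1 / real n \<le> (Lam \<psi> n t h)\<^sup>2" by (rule Lam_squared_ge(2)[OF n th])
  have "0 < 1 / real n" using n by simp
  then have "Lam \<psi> n t h \<noteq> 0" using ge by auto
  then show pos: "0 < Lam \<psi> n t h" using Lam_nonneg[of n t h] by simp
  have "(Lam \<psi> n t h)\<^sup>2 \<le> 1" using Lam_squared_le[OF n h, of t] th unfolding loc_scales_def by auto
  then show "Lam \<psi> n t h \<le> 1" using power2_le_imp_le[of "Lam \<psi> n t h" 1] by simp
  have "sqrt (1 / real n) \<le> Lam \<psi> n t h" using ge pos by (intro real_le_lsqrt) auto
  then show "1 \<le> sqrt (real n) * Lam \<psi> n t h" using n by (simp add: real_sqrt_divide field_simps)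
qed

text \<open>The factor \<open>\<surd>(1/2)\<^sup>j\<close> is \<open>\<surd>h\<close> up to a constant at dyadic level \<open>j\<close>.\<close>

lemma Lam_dyadic_lower_bound:
  assumes n: "n \<ge> 1" and th: "(t, h) \<in> loc_scales n min_scale" and h: "1 / 2 ^ (j + 1) \<le> h"
  shows "sqrt core_radius / 4 * sqrt (1 / 2) ^ j \<le> Lam \<psi> n t h"
proof (rule power2_le_imp_le)
  have "(sqrt core_radius / 4 * sqrt (1 / 2) ^ j)\<^sup>2 = core_radius * (1 / 2 ^ (j + 1)) / 8"
    using core_radius_pos
    by (simp add: power_mult_distrib power_divide power_mult[symmetric] mult.commute[of j 2])
       (simp add: power_mult power_divide)
  also have "\<dots> \<le> core_radius * h / 8" using h core_radius_pos by (intro divide_right_mono mult_left_mono) auto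
  also have "\<dots> \<le> (Lam \<psi> n t h)\<^sup>2" by (rule Lam_squared_ge(1)[OF n th])
  finally show "(sqrt core_radius / 4 * sqrt (1 / 2) ^ j)\<^sup>2 \<le> (Lam \<psi> n t h)\<^sup>2" .
qed (rule Lam_nonneg)

lemma variation_nonneg: "0 \<le> V"
  using variation[of 0] by simp

text \<open>A bound \<open>G + M\<close> for the statistic at \<open>(t',h')\<close> carries over to every \<open>(t,h)\<close> of the same dyadic level
  within one mesh width, at the price of an additive constant. The constant \<open>D\<close> depends on
  the kernel only; this uniformity in \<open>n\<close>, in the level and in the noise is the reason for the form with
  \<open>D\<close> in front. The premise on the walk is the modulus of continuity from dyadic chaining.\<close>

lemma net_comparison:
  obtains D where "0 \<le> D"
    "\<And>n y C M t h t' h' j. \<lbrakk>n \<ge> 1; 0 \<le> C; 0 \<le> M; (t, h) \<in> loc_scales n min_scale; (t', h') \<in> loc_scales n min_scale;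
       1 \<le> j; 1 / 2 ^ (j + 1) \<le> h; h \<le> 1 / 2 ^ j; 1 / 2 ^ (j + 1) \<le> h'; h' \<le> 1 / 2 ^ j;
       \<bar>t - t'\<bar> \<le> mesh j; \<bar>h - h'\<bar> \<le> mesh j;
       \<And>s s' L. \<lbrakk>s \<in> {0..1}; s' \<in> {0..1}; \<bar>s - s'\<bar> \<le> 1 / 2 ^ L\<rbrakk> \<Longrightarrow>
         \<bar>walk n y s - walk n y s'\<bar> \<le> 12 * (4 * C * sqrt (real n)) * (real L + 10) * sqrt (1 / 2) ^ L;
       \<bar>lin_stat \<psi> n y t' h'\<bar> \<le> G n (2 * ln (1 / Lam \<psi> n t' h')) (Lam \<psi> n t' h') + M\<rbrakk>
     \<Longrightarrow> \<bar>lin_stat \<psi> n y t h\<bar> \<le> G n (2 * ln (1 / Lam \<psi> n t h)) (Lam \<psi> n t h) + D * (1 + C + M)"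
proof -
  define q where "q = sqrt (1 / 2 :: real)"
  have q: "0 < q" "q < 1" unfolding q_def by (auto simp: real_sqrt_lt_1_iff)
  define c0 where "c0 = sqrt core_radius / 4"
  have c0: "0 < c0" "c0 \<le> 1" 
  proof -
    have "sqrt core_radius \<le> 1" using core_radius_less_one by simp
    then show "c0 \<le> 1" unfolding c0_def by linarith
    show "0 < c0" unfolding c0_def using core_radius_pos by simp
  qed
  obtain D1 where D1: "0 \<le> D1" "\<And>r::nat. ((real r)\<^sup>2 + real r + 9) * q ^ r \<le> D1"
    using quadratic_times_geometric_bounded[OF q] by metis
  define x where "x = 2 powr - \<beta>"
  have x: "0 < x" "x < 1" unfolding x_def using beta_pos powr_less_one[of 2 "- \<beta>"] by auto
  obtain D2 where D2: "0 \<le> D2" "\<And>r::nat. ((real r)\<^sup>2 + real r + (1 + ln (1 / c0))) * x ^ r \<le> D2"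
    using quadratic_times_geometric_bounded[OF x] by metis
  define D3 where "D3 = sqrt 3 / c0 * 4 powr \<beta> * D2"
  define K where "K = 48 * V * (D1 / q) / c0"
  have K0: "0 \<le> K" unfolding K_def using variation_nonneg D1 q c0 by simp
  have D30: "0 \<le> D3" unfolding D3_def using D2 c0 by simp
  define D where "D = K + 9 * D3 + 3"
  show thesis
  proof (rule that[of D])
    show "0 \<le> D" unfolding D_def using K0 D30 by simp
    fix n y C M t h t' h' j
    assume n: "n \<ge> 1" and C: "0 \<le> C" and M: "0 \<le> (M::real)"
      and th: "(t, h) \<in> loc_scales n min_scale" and th': "(t', h') \<in> loc_scales n min_scale"
      and j: "1 \<le> j" and hj: "1 / 2 ^ (j + 1) \<le> h" "h \<le> 1 / 2 ^ j" "1 / 2 ^ (j + 1) \<le> h'" "h' \<le> 1 / 2 ^ j"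
      and tt: "\<bar>t - t'\<bar> \<le> mesh j" and hh: "\<bar>h - h'\<bar> \<le> mesh j"
      and modulus: "\<And>s s' L. \<lbrakk>s \<in> {0..1}; s' \<in> {0..1}; \<bar>s - s'\<bar> \<le> 1 / 2 ^ L\<rbrakk> \<Longrightarrow>
         \<bar>walk n y s - walk n y s'\<bar> \<le> 12 * (4 * C * sqrt (real n)) * (real L + 10) * sqrt (1 / 2) ^ L"
      and T': "\<bar>lin_stat \<psi> n y t' h'\<bar> \<le> G n (2 * ln (1 / Lam \<psi> n t' h')) (Lam \<psi> n t' h') + M"
    define r where "r = refinement j"
    have r1: "1 \<le> r" and jr: "real j \<le> (real r)\<^sup>2" unfolding r_def using refinement_bounds[of j] j by auto
    let ?\<Lambda> = "Lam \<psi> n t h" and ?\<Lambda>' = "Lam \<psi> n t' h'"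
    note b = Lam_bounds[OF n th] and b' = Lam_bounds[OF n th']
    have low: "c0 * q ^ j \<le> ?\<Lambda>" "c0 * q ^ j \<le> ?\<Lambda>'"
      unfolding c0_def q_def using Lam_dyadic_lower_bound[OF n th hj(1)] Lam_dyadic_lower_bound[OF n th' hj(3)] by auto
    have n0: "0 < sqrt (real n)" using n by simp
    have qj: "0 < c0 * q ^ j" using c0 q by simp
    \<comment> \<open>The difference of the numerators is at most the oscillation of the walk over length
      \<open>2 mesh j = 2\<^bsup>-L\<^esup>\<close>. Its factor \<open>q\<^bsup>r\<^esup>\<close> absorbs \<open>L + 10\<close>, and \<open>q\<^sup>j\<close> is the order of \<open>\<Lambda>\<close>.\<close>
    define L where "L = j + r - 1"
    define A where "A = (\<Sum>k=1..n. lam \<psi> n t h k * y k)"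
    define A' where "A' = (\<Sum>k=1..n. lam \<psi> n t' h' k * y k)"
    have mesh2: "2 * mesh j = 1 / 2 ^ L"
    proof -
      have "j + r = Suc L" unfolding L_def using r1 by simp
      then show ?thesis unfolding mesh_def r_def[symmetric] by simp
    qed
    have "sqrt (real n) * \<bar>A - A'\<bar> \<le> V * (12 * (4 * C * sqrt (real n)) * (real L + 10) * q ^ L)"
      unfolding A_def A'_def
    proof (rule lam_sum_diff_le[OF n b(1) b'(1)])
      fix x :: real assume x: "\<bar>x\<bar> \<le> 1"
      have hx: "\<bar>h * x\<bar> \<le> h" "\<bar>h' * x\<bar> \<le> h'" "\<bar>(h - h') * x\<bar> \<le> \<bar>h - h'\<bar>"
        using x b(1) b'(1) by (auto simp: abs_mult mult_left_le)
      have "t + h * x - (t' + h' * x) = (t - t') + (h - h') * x" by (simp add: algebra_simps)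
      then have "\<bar>t + h * x - (t' + h' * x)\<bar> \<le> 2 * mesh j" using hx(3) tt hh by linarith
      moreover have "t + h * x \<in> {0..1}" "t' + h' * x \<in> {0..1}"
        using hx(1,2) th th' unfolding loc_scales_def by (auto simp: abs_le_iff)
      ultimately show "\<bar>walk n y (t + h * x) - walk n y (t' + h' * x)\<bar> \<le> 12 * (4 * C * sqrt (real n)) * (real L + 10) * q ^ L"
        unfolding q_def mesh2 by (intro modulus)
    qed
    also have "\<dots> = sqrt (real n) * (48 * V * C * ((real L + 10) * q ^ L))" by simp
    finally have "\<bar>A - A'\<bar> \<le> 48 * V * C * ((real L + 10) * q ^ L)"
      using n0 by (simp only: mult_le_cancel_left_pos)
    also have "\<dots> \<le> 48 * V * C * (D1 / q * q ^ j)"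
    proof (rule mult_left_mono)
      have "q ^ L * q = q ^ j * q ^ r" unfolding L_def power_add[symmetric] power_Suc2[symmetric] using r1 by simp
      then have qL: "q ^ L = q ^ r * q ^ j / q" using q by (simp add: field_simps)
      have "(real L + 10) * q ^ r \<le> ((real r)\<^sup>2 + real r + 9) * q ^ r"
        using jr r1 q unfolding L_def by (intro mult_right_mono) auto
      then have "(real L + 10) * q ^ r \<le> D1" using D1(2)[of r] by linarith
      then have "(real L + 10) * q ^ r * (q ^ j / q) \<le> D1 * (q ^ j / q)" using q by (intro mult_right_mono) auto
      then show "(real L + 10) * q ^ L \<le> D1 / q * q ^ j" unfolding qL by (simp add: mult.assoc)
    qed (use variation_nonneg C in simp)
    also have "\<dots> = K * C * (c0 * q ^ j)" unfolding K_def using c0 by simp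
    also have "\<dots> \<le> K * C * ?\<Lambda>" using low K0 C by (intro mult_left_mono) auto
    finally have num: "\<bar>A - A'\<bar> \<le> K * C * ?\<Lambda>" .
    \<comment> \<open>The relative difference \<open>\<rho>\<close> of the denominators decays geometrically in \<open>r\<close>, whereas
      \<open>ln (1 / \<Lambda>')\<close> grows at most linearly in \<open>j \<le> r\<^sup>2\<close>.\<close>
    define \<rho> where "\<rho> = sqrt 3 / c0 * (4 / 2 ^ r) powr \<beta>"
    have \<rho>0: "0 \<le> \<rho>" unfolding \<rho>_def using c0 by simp
    have "\<bar>?\<Lambda> - ?\<Lambda>'\<bar> \<le> (2 * mesh j / (1 / 2 ^ (j + 1))) powr \<beta> * sqrt (6 * (1 / 2 ^ (j + 1)))"
    proof (rule Lam_diff_le[OF n _ _ _ _ _ tt hh])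
      have "(2::real) ^ (j + 1) \<le> 2 ^ (j + r)" using r1 by (intro power_increasing) auto
      then show "mesh j \<le> 1 / 2 ^ (j + 1)" unfolding mesh_def r_def[symmetric] by (intro divide_left_mono) auto
    qed (use hj in auto)
    also have "2 * mesh j / (1 / 2 ^ (j + 1)) = 4 / 2 ^ r"
      unfolding mesh_def r_def[symmetric] by (simp add: power_add)
    also have "sqrt (6 * (1 / 2 ^ (j + 1))) = sqrt 3 * q ^ j"
    proof -
      have "(6::real) * (1 / 2 ^ (j + 1)) = 3 * (1 / 2) ^ j" by (simp add: power_one_over)
      then show ?thesis unfolding q_def by (simp only: real_sqrt_mult real_sqrt_power)
    qed
    also have "(4 / 2 ^ r) powr \<beta> * (sqrt 3 * q ^ j) = \<rho> * (c0 * q ^ j)" unfolding \<rho>_def using c0 by simp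
    finally have dd: "\<bar>?\<Lambda> - ?\<Lambda>'\<bar> \<le> \<rho> * (c0 * q ^ j)" .
    have den: "\<bar>?\<Lambda> - ?\<Lambda>'\<bar> \<le> \<rho> * ?\<Lambda>" "\<bar>?\<Lambda> - ?\<Lambda>'\<bar> \<le> \<rho> * ?\<Lambda>'"
      using order_trans[OF dd mult_left_mono[OF low(1) \<rho>0]] order_trans[OF dd mult_left_mono[OF low(2) \<rho>0]] by auto
    have \<rho>D: "\<rho> * (1 + ln (1 / ?\<Lambda>')) \<le> D3"
    proof -
      have "1 / ?\<Lambda>' \<le> 1 / (c0 * q ^ j)" using low(2) qj b' by (intro divide_left_mono) auto
      then have "ln (1 / ?\<Lambda>') \<le> ln (1 / (c0 * q ^ j))" using qj b' by (subst ln_le_cancel_iff) auto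
      also have "\<dots> = ln (1 / c0) + real j * ln (1 / q)" using c0 q by (simp add: ln_div ln_mult ln_realpow)
      also have "real j * ln (1 / q) \<le> real j * 1"
      proof (rule mult_left_mono)
        have "1 / q = sqrt 2" unfolding q_def by (simp add: real_sqrt_divide)
        then have "ln (1 / q) \<le> sqrt 2 - 1" by (metis ln_le_minus_one real_sqrt_gt_0_iff zero_less_numeral)
        also have "sqrt 2 \<le> 2" by (rule real_le_lsqrt) auto
        finally show "ln (1 / q) \<le> 1" by simp
      qed simp
      finally have "1 + ln (1 / ?\<Lambda>') \<le> (real r)\<^sup>2 + real r + (1 + ln (1 / c0))"
        using jr of_nat_0_le_iff[of r, where ?'a = real] by linarith
      then have "\<rho> * (1 + ln (1 / ?\<Lambda>')) \<le> \<rho> * ((real r)\<^sup>2 + real r + (1 + ln (1 / c0)))"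
        using \<rho>0 by (rule mult_left_mono)
      also have "(4 / 2 ^ r) powr \<beta> = 4 powr \<beta> * x ^ r"
        unfolding x_def by (simp add: powr_divide powr_minus powr_powr[symmetric] powr_realpow[symmetric] field_simps)
           (simp add: powr_powr mult.commute)
      then have "\<rho> * ((real r)\<^sup>2 + real r + (1 + ln (1 / c0)))
         = sqrt 3 / c0 * 4 powr \<beta> * (((real r)\<^sup>2 + real r + (1 + ln (1 / c0))) * x ^ r)"
        unfolding \<rho>_def by (simp only: mult_ac)
      also have "\<dots> \<le> D3" unfolding D3_def using D2(2)[of r] c0 by (intro mult_left_mono) auto
      finally show ?thesis .
    qed
    have "lin_stat \<psi> n y t h = (A - A') / (sqrt 2 * ?\<Lambda>) + lin_stat \<psi> n y t' h' * (?\<Lambda>' / ?\<Lambda>)"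
      unfolding lin_stat_def A_def[symmetric] A'_def[symmetric] using b b' by (simp add: field_simps)
    also have "\<bar>\<dots>\<bar> \<le> \<bar>(A - A') / (sqrt 2 * ?\<Lambda>)\<bar> + \<bar>lin_stat \<psi> n y t' h'\<bar> * (?\<Lambda>' / ?\<Lambda>)"
      by (rule order_trans[OF abs_triangle_ineq]) (use b b' in \<open>simp add: abs_mult\<close>)
    also have "\<bar>(A - A') / (sqrt 2 * ?\<Lambda>)\<bar> \<le> K * C"
    proof -
      have "1 * ?\<Lambda> \<le> sqrt 2 * ?\<Lambda>" using b by (intro mult_right_mono) auto
      then have "K * C * ?\<Lambda> \<le> K * C * (sqrt 2 * ?\<Lambda>)" using K0 C by (intro mult_left_mono) auto
      then have "\<bar>A - A'\<bar> \<le> K * C * (sqrt 2 * ?\<Lambda>)" using num by linarith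
      then show ?thesis using b by (simp add: abs_mult divide_le_eq)
    qed
    also have "\<bar>lin_stat \<psi> n y t' h'\<bar> * (?\<Lambda>' / ?\<Lambda>)
       \<le> (G n (2 * ln (1 / ?\<Lambda>')) ?\<Lambda>' + M) * (?\<Lambda>' / ?\<Lambda>)"
      using T' b b' by (intro mult_right_mono) auto
    also have "\<dots> \<le> G n (2 * ln (1 / ?\<Lambda>)) ?\<Lambda> + 8 * D3 + 2 + M * (1 + D3)"
      by (rule G_nearby_scale) (use b b' \<rho>0 den \<rho>D M in auto)
    finally have "\<bar>lin_stat \<psi> n y t h\<bar> \<le> K * C + (G n (2 * ln (1 / ?\<Lambda>)) ?\<Lambda> + 8 * D3 + 2 + M * (1 + D3))" by simp
    also have "\<dots> \<le> G n (2 * ln (1 / ?\<Lambda>)) ?\<Lambda> + D * (1 + C + M)"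
    proof -
      have "0 \<le> K * M" "0 \<le> D3 * C" "0 \<le> D3 * M" using K0 D30 C M by auto
      then show ?thesis unfolding D_def using K0 D30 C M by (simp add: algebra_simps)
    qed
    finally show "\<bar>lin_stat \<psi> n y t h\<bar> \<le> G n (2 * ln (1 / ?\<Lambda>)) ?\<Lambda> + D * (1 + C + M)" .
  qed
qed

end

section \<open>Deviations on the net\<close>

text \<open>Up to a factor, the sum of this series over the dyadic levels bounds the probability of an
  exceedance anywhere on the net.\<close>

lemma summable_exp_neg_sqrt: "summable (\<lambda>j. exp (- 2 * sqrt (real j)))"
proof (rule summable_comparison_test'[where N = 1])
  show "summable (\<lambda>j. 16 * inverse ((real j)\<^sup>2))"
    by (intro summable_mult inverse_power_summable) simp
  fix j :: nat assume j: "1 \<le> j"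
  have "(sqrt (real j) / 2) ^ 4 \<le> exp (sqrt (real j) / 2) ^ 4"
  proof (rule power_mono)
    show "sqrt (real j) / 2 \<le> exp (sqrt (real j) / 2)"
      using exp_ge_add_one_self[of "sqrt (real j) / 2"] by linarith
  qed simp
  also have "\<dots> = exp (2 * sqrt (real j))" by (simp add: exp_of_nat_mult[symmetric])
  also have "(sqrt (real j) / 2) ^ 4 = (real j)\<^sup>2 / 16"
  proof -
    have "sqrt (real j) ^ 4 = (sqrt (real j) * sqrt (real j)) * (sqrt (real j) * sqrt (real j))"
      by (simp only: power4_eq_xxxx mult.assoc)
    then have "sqrt (real j) ^ 4 = (real j)\<^sup>2" by (simp add: power2_eq_square)
    then show ?thesis by (simp add: power_divide)
  qed
  finally have "(real j)\<^sup>2 / 16 \<le> exp (2 * sqrt (real j))" .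
  then have "inverse (exp (2 * sqrt (real j))) \<le> inverse ((real j)\<^sup>2 / 16)" using j by (intro le_imp_inverse_le) auto
  moreover have "exp (- 2 * sqrt (real j)) = inverse (exp (2 * sqrt (real j)))"
    using exp_minus[of "2 * sqrt (real j)"] by simp
  moreover have "inverse ((real j)\<^sup>2 / 16) = 16 * inverse ((real j)\<^sup>2)"
    by (simp add: inverse_eq_divide)
  ultimately show "norm (exp (- 2 * sqrt (real j))) \<le> 16 * inverse ((real j)\<^sup>2)" by simp
qed

text \<open>Evaluating the sub-gamma threshold at \<open>x = (\<surd>\<eta> + m)\<^sup>2\<close> rather than \<open>x = \<eta>\<close> gains the factor
  \<open>exp (- 2m \<surd>\<eta> - m\<^sup>2)\<close> in probability. It costs only a constant independent of \<open>\<eta>\<close>: the mixed term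
  \<open>2 \<surd>2 a m \<surd>\<eta>\<close> is absorbed by the linear term, which has the coefficient \<open>2\<close> in \<open>G\<close> but only \<open>\<surd>2\<close> in the
  threshold.\<close>

lemma subgamma_quantile_le:
  assumes \<eta>: "0 \<le> \<eta>" and m: "0 \<le> m" and a: "0 \<le> a" "a \<le> 1"
  shows "sqrt 2 * (sqrt \<eta> + m) + sqrt 2 * a * (sqrt \<eta> + m)\<^sup>2
    \<le> sqrt (2 * \<eta>) + 2 * \<eta> * a + 2 * m + 6 * m\<^sup>2"
proof -
  define u where "u = sqrt \<eta>"
  have u: "0 \<le> u" "\<eta> = u\<^sup>2" unfolding u_def using \<eta> by auto
  have s2: "sqrt 2 \<le> (3 / 2 :: real)" by (rule real_le_lsqrt) (auto simp: power2_eq_square)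
  have quad: "3 / 2 * (u + m)\<^sup>2 \<le> 2 * u\<^sup>2 + 6 * m\<^sup>2"
  proof -
    have "0 \<le> (u - 3 * m)\<^sup>2" by simp
    then show ?thesis by (simp add: power2_eq_square algebra_simps)
  qed
  have "sqrt 2 * a * (u + m)\<^sup>2 \<le> 3 / 2 * a * (u + m)\<^sup>2" using s2 a by (intro mult_right_mono) auto
  also have "\<dots> = a * (3 / 2 * (u + m)\<^sup>2)" by simp
  also have "\<dots> \<le> a * (2 * u\<^sup>2 + 6 * m\<^sup>2)" using quad a by (intro mult_left_mono) auto
  also have "\<dots> = 2 * u\<^sup>2 * a + a * (6 * m\<^sup>2)" by (simp add: algebra_simps)
  also have "a * (6 * m\<^sup>2) \<le> 1 * (6 * m\<^sup>2)" using a by (intro mult_right_mono) auto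
  finally have "sqrt 2 * a * (u + m)\<^sup>2 \<le> 2 * u\<^sup>2 * a + 6 * m\<^sup>2" by simp
  moreover have "sqrt 2 * m \<le> 2 * m" using s2 m by (intro mult_right_mono) auto
  moreover have "sqrt (2 * \<eta>) = sqrt 2 * u" unfolding u_def by (rule real_sqrt_mult)
  moreover have "2 * \<eta> * a = 2 * u\<^sup>2 * a" using u(2) by simp
  ultimately show ?thesis unfolding u_def[symmetric] distrib_left by linarith
qed

lemma dyadic_level:
  fixes h :: real
  assumes "0 < h" "h < 1 / 2"
  obtains j :: nat where "1 \<le> j" "1 / 2 ^ (j + 1) \<le> h" "h \<le> 1 / 2 ^ j"
proof -
  let ?P = "\<lambda>j. 1 / 2 ^ (j + 1) \<le> h"
  obtain k where "(1 / 2) ^ k < h" using real_arch_pow_inv[OF assms(1), of "1/2"] by auto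
  moreover have "1 / 2 ^ (k + 1) \<le> (1 / 2 :: real) ^ k" by (simp add: power_one_over frac_le)
  ultimately have "?P k" by linarith
  then have P: "?P (LEAST j. ?P j)" by (rule LeastI)
  define j where "j = (LEAST j. ?P j)"
  have j1: "1 \<le> j" using P assms unfolding j_def[symmetric] by (cases j) auto
  then have "j - 1 < (LEAST j. ?P j)" unfolding j_def[symmetric] by simp
  from not_less_Least[OF this] have "h < 1 / 2 ^ j" using j1 by simp
  then show thesis using that[of j] j1 P unfolding j_def[symmetric] by simp
qed

lemma same_floor_close:
  fixes u v w :: real
  assumes "0 < w" "\<lfloor>u / w\<rfloor> = \<lfloor>v / w\<rfloor>"
  shows "\<bar>u - v\<bar> \<le> w"
proof -
  have "\<bar>u / w - v / w\<bar> \<le> 1" using assms(2) by linarith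
  then show ?thesis using assms(1) by (simp add: diff_divide_distrib[symmetric])
qed

text \<open>The net consists of one point from each nonempty cell of a square grid of width \<open>mesh j\<close> at each
  dyadic level. Choosing the points inside the cells keeps them admissible, so that the bounds for \<open>\<Lambda>\<close> apply
  to them.\<close>

definition net_cell :: "nat \<Rightarrow> real \<Rightarrow> nat \<Rightarrow> int \<times> int \<Rightarrow> (real \<times> real) set" where
  "net_cell n K j = (\<lambda>(a, b). {(t, h) \<in> loc_scales n K.
     1 / 2 ^ (j + 1) \<le> h \<and> h \<le> 1 / 2 ^ j \<and> \<lfloor>t / mesh j\<rfloor> = a \<and> \<lfloor>h / mesh j\<rfloor> = b})"

text \<open>Scales are below \<open>1/2\<close>, so level \<open>0\<close> does not occur.\<close>

definition net_index :: "nat \<Rightarrow> (int \<times> int) set" where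
  "net_index j = (if j = 0 then {} else {0..2 ^ (j + refinement j)} \<times> {0..2 ^ refinement j})"

lemma card_net_index: "real (card (net_index j)) \<le> 4 * exp 2 * 2 ^ j * exp (2 * sqrt (real j))"
proof -
  define r where "r = refinement j"
  have "card (net_index j) \<le> (2 ^ (j + r) + 1) * (2 ^ r + 1)"
    unfolding net_index_def r_def by (auto simp: card_cartesian_product nat_add_distrib nat_power_eq)
  also have "\<dots> \<le> (2 * 2 ^ (j + r)) * (2 * 2 ^ r)" by (intro mult_mono) auto
  also have "\<dots> = 4 * 2 ^ j * 4 ^ r"
  proof -
    have "(4::nat) ^ r = 2 ^ r * 2 ^ r" by (simp add: power_mult_distrib[symmetric])
    then show ?thesis by (simp add: power_add)
  qed
  finally have "real (card (net_index j)) \<le> real (4 * 2 ^ j * 4 ^ r)" by (simp only: of_nat_le_iff)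
  also have "\<dots> = 4 * 2 ^ j * 4 ^ r" by simp
  also have "(4::real) ^ r \<le> exp 2 * exp (2 * sqrt (real j))"
  proof -
    have "(1 + 1 :: real) \<le> exp 1" by (rule exp_ge_add_one_self)
    then have "(2::real)\<^sup>2 \<le> (exp 1)\<^sup>2" by (intro power_mono) auto
    moreover have "(exp 1)\<^sup>2 = exp (2::real)" using exp_double[of "1::real"] by simp
    ultimately have "(4::real) ^ r \<le> exp 2 ^ r" by (intro power_mono) auto
    also have "\<dots> = exp (2 * real r)" by (simp add: exp_of_nat_mult[symmetric] mult.commute)
    also have "\<dots> \<le> exp (2 + 2 * sqrt (real j))" using refinement_bounds(2)[of j] unfolding r_def by simp
    finally show ?thesis by (simp only: exp_add)
  qed
  finally show ?thesis by (simp add: mult_ac)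
qed

locale kernel_noise = kernel \<psi> \<beta> V + subgamma_noise M n y
  for \<psi> :: "real \<Rightarrow> real" and \<beta> V :: real and M :: "'a measure" and n :: nat and y :: "nat \<Rightarrow> 'a \<Rightarrow> real"
begin

definition exceedance :: "real \<Rightarrow> real \<times> real \<Rightarrow> 'a set" where
  "exceedance m = (\<lambda>(t, h). {\<omega>\<in>space M.
     G n (2 * ln (1 / Lam \<psi> n t h)) (Lam \<psi> n t h) + 2 * m + 6 * m\<^sup>2 \<le> \<bar>lin_stat \<psi> n (\<lambda>k. y k \<omega>) t h\<bar>})"

lemma lin_stat_measurable[measurable]: "(\<lambda>\<omega>. lin_stat \<psi> n (\<lambda>k. y k \<omega>) t h) \<in> borel_measurable M"
  unfolding lin_stat_def
  by (intro borel_measurable_divide borel_measurable_sum borel_measurable_times noise_measurable) auto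

lemma exceedance_measurable: "exceedance m p \<in> events"
  unfolding exceedance_def by (cases p) simp

text \<open>The weights \<open>\<lambda>\<^sub>k / (\<surd>2 \<Lambda>)\<close> have sum of squares \<open>1/2\<close> and are at most \<open>\<alpha>/\<surd>2\<close>, where
  \<open>\<alpha> = 1/(\<surd>n \<Lambda>) \<le> 1\<close> is also the factor of \<open>2\<eta>\<close> in \<open>G\<close>.\<close>

lemma exceedance_prob:
  assumes th: "(t, h) \<in> loc_scales n min_scale" and m: "0 \<le> m"
  shows "prob (exceedance m (t, h)) \<le> 2 * exp (- (sqrt (2 * ln (1 / Lam \<psi> n t h)) + m)\<^sup>2)"
proof -
  define \<Lambda> where "\<Lambda> = Lam \<psi> n t h"
  define \<eta> where "\<eta> = 2 * ln (1 / \<Lambda>)"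
  define \<alpha> where "\<alpha> = 1 / (sqrt (real n) * \<Lambda>)"
  define x where "x = (sqrt \<eta> + m)\<^sup>2"
  note b = Lam_bounds[OF n_pos th, folded \<Lambda>_def]
  have n0: "0 < sqrt (real n)" using n_pos by simp
  have \<eta>0: "0 \<le> \<eta>" unfolding \<eta>_def using b by simp
  have \<alpha>: "0 \<le> \<alpha>" "\<alpha> \<le> 1" unfolding \<alpha>_def using b n0 by auto
  have sx: "sqrt x = sqrt \<eta> + m" unfolding x_def using \<eta>0 m by simp
  define a where "a = (\<lambda>k. lam \<psi> n t h k / (sqrt 2 * \<Lambda>))"
  have stat: "lin_stat \<psi> n (\<lambda>k. y k \<omega>) t h = (\<Sum>k=1..n. a k * y k \<omega>)" for \<omega>
    unfolding lin_stat_def a_def \<Lambda>_def by (simp add: sum_divide_distrib)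
  have sq: "(\<Sum>k=1..n. (a k)\<^sup>2) = 1 / 2"
  proof -
    have "(\<Sum>k=1..n. (a k)\<^sup>2) = (\<Sum>k=1..n. (lam \<psi> n t h k)\<^sup>2) / (2 * \<Lambda>\<^sup>2)"
      unfolding a_def by (simp add: power_divide power_mult_distrib sum_divide_distrib)
    then show ?thesis unfolding Lam_squared[symmetric] \<Lambda>_def[symmetric] using b by simp
  qed
  have ab: "\<bar>a k\<bar> \<le> \<alpha> / sqrt 2" for k
  proof -
    have "lam \<psi> n t h k / (sqrt 2 * \<Lambda>) \<le> 1 / sqrt (real n) / (sqrt 2 * \<Lambda>)"
      using lam_le[OF n_pos] b by (intro divide_right_mono) auto
    also have "\<dots> = \<alpha> / sqrt 2" unfolding \<alpha>_def by simp
    finally show ?thesis unfolding a_def using lam_nonneg[of n t h k] b by (simp add: abs_mult)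
  qed
  have thr: "2 * sqrt (1 / 2 * x) + 2 * (\<alpha> / sqrt 2) * x \<le> G n \<eta> \<Lambda> + 2 * m + 6 * m\<^sup>2"
  proof -
    have d: "2 / sqrt 2 = sqrt (2::real)" by (rule real_div_sqrt) simp
    have "sqrt (1 / 2 * x) = sqrt x / sqrt 2" unfolding real_sqrt_divide[symmetric] by simp
    then have "2 * sqrt (1 / 2 * x) + 2 * (\<alpha> / sqrt 2) * x = 2 / sqrt 2 * sqrt x + 2 / sqrt 2 * \<alpha> * x"
      by (simp only: times_divide_eq_left times_divide_eq_right)
    also have "\<dots> = sqrt 2 * (sqrt \<eta> + m) + sqrt 2 * \<alpha> * (sqrt \<eta> + m)\<^sup>2"
      unfolding d sx unfolding x_def ..
    also have "\<dots> \<le> sqrt (2 * \<eta>) + 2 * \<eta> * \<alpha> + 2 * m + 6 * m\<^sup>2"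
      by (rule subgamma_quantile_le[OF \<eta>0 m \<alpha>])
    also have "sqrt (2 * \<eta>) + 2 * \<eta> * \<alpha> = G n \<eta> \<Lambda>" unfolding G_def \<alpha>_def using b by (simp add: max_absorb2)
    finally show ?thesis .
  qed
  have meas[measurable]: "(\<lambda>\<omega>. \<Sum>k=1..n. a k * y k \<omega>) \<in> borel_measurable M"
    by (intro borel_measurable_sum borel_measurable_times noise_measurable) auto
  have "exceedance m (t, h) = {\<omega>\<in>space M. G n \<eta> \<Lambda> + 2 * m + 6 * m\<^sup>2 \<le> \<bar>\<Sum>k=1..n. a k * y k \<omega>\<bar>}"
    unfolding exceedance_def prod.case stat \<eta>_def \<Lambda>_def ..
  then have "exceedance m (t, h) \<subseteq> {\<omega>\<in>space M. 2 * sqrt (1 / 2 * x) + 2 * (\<alpha> / sqrt 2) * x \<le> \<bar>\<Sum>k=1..n. a k * y k \<omega>\<bar>}"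
    using thr by auto
  then have "prob (exceedance m (t, h)) \<le> prob {\<omega>\<in>space M. 2 * sqrt (1 / 2 * x) + 2 * (\<alpha> / sqrt 2) * x \<le> \<bar>\<Sum>k=1..n. a k * y k \<omega>\<bar>}"
    by (rule finite_measure_mono) measurable
  also have "\<dots> \<le> 2 * exp (- x)"
    by (rule weighted_sum_tail) (use sq ab in \<open>auto simp: x_def\<close>)
  finally show ?thesis unfolding x_def \<eta>_def \<Lambda>_def .
qed

text \<open>Here \<open>exp (- \<eta>) = \<Lambda>\<^sup>2 \<le> 2h\<close>, which also forces \<open>\<eta> \<ge> (j - 1) ln 2\<close>. The estimate
  \<open>(\<surd>j - 1)/2 \<le> \<surd>\<eta>\<close> holds from \<open>j = 1\<close> on.\<close>

lemma exceedance_prob_dyadic: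
  assumes th: "(t, h) \<in> loc_scales n min_scale" and m: "0 \<le> m" and j: "1 \<le> j" and h: "h \<le> 1 / 2 ^ j"
  shows "prob (exceedance m (t, h)) \<le> 4 / 2 ^ j * exp (m - m\<^sup>2 - m * sqrt (real j))"
proof -
  define \<eta> where "\<eta> = 2 * ln (1 / Lam \<psi> n t h)"
  note b = Lam_bounds[OF n_pos th]
  have \<eta>0: "0 \<le> \<eta>" unfolding \<eta>_def using b by simp
  have "exp (- \<eta>) = (Lam \<psi> n t h)\<^sup>2"
    unfolding \<eta>_def using b by (simp add: ln_div exp_double)
  also have "\<dots> \<le> 2 * h" by (rule Lam_squared_le[OF n_pos b(1)])
  also have "\<dots> \<le> 2 / 2 ^ j" using h by simp
  finally have e: "exp (- \<eta>) \<le> 2 / 2 ^ j" .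
  have "(real j - 1) / 2 \<le> \<eta>"
  proof -
    have "- \<eta> \<le> ln (2 / 2 ^ j)" using e by (subst ln_ge_iff) auto
    also have "ln (2 / 2 ^ j :: real) = ln 2 - real j * ln 2" by (simp add: ln_div ln_realpow)
    finally have "(real j - 1) * ln 2 \<le> \<eta>" by (simp add: algebra_simps)
    moreover have "(real j - 1) * (1 / 2) \<le> (real j - 1) * ln 2" using j ln2_ge_two_thirds by (intro mult_left_mono) auto
    ultimately show ?thesis by simp
  qed
  moreover have "((sqrt (real j) - 1) / 2)\<^sup>2 \<le> (real j - 1) / 2"
  proof -
    define s where "s = sqrt (real j)"
    have s: "1 \<le> s" "real j = s * s" unfolding s_def using j by auto
    have "0 \<le> (s - 1) * (s + 3)" using s by (intro mult_nonneg_nonneg) auto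
    then show ?thesis unfolding s_def[symmetric] s(2) by (simp add: power2_eq_square field_simps)
  qed
  ultimately have "sqrt (((sqrt (real j) - 1) / 2)\<^sup>2) \<le> sqrt \<eta>" by (intro real_sqrt_le_mono) linarith
  then have "(sqrt (real j) - 1) / 2 \<le> sqrt \<eta>" by simp
  then have "2 * m * ((sqrt (real j) - 1) / 2) \<le> 2 * m * sqrt \<eta>" using m by (intro mult_left_mono) auto
  then have k: "m * sqrt (real j) - m \<le> 2 * m * sqrt \<eta>" by (simp add: right_diff_distrib)
  have "(sqrt \<eta> + m)\<^sup>2 = \<eta> + m\<^sup>2 + 2 * m * sqrt \<eta>" using \<eta>0 by (simp add: power2_sum)
  then have "exp (- (sqrt \<eta> + m)\<^sup>2) = exp (- \<eta>) * exp (- m\<^sup>2 - 2 * m * sqrt \<eta>)"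
    by (simp add: exp_add[symmetric])
  also have "\<dots> \<le> 2 / 2 ^ j * exp (m - m\<^sup>2 - m * sqrt (real j))"
    using k by (intro mult_mono e) auto
  finally show ?thesis using exceedance_prob[OF th m] unfolding \<eta>_def by simp
qed

definition net_point :: "nat \<Rightarrow> int \<times> int \<Rightarrow> real \<times> real" where
  "net_point j c = (SOME p. p \<in> net_cell n min_scale j c)"

definition net_exceedance :: "real \<Rightarrow> 'a set" where
  "net_exceedance m = (\<Union>j. \<Union>c\<in>net_index j. if net_cell n min_scale j c = {} then {} else exceedance m (net_point j c))"

lemma net_point_in_cell: "net_cell n min_scale j c \<noteq> {} \<Longrightarrow> net_point j c \<in> net_cell n min_scale j c"
  unfolding net_point_def by (metis ex_in_conv someI)

text \<open>At level \<open>j\<close> the factor \<open>2\<^bsup>-j\<^esup>\<close> in the probability cancels the number of locations, and for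
  \<open>m \<ge> 4\<close> the refinement of the mesh uses up at most half of the exponent \<open>m \<surd>j\<close>.\<close>

lemma net_exceedance_prob:
  assumes m: "4 \<le> m"
  shows "net_exceedance m \<in> events"
    "prob (net_exceedance m) \<le> 16 * exp 2 * exp (m - m\<^sup>2) * (\<Sum>j. exp (- 2 * sqrt (real j)))"
proof -
  let ?A = "\<lambda>j c. if net_cell n min_scale j c = {} then {} else exceedance m (net_point j c)"
  let ?p = "\<lambda>j. 4 / 2 ^ j * exp (m - m\<^sup>2 - m * sqrt (real j))"
  let ?s = "\<lambda>j. 16 * exp 2 * exp (m - m\<^sup>2) * exp (- 2 * sqrt (real j))"
  have fin: "finite (net_index j)" for j unfolding net_index_def by simp
  have meas: "?A j c \<in> events" for j c using exceedance_measurable by simp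
  have p: "prob (?A j c) \<le> ?p j" if c: "c \<in> net_index j" for j c
  proof (cases "net_cell n min_scale j c = {}")
    case False
    obtain t h where th: "net_point j c = (t, h)" by fastforce
    have "(t, h) \<in> net_cell n min_scale j c" using net_point_in_cell[OF False] th by simp
    then have "(t, h) \<in> loc_scales n min_scale" "h \<le> 1 / 2 ^ j" unfolding net_cell_def by (auto split: prod.splits)
    moreover have "1 \<le> j" using c unfolding net_index_def by (auto split: if_splits)
    ultimately show ?thesis using exceedance_prob_dyadic[of t h m j] m False th by simp
  qed simp
  have s: "real (card (net_index j)) * ?p j \<le> ?s j" for j
  proof -
    have "real (card (net_index j)) * ?p j \<le> (4 * exp 2 * 2 ^ j * exp (2 * sqrt (real j))) * ?p j"
      by (intro mult_right_mono card_net_index) auto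
    also have "\<dots> = 16 * exp 2 * (exp (2 * sqrt (real j)) * exp (m - m\<^sup>2 - m * sqrt (real j)))" by simp
    also have "exp (2 * sqrt (real j)) * exp (m - m\<^sup>2 - m * sqrt (real j)) \<le> exp (m - m\<^sup>2) * exp (- 2 * sqrt (real j))"
    proof -
      have "4 * sqrt (real j) \<le> m * sqrt (real j)" using m by (intro mult_right_mono) auto
      then show ?thesis unfolding exp_add[symmetric] by simp
    qed
    finally show ?thesis by (simp add: mult_ac)
  qed
  have sm: "summable ?s" by (intro summable_mult summable_exp_neg_sqrt)
  show "net_exceedance m \<in> events" unfolding net_exceedance_def
    by (rule multiscale_union_bound(1)[OF prob_space_axioms fin meas p s sm])
  have "prob (net_exceedance m) \<le> suminf ?s" unfolding net_exceedance_def
    by (rule multiscale_union_bound(2)[OF prob_space_axioms fin meas p s sm])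
  also have "suminf ?s = 16 * exp 2 * exp (m - m\<^sup>2) * (\<Sum>j. exp (- 2 * sqrt (real j)))"
    by (rule suminf_mult[OF summable_exp_neg_sqrt])
  finally show "prob (net_exceedance m) \<le> 16 * exp 2 * exp (m - m\<^sup>2) * (\<Sum>j. exp (- 2 * sqrt (real j)))" .
qed

lemma nearby_net_point:
  assumes \<omega>: "\<omega> \<in> space M - net_exceedance m" and th: "(t, h) \<in> loc_scales n min_scale"
  obtains j t' h' where "1 \<le> j" "1 / 2 ^ (j + 1) \<le> h" "h \<le> 1 / 2 ^ j" "1 / 2 ^ (j + 1) \<le> h'" "h' \<le> 1 / 2 ^ j"
    "\<bar>t - t'\<bar> \<le> mesh j" "\<bar>h - h'\<bar> \<le> mesh j" "(t', h') \<in> loc_scales n min_scale"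
    "\<bar>lin_stat \<psi> n (\<lambda>k. y k \<omega>) t' h'\<bar> \<le> G n (2 * ln (1 / Lam \<psi> n t' h')) (Lam \<psi> n t' h') + (2 * m + 6 * m\<^sup>2)"
proof -
  have h: "0 < h" "h < 1 / 2" "0 \<le> t" "t \<le> 1"
    using Lam_bounds(1)[OF n_pos th] th unfolding loc_scales_def by auto
  obtain j where j: "1 \<le> j" "1 / 2 ^ (j + 1) \<le> h" "h \<le> 1 / 2 ^ j" using dyadic_level[OF h(1,2)] .
  have w: "0 < mesh j" unfolding mesh_def by simp
  define c where "c = (\<lfloor>t / mesh j\<rfloor>, \<lfloor>h / mesh j\<rfloor>)"
  have cell: "(t, h) \<in> net_cell n min_scale j c" unfolding net_cell_def c_def using th j by simp
  have "c \<in> net_index j"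
  proof -
    have "t / mesh j \<le> 2 ^ (j + refinement j)" unfolding mesh_def using h by simp
    then have "\<lfloor>t / mesh j\<rfloor> \<le> 2 ^ (j + refinement j)" by (simp add: floor_le_iff)
    moreover have "h / mesh j \<le> 2 ^ refinement j"
      unfolding mesh_def using j(3) by (simp add: power_add field_simps)
    then have "\<lfloor>h / mesh j\<rfloor> \<le> 2 ^ refinement j" by (simp add: floor_le_iff)
    ultimately show ?thesis unfolding net_index_def c_def using j(1) h w by auto
  qed
  obtain t' h' where p: "net_point j c = (t', h')" by fastforce
  have cell': "(t', h') \<in> net_cell n min_scale j c" using net_point_in_cell[of j c] cell p by auto
  have "\<omega> \<notin> exceedance m (t', h')"
  proof
    assume "\<omega> \<in> exceedance m (t', h')"
    then have "\<omega> \<in> net_exceedance m"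
      unfolding net_exceedance_def using cell p \<open>c \<in> net_index j\<close> by (intro UN_I[of j] UN_I[of c]) auto
    with \<omega> show False by simp
  qed
  then have "\<bar>lin_stat \<psi> n (\<lambda>k. y k \<omega>) t' h'\<bar> \<le> G n (2 * ln (1 / Lam \<psi> n t' h')) (Lam \<psi> n t' h') + (2 * m + 6 * m\<^sup>2)"
    using \<omega> unfolding exceedance_def by auto
  moreover have "(t', h') \<in> loc_scales n min_scale" "1 / 2 ^ (j + 1) \<le> h'" "h' \<le> 1 / 2 ^ j"
    "\<lfloor>t' / mesh j\<rfloor> = \<lfloor>t / mesh j\<rfloor>" "\<lfloor>h' / mesh j\<rfloor> = \<lfloor>h / mesh j\<rfloor>"
    using cell' unfolding net_cell_def c_def by auto
  ultimately show thesis using that[of j h' t'] j same_floor_close[OF w, of t t'] same_floor_close[OF w, of h h'] by simp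
qed

end

section \<open>Studentization\<close>

context kernel
begin

lemma sum_lam_le: "(\<Sum>k=1..n. lam \<psi> n t h k) \<le> sqrt (real n) * Lam \<psi> n t h"
proof (rule power2_le_imp_le)
  have "(\<Sum>k=1..n. lam \<psi> n t h k)\<^sup>2 \<le> (\<Sum>k=1..n. (lam \<psi> n t h k)\<^sup>2) * card {1..n}"
    by (rule sum_squared_le_sum_of_squares)
  then show "(\<Sum>k=1..n. lam \<psi> n t h k)\<^sup>2 \<le> (sqrt (real n) * Lam \<psi> n t h)\<^sup>2"
    by (simp add: power_mult_distrib Lam_squared mult.commute)
qed (simp add: Lam_nonneg)

lemma Psi_hat_studentized:
  assumes n: "n \<ge> 1" and c: "c > 0"
    and z: "\<And>k. k \<in> {1..n} \<Longrightarrow> real n * (z k - z (k - 1))\<^sup>2 = c\<^sup>2 * (1 + y k)"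
    and S: "S = 1 + (\<Sum>k=1..n. y k) / real n" "0 < S" and pos: "0 < Lam \<psi> n t h"
  shows "Psi_hat \<psi> n t h (c_hat_sq n z) z =
     lin_stat \<psi> n y t h / S - (S - 1) * (\<Sum>k=1..n. lam \<psi> n t h k) / (sqrt 2 * Lam \<psi> n t h) / S"
proof -
  have n0: "0 < real n" using n by simp
  have "real n * c_hat_sq n z = (\<Sum>k=1..n. c\<^sup>2 * (1 + y k))"
    unfolding c_hat_sq_def sum_distrib_left by (intro sum.cong refl z)
  also have "\<dots> = c\<^sup>2 * (real n + (\<Sum>k=1..n. y k))"
    unfolding sum_distrib_left[symmetric] sum.distrib by simp
  also have "\<dots> = real n * (c\<^sup>2 * S)" unfolding S(1) using n0 by (simp add: field_simps)
  finally have ch: "c_hat_sq n z = c\<^sup>2 * S" using n0 by simp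
  have "(\<Sum>k=1..n. lam \<psi> n t h k * (real n * (z k - z (k - 1))\<^sup>2 - c\<^sup>2 * S))
     = (\<Sum>k=1..n. c\<^sup>2 * (lam \<psi> n t h k * y k - (S - 1) * lam \<psi> n t h k))"
  proof (intro sum.cong refl)
    fix k assume k: "k \<in> {1..n}"
    show "lam \<psi> n t h k * (real n * (z k - z (k - 1))\<^sup>2 - c\<^sup>2 * S)
       = c\<^sup>2 * (lam \<psi> n t h k * y k - (S - 1) * lam \<psi> n t h k)"
      unfolding z[OF k] by (simp add: algebra_simps)
  qed
  also have "\<dots> = c\<^sup>2 * ((\<Sum>k=1..n. lam \<psi> n t h k * y k) - (S - 1) * (\<Sum>k=1..n. lam \<psi> n t h k))"
    unfolding sum_distrib_left[symmetric] sum_subtractf by simp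
  finally have "Psi_hat \<psi> n t h (c_hat_sq n z) z =
     1 / sqrt 2 * (c\<^sup>2 * ((\<Sum>k=1..n. lam \<psi> n t h k * y k) - (S - 1) * (\<Sum>k=1..n. lam \<psi> n t h k))) / (c\<^sup>2 * S * Lam \<psi> n t h)"
    unfolding Psi_hat_def ch by simp
  also have "\<dots> = ((\<Sum>k=1..n. lam \<psi> n t h k * y k) - (S - 1) * (\<Sum>k=1..n. lam \<psi> n t h k)) / (sqrt 2 * Lam \<psi> n t h) / S"
    using c by simp
  also have "\<dots> = lin_stat \<psi> n y t h / S - (S - 1) * (\<Sum>k=1..n. lam \<psi> n t h k) / (sqrt 2 * Lam \<psi> n t h) / S"
    unfolding lin_stat_def by (simp only: diff_divide_distrib)
  finally show ?thesis .
qed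

text \<open>The exact error of studentization is \<open>(S - 1)(T + R)/S\<close> with \<open>R = (\<Sum>\<^sub>k \<lambda>\<^sub>k)/(\<surd>2 \<Lambda>)\<close>. Both \<open>T\<close> and
  \<open>R\<close> are of order at most \<open>\<surd>n\<close>, which \<open>S - 1\<close> compensates.\<close>

lemma Psi_hat_le:
  assumes n: "n \<ge> 1" and c: "c > 0" and th: "(t, h) \<in> loc_scales n min_scale"
    and z: "\<And>k. k \<in> {1..n} \<Longrightarrow> real n * (z k - z (k - 1))\<^sup>2 = c\<^sup>2 * (1 + y k)"
    and A: "\<bar>\<Sum>k=1..n. y k\<bar> \<le> A * sqrt (real n)"
    and s0: "0 < s0" "s0 \<le> 1 + (\<Sum>k=1..n. y k) / real n"
    and M: "0 \<le> M" "\<bar>lin_stat \<psi> n y t h\<bar> \<le> G n (2 * ln (1 / Lam \<psi> n t h)) (Lam \<psi> n t h) + M"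
  shows "\<bar>Psi_hat \<psi> n t h (c_hat_sq n z) z\<bar> - G n (2 * ln (1 / Lam \<psi> n t h)) (Lam \<psi> n t h)
    \<le> M + (7 + M) * A / s0"
proof -
  define S where "S = 1 + (\<Sum>k=1..n. y k) / real n"
  define g where "g = G n (2 * ln (1 / Lam \<psi> n t h)) (Lam \<psi> n t h)"
  define T where "T = lin_stat \<psi> n y t h"
  define R where "R = (\<Sum>k=1..n. lam \<psi> n t h k) / (sqrt 2 * Lam \<psi> n t h)"
  note b = Lam_bounds[OF n th]
  have n0: "0 < sqrt (real n)" "1 \<le> sqrt (real n)" using n by auto
  have S: "s0 \<le> S" "0 < S" unfolding S_def using s0 by auto
  have A0: "0 \<le> A" using A n0 by (metis abs_ge_zero mult_nonneg_nonneg order_trans zero_le_mult_iff not_le)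
  have dev: "sqrt (real n) * \<bar>S - 1\<bar> \<le> A"
  proof -
    have "sqrt (real n) * \<bar>S - 1\<bar> = \<bar>\<Sum>k=1..n. y k\<bar> / sqrt (real n)"
      unfolding S_def using n0 by (simp add: abs_divide field_simps)
    also have "\<dots> \<le> A * sqrt (real n) / sqrt (real n)" using A n0 by (intro divide_right_mono) auto
    finally show ?thesis using n0 by simp
  qed
  have g: "g \<le> 6 * sqrt (real n)" unfolding g_def using G_upper_bound(2) b by auto
  have Tn: "\<bar>T\<bar> \<le> (6 + M) * sqrt (real n)"
  proof -
    have "M * 1 \<le> M * sqrt (real n)" using M n0 by (intro mult_left_mono) auto
    then show ?thesis using g M(2) unfolding T_def g_def by (simp add: algebra_simps)
  qed
  have R: "\<bar>R\<bar> \<le> sqrt (real n)"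
  proof -
    have R0: "0 \<le> R" unfolding R_def using lam_nonneg b by (intro divide_nonneg_nonneg sum_nonneg) auto
    have "Lam \<psi> n t h \<le> sqrt 2 * Lam \<psi> n t h" using b by (simp add: mult_le_cancel_right1)
    then have "sqrt (real n) * Lam \<psi> n t h \<le> sqrt (real n) * (sqrt 2 * Lam \<psi> n t h)"
      using n0 by (intro mult_left_mono) auto
    then have "(\<Sum>k=1..n. lam \<psi> n t h k) \<le> sqrt (real n) * (sqrt 2 * Lam \<psi> n t h)"
      using sum_lam_le[of n t h] by linarith
    then have "R \<le> sqrt (real n)" unfolding R_def using b by (simp add: divide_le_eq)
    then show ?thesis using R0 by simp
  qed
  have "Psi_hat \<psi> n t h (c_hat_sq n z) z = T / S - (S - 1) * R / S"
    using Psi_hat_studentized[OF n c z S_def S(2) b(2)] unfolding T_def R_def by simp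
  also have "\<dots> = T - (S - 1) * (T + R) / S" using S by (simp add: field_simps)
  also have "\<bar>\<dots>\<bar> \<le> \<bar>T\<bar> + \<bar>S - 1\<bar> * (\<bar>T\<bar> + \<bar>R\<bar>) / S"
  proof -
    have "\<bar>(S - 1) * (T + R) / S\<bar> = \<bar>S - 1\<bar> * \<bar>T + R\<bar> / S" using S by (simp add: abs_mult)
    also have "\<dots> \<le> \<bar>S - 1\<bar> * (\<bar>T\<bar> + \<bar>R\<bar>) / S"
      using S by (intro divide_right_mono mult_left_mono) auto
    finally show ?thesis by (rule order_trans[OF abs_triangle_ineq4 add_left_mono])
  qed
  also have "\<bar>S - 1\<bar> * (\<bar>T\<bar> + \<bar>R\<bar>) / S \<le> (7 + M) * A / s0"
  proof (rule frac_le)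
    have "\<bar>S - 1\<bar> * (\<bar>T\<bar> + \<bar>R\<bar>) \<le> \<bar>S - 1\<bar> * ((7 + M) * sqrt (real n))"
      using Tn R by (intro mult_left_mono) (auto simp: algebra_simps)
    also have "\<dots> = (7 + M) * (sqrt (real n) * \<bar>S - 1\<bar>)" by simp
    also have "\<dots> \<le> (7 + M) * A" using dev M by (intro mult_left_mono) auto
    finally show "\<bar>S - 1\<bar> * (\<bar>T\<bar> + \<bar>R\<bar>) \<le> (7 + M) * A" .
  qed (use S s0 M A0 in auto)
  finally show ?thesis using M(2) unfolding T_def g_def by linarith
qed

text \<open>At scales bounded away from zero the calibration term is bounded, so the supremum is bounded below by
  a constant.\<close>

lemma large_scale_exists:
  assumes n: "n \<ge> 1" and ne: "loc_scales n min_scale \<noteq> {}"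
  obtains t h where "(t, h) \<in> loc_scales n min_scale"
    "G n (2 * ln (1 / Lam \<psi> n t h)) (Lam \<psi> n t h) \<le> 3 * ln (32 / core_radius) + 2"
proof -
  define h where "h = max (min_scale / real n) (1 / 4)"
  obtain t' h' where "min_scale / real n \<le> h'" "h' < 1 / 2" using ne unfolding loc_scales_def by auto
  then have "min_scale / real n < 1 / 2" by (rule le_less_trans)
  then have th: "(1 / 2, h) \<in> loc_scales n min_scale" unfolding loc_scales_def h_def by auto
  note b = Lam_bounds[OF n th]
  let ?\<Lambda> = "Lam \<psi> n (1 / 2) h"
  have "core_radius / 32 \<le> core_radius * h / 8" using core_radius_pos unfolding h_def by (simp add: max_def)
  also have "\<dots> \<le> ?\<Lambda>\<^sup>2" by (rule Lam_squared_ge(1)[OF n th])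
  finally have "core_radius / 32 \<le> ?\<Lambda>\<^sup>2" .
  then have "ln (core_radius / 32) \<le> ln (?\<Lambda>\<^sup>2)" using core_radius_pos b by (subst ln_le_cancel_iff) auto
  also have "ln (?\<Lambda>\<^sup>2) = 2 * ln ?\<Lambda>" using b by (simp add: ln_realpow)
  finally have "2 * ln (1 / ?\<Lambda>) \<le> ln (32 / core_radius)" using b core_radius_pos by (simp add: ln_div)
  then have "G n (2 * ln (1 / ?\<Lambda>)) ?\<Lambda> \<le> 3 * ln (32 / core_radius) + 2"
    using G_upper_bound(1)[OF b(2,3,4)] by linarith
  with th show thesis by (rule that)
qed

end

text \<open>For large \<open>n\<close> the mean is near one. For the remaining \<open>n\<close>, at most \<open>4A\<^sup>2\<close>, the first summand
  alone keeps it away from zero.\<close>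

lemma mean_square_lower_bound:
  fixes y :: "nat \<Rightarrow> real"
  assumes n: "n \<ge> 1" and ge: "\<And>k. - 1 \<le> y k" and y1: "s - 1 \<le> y 1" and s: "0 \<le> s"
    and A: "0 < A" "\<bar>\<Sum>k=1..n. y k\<bar> \<le> A * sqrt (real n)"
  shows "min (1 / 2) (s / (4 * A\<^sup>2)) \<le> 1 + (\<Sum>k=1..n. y k) / real n"
proof (cases "2 * A \<le> sqrt (real n)")
  case True
  have n0: "0 < sqrt (real n)" using n by simp
  have "\<bar>\<Sum>k=1..n. y k\<bar> * 2 \<le> 2 * A * sqrt (real n)" using A by simp
  also have "\<dots> \<le> sqrt (real n) * sqrt (real n)" using True n0 by (intro mult_right_mono) auto
  finally have "\<bar>\<Sum>k=1..n. y k\<bar> / real n \<le> 1 / 2" using n by (simp add: divide_le_eq)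
  moreover have "(- \<bar>\<Sum>k=1..n. y k\<bar>) / real n \<le> (\<Sum>k=1..n. y k) / real n"
    by (rule divide_right_mono) auto
  ultimately have "1 / 2 \<le> 1 + (\<Sum>k=1..n. y k) / real n" by simp
  then show ?thesis by (rule min.coboundedI1)
next
  case False
  have "(sqrt (real n))\<^sup>2 \<le> (2 * A)\<^sup>2" using False by (intro power_mono) auto
  then have n4: "real n \<le> 4 * A\<^sup>2" by (simp add: power_mult_distrib)
  have "s \<le> (\<Sum>k\<in>{1}. 1 + y k)" using y1 by simp
  also have "\<dots> \<le> (\<Sum>k=1..n. 1 + y k)"
  proof (rule sum_mono2)
    fix k show "0 \<le> 1 + y k" using ge[of k] by simp
  qed (use n in auto)
  also have "\<dots> = real n * (1 + (\<Sum>k=1..n. y k) / real n)" using n by (simp add: sum.distrib field_simps)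
  finally have "s / real n \<le> real n * (1 + (\<Sum>k=1..n. y k) / real n) / real n" by (rule divide_right_mono) simp
  then have "s / real n \<le> 1 + (\<Sum>k=1..n. y k) / real n"
    using n by (subst (asm) nonzero_mult_div_cancel_left) auto
  moreover have "s / (4 * A\<^sup>2) \<le> s / real n" using n4 s n A by (intro divide_left_mono) auto
  ultimately show ?thesis by (intro min.coboundedI2) linarith
qed

section \<open>Measurability of the supremum\<close>

text \<open>The part of \<open>S\<close> on which \<open>g\<close> is at most the supremum over \<open>T\<close> is closed in \<open>S\<close> and contains \<open>T\<close>.\<close>

lemma SUP_ereal_dense_subset:
  fixes g :: "'a::topological_space \<Rightarrow> real"
  assumes cont: "continuous_on S g" and T: "T \<subseteq> S" "S \<subseteq> closure T"
  shows "(SUP x\<in>S. ereal (g x)) = (SUP x\<in>T. ereal (g x))"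
proof (rule antisym)
  show "(SUP x\<in>T. ereal (g x)) \<le> (SUP x\<in>S. ereal (g x))" by (rule SUP_subset_mono) (use T in auto)
  let ?B = "SUP x\<in>T. ereal (g x)"
  have "closedin (top_of_set S) (S \<inter> (\<lambda>x. ereal (g x)) -` {..?B})"
    by (rule continuous_closedin_preimage) (auto intro!: continuous_on_ereal cont)
  then obtain C where C: "closed C" "S \<inter> (\<lambda>x. ereal (g x)) -` {..?B} = S \<inter> C"
    by (auto simp: closedin_closed)
  have "T \<subseteq> C"
  proof
    fix x assume x: "x \<in> T"
    then have "x \<in> S \<inter> (\<lambda>x. ereal (g x)) -` {..?B}" using T by (auto intro: SUP_upper)
    then show "x \<in> C" unfolding C(2) by simp
  qed
  then have "S \<subseteq> C" using closure_minimal[OF _ C(1)] T(2) by blast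
  then show "(SUP x\<in>S. ereal (g x)) \<le> ?B" using C(2) by (intro SUP_least) blast
qed

context kernel
begin

lemma continuous_lam:
  assumes S: "\<And>p. p \<in> S \<Longrightarrow> 0 < snd p"
  shows "continuous_on S (\<lambda>p. lam \<psi> n (fst p) (snd p) k)"
proof -
  have "continuous_on (S \<times> cbox ((real k - 1) / real n) (real k / real n))
     (\<lambda>(p, s). scaled_kernel \<psi> (fst p) (snd p) s)"
    unfolding scaled_kernel_def split_beta
    by (rule continuous_on_compose2[OF continuous[of UNIV]])
       (use S in \<open>force intro!: continuous_intros\<close>)+
  from integral_continuous_on_param[OF this] show ?thesis
    unfolding lam_eq_integral by (intro continuous_intros) (simp add: cbox_interval)
qed

lemma continuous_calibrated_statistic:
  assumes n: "n \<ge> 1"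
  shows "continuous_on (loc_scales n min_scale)
     (\<lambda>p. \<bar>Psi_hat \<psi> n (fst p) (snd p) v z\<bar> - G n (2 * ln (1 / Lam \<psi> n (fst p) (snd p))) (Lam \<psi> n (fst p) (snd p)))"
proof -
  let ?S = "loc_scales n min_scale"
  have b: "0 < snd p" "0 < Lam \<psi> n (fst p) (snd p)" if "p \<in> ?S" for p
    using Lam_bounds(1,2)[OF n, of "fst p" "snd p"] that by auto
  have cl: "continuous_on ?S (\<lambda>p. lam \<psi> n (fst p) (snd p) k)" for k
    by (rule continuous_lam) (rule b)
  have cL: "continuous_on ?S (\<lambda>p. Lam \<psi> n (fst p) (snd p))"
    unfolding Lam_def by (intro continuous_intros cl)
  have cP: "continuous_on ?S (\<lambda>p. Psi_hat \<psi> n (fst p) (snd p) v z)"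
  proof (cases "v = 0")
    case True then show ?thesis unfolding Psi_hat_def by simp
  next
    case False
    then show ?thesis unfolding Psi_hat_def
      using b(2) by (intro continuous_intros cl cL) force
  qed
  show ?thesis unfolding G_def
    by (intro continuous_intros cP cL) (use b(2) in \<open>fastforce+\<close>)
qed

end

lemma observation_measurable:
  assumes proc: "constant_volatility_process M c z0 Z" and k: "k \<le> n"
  shows "(\<lambda>\<omega>. observations Z n \<omega> k) \<in> borel_measurable M"
proof -
  obtain W where W: "standard_brownian_motion M W"
    and Z: "\<And>t \<omega>. t \<in> {0..1} \<Longrightarrow> \<omega> \<in> space M \<Longrightarrow> Z t \<omega> = z0 + c * W t \<omega>"
    using proc unfolding constant_volatility_process_def by blast
  interpret standard_brownian_motion M W by fact
  have t: "real k / real n \<in> {0..1}" using k by (auto simp: divide_le_eq)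
  have "(\<lambda>\<omega>. z0 + c * W (real k / real n) \<omega>) \<in> borel_measurable M"
    using measurable_W[OF t] by simp
  then show ?thesis unfolding observations_def using Z[OF t] by (simp cong: measurable_cong)
qed

context kernel
begin

lemma calibrated_sup_measurable:
  assumes proc: "constant_volatility_process M c z0 Z" and n: "n \<ge> 1"
  shows "(\<lambda>\<omega>. calibrated_sup \<psi> min_scale n (observations Z n \<omega>)) \<in> borel_measurable M"
proof -
  let ?S = "loc_scales n min_scale"
  define g where "g = (\<lambda>z p. \<bar>Psi_hat \<psi> n (fst p) (snd p) (c_hat_sq n z) z\<bar>
      - G n (2 * ln (1 / Lam \<psi> n (fst p) (snd p))) (Lam \<psi> n (fst p) (snd p)))"
  obtain T where T: "countable T" "T \<subseteq> ?S" "?S \<subseteq> closure T" by (rule separable)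
  have eq: "calibrated_sup \<psi> min_scale n z = (SUP p\<in>T. ereal (g z p))" for z
  proof -
    have "calibrated_sup \<psi> min_scale n z = (SUP p\<in>?S. ereal (g z p))"
      unfolding calibrated_sup_def g_def by (simp add: split_beta)
    also have "\<dots> = (SUP p\<in>T. ereal (g z p))"
      by (rule SUP_ereal_dense_subset[OF _ T(2,3)])
         (unfold g_def, rule continuous_calibrated_statistic[OF n])
    finally show ?thesis .
  qed
  have [measurable]: "(\<lambda>\<omega>. observations Z n \<omega> k) \<in> borel_measurable M" if "k \<in> {1..n}" for k
    by (rule observation_measurable[OF proc]) (use that in auto)
  have [measurable]: "(\<lambda>\<omega>. observations Z n \<omega> (k - 1)) \<in> borel_measurable M" if "k \<in> {1..n}" for k
    by (rule observation_measurable[OF proc]) (use that in auto)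
  have "(\<lambda>\<omega>. g (observations Z n \<omega>) p) \<in> borel_measurable M" for p
    unfolding g_def Psi_hat_def c_hat_sq_def by measurable
  then show ?thesis unfolding eq using T(1) by measurable
qed

end

section \<open>Tightness\<close>

text \<open>The normalized squared increments of the observed process, minus one. The bound
  from below and the small ball estimate serve to keep the volatility estimator away from zero.\<close>

lemma brownian_chi_square_noise:
  assumes proc: "constant_volatility_process M c z0 Z" and n: "n \<ge> 1"
  obtains y where "subgamma_noise M n y"
    "\<And>\<omega> k. \<omega> \<in> space M \<Longrightarrow> k \<in> {1..n} \<Longrightarrow>
       real n * (observations Z n \<omega> k - observations Z n \<omega> (k - 1))\<^sup>2 = c\<^sup>2 * (1 + y k \<omega>)"
    "\<And>k \<omega>. - 1 \<le> y k \<omega>"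
    "\<And>s. 0 \<le> s \<Longrightarrow> measure M {\<omega>\<in>space M. y 1 \<omega> < s - 1} \<le> 2 * sqrt s"
proof -
  obtain W where W: "standard_brownian_motion M W"
    and Z: "\<And>t \<omega>. t \<in> {0..1} \<Longrightarrow> \<omega> \<in> space M \<Longrightarrow> Z t \<omega> = z0 + c * W t \<omega>"
    using proc unfolding constant_volatility_process_def by blast
  interpret standard_brownian_motion M W by fact
  define \<sigma> where "\<sigma> = sqrt (1 / real n)"
  have \<sigma>: "0 < \<sigma>" "\<sigma>\<^sup>2 = 1 / real n" unfolding \<sigma>_def using n by auto
  define X where "X = (\<lambda>k \<omega>. W (real k / real n) \<omega> - W (real (k - 1) / real n) \<omega>)"
  define y where "y = (\<lambda>k \<omega>. (X k \<omega> / \<sigma>)\<^sup>2 - 1)"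
  have dist: "distributed M lborel (X k) (normal_density 0 \<sigma>)" if k: "k \<in> {1..n}" for k
  proof -
    have "real k / real n - real (k - 1) / real n = 1 / real n"
      using k by (simp add: diff_divide_distrib[symmetric] of_nat_diff)
    moreover have "distributed M lborel (X k) (normal_density 0 (sqrt (real k / real n - real (k - 1) / real n)))"
      unfolding X_def by (rule normal_increments) (use k n in \<open>auto simp: divide_strict_right_mono\<close>)
    ultimately show ?thesis unfolding \<sigma>_def by simp
  qed
  \<comment> \<open>duplicating the starting time shifts the index of the increments by one\<close>
  have "indep_vars (\<lambda>_. borel) (\<lambda>i \<omega>. W (real (Suc i - 1) / real n) \<omega> - W (real (i - 1) / real n) \<omega>) {..<Suc n}"
    by (rule indep_increments) (use n in \<open>auto simp: divide_le_eq intro!: divide_right_mono\<close>)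
  then have "indep_vars (\<lambda>_. borel) X {..<Suc n}" unfolding X_def by simp
  then have "indep_vars (\<lambda>_. borel) X {1..n}" by (rule indep_vars_subset) auto
  then have indep: "indep_vars (\<lambda>_. borel) y {1..n}"
    unfolding y_def by (rule indep_vars_compose2[where Y = "\<lambda>_ u. (u / \<sigma>)\<^sup>2 - 1"]) auto
  show thesis
  proof (rule that[of y])
    show "subgamma_noise M n y"
    proof
      fix k \<theta> assume "k \<in> {1..n}" "2 * \<bar>\<theta>\<bar> < (1::real)"
      then show "integrable M (\<lambda>\<omega>. exp (\<theta> * y k \<omega>))" "expectation (\<lambda>\<omega>. exp (\<theta> * y k \<omega>)) \<le> exp (\<theta>\<^sup>2 / (1 - 2 * \<bar>\<theta>\<bar>))"
        unfolding y_def using chi_square_exponential_moment[OF dist \<sigma>(1)] by auto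
    qed (use n indep in auto)
    show "- 1 \<le> y k \<omega>" for k \<omega> unfolding y_def by simp
    show "prob {\<omega>\<in>space M. y 1 \<omega> < s - 1} \<le> 2 * sqrt s" if "0 \<le> s" for s
      unfolding y_def using normal_small_ball[OF dist \<sigma>(1) that, of 1] n by simp
    fix \<omega> k assume \<omega>: "\<omega> \<in> space M" and k: "k \<in> {1..n}"
    have "real k / real n \<in> {0..1}" "real (k - 1) / real n \<in> {0..1}" using k by (auto simp: divide_le_eq)
    then have "observations Z n \<omega> k - observations Z n \<omega> (k - 1) = c * X k \<omega>"
      unfolding observations_def X_def using Z \<omega> by (simp add: right_diff_distrib)
    then show "real n * (observations Z n \<omega> k - observations Z n \<omega> (k - 1))\<^sup>2 = c\<^sup>2 * (1 + y k \<omega>)"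
      unfolding y_def power_divide \<sigma>(2) by (simp add: power_mult_distrib)
  qed
qed

context kernel
begin

text \<open>The three exceptional events concern the walk, the net, and the first increment. Each has probability at
  most \<open>\<epsilon>/3\<close> for suitable \<open>C\<close>, \<open>m\<close> and \<open>s\<close>, chosen from \<open>\<epsilon>\<close> and the kernel alone.\<close>

lemma calibrated_sup_tight:
  assumes proc: "constant_volatility_process M c z0 Z" and c: "c > 0"
  shows "tight_family M {n. n \<ge> 1 \<and> loc_scales n min_scale \<noteq> {}}
    (\<lambda>n \<omega>. calibrated_sup \<psi> min_scale n (observations Z n \<omega>))"
  unfolding tight_family_def
proof (intro conjI ballI allI impI)
  fix n assume "n \<in> {n. n \<ge> 1 \<and> loc_scales n min_scale \<noteq> {}}"
  then show "(\<lambda>\<omega>. calibrated_sup \<psi> min_scale n (observations Z n \<omega>)) \<in> borel_measurable M"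
    using calibrated_sup_measurable[OF proc] by simp
next
  fix \<epsilon> :: real assume \<epsilon>: "0 < \<epsilon>"
  define A0 where "A0 = 16 * exp 2 * (\<Sum>j. exp (- 2 * sqrt (real j)))"
  define C where "C = max 2 (6 / \<epsilon>)"
  define m where "m = max 4 (3 * A0 / \<epsilon>)"
  define s where "s = (\<epsilon> / 6)\<^sup>2"
  define M1 where "M1 = 2 * m + 6 * m\<^sup>2"
  define s0 where "s0 = min (1 / 2) (s / (4 * (8 * C)\<^sup>2))"
  have A0: "0 \<le> A0" unfolding A0_def by (intro mult_nonneg_nonneg suminf_nonneg summable_exp_neg_sqrt) auto
  have C2: "2 \<le> C" and m4: "4 \<le> m" and s: "0 < s" unfolding C_def m_def s_def using \<epsilon> by auto
  have M1: "0 \<le> M1" unfolding M1_def using m4 by simp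
  have s0: "0 < s0" unfolding s0_def using s C2 by simp
  obtain D where D0: "0 \<le> D" and D: "\<And>n y C M t h t' h' j. \<lbrakk>n \<ge> 1; 0 \<le> C; 0 \<le> M; (t, h) \<in> loc_scales n min_scale; (t', h') \<in> loc_scales n min_scale;
       1 \<le> j; 1 / 2 ^ (j + 1) \<le> h; h \<le> 1 / 2 ^ j; 1 / 2 ^ (j + 1) \<le> h'; h' \<le> 1 / 2 ^ j;
       \<bar>t - t'\<bar> \<le> mesh j; \<bar>h - h'\<bar> \<le> mesh j;
       \<And>s s' L. \<lbrakk>s \<in> {0..1}; s' \<in> {0..1}; \<bar>s - s'\<bar> \<le> 1 / 2 ^ L\<rbrakk> \<Longrightarrow>
         \<bar>walk n y s - walk n y s'\<bar> \<le> 12 * (4 * C * sqrt (real n)) * (real L + 10) * sqrt (1 / 2) ^ L;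
       \<bar>lin_stat \<psi> n y t' h'\<bar> \<le> G n (2 * ln (1 / Lam \<psi> n t' h')) (Lam \<psi> n t' h') + M\<rbrakk>
     \<Longrightarrow> \<bar>lin_stat \<psi> n y t h\<bar> \<le> G n (2 * ln (1 / Lam \<psi> n t h)) (Lam \<psi> n t h) + D * (1 + C + M)"
    by (rule net_comparison) blast
  define M2 where "M2 = D * (1 + C + M1)"
  have M2: "0 \<le> M2" unfolding M2_def using D0 C2 M1 by simp
  define B where "B = max (M2 + (7 + M2) * (8 * C) / s0) (3 * ln (32 / core_radius) + 2)"
  have B1: "M2 + (7 + M2) * (8 * C) / s0 \<le> B" unfolding B_def by simp
  have inv_exp: "exp (- x) \<le> 1 / x" if "0 < x" for x :: real
  proof -
    have "x \<le> exp x" using exp_ge_add_one_self[of x] by linarith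
    then have "inverse (exp x) \<le> inverse x" using that by (intro le_imp_inverse_le) auto
    then show ?thesis by (simp add: exp_minus inverse_eq_divide)
  qed
  have "measure M {\<omega>\<in>space M. \<bar>calibrated_sup \<psi> min_scale n (observations Z n \<omega>)\<bar> > ereal B} \<le> \<epsilon>"
    if n: "n \<in> {n. n \<ge> 1 \<and> loc_scales n min_scale \<noteq> {}}" for n
  proof -
    have n1: "n \<ge> 1" and ne: "loc_scales n min_scale \<noteq> {}" using n by auto
    obtain y where noise: "subgamma_noise M n y"
      and inc: "\<And>\<omega> k. \<omega> \<in> space M \<Longrightarrow> k \<in> {1..n} \<Longrightarrow>
        real n * (observations Z n \<omega> k - observations Z n \<omega> (k - 1))\<^sup>2 = c\<^sup>2 * (1 + y k \<omega>)"
      and y_ge: "\<And>k \<omega>. - 1 \<le> y k \<omega>"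
      and small_ball: "\<And>s. 0 \<le> s \<Longrightarrow> measure M {\<omega>\<in>space M. y 1 \<omega> < s - 1} \<le> 2 * sqrt s"
      using brownian_chi_square_noise[OF proc n1] by blast
    interpret kernel_noise \<psi> \<beta> V M n y by (intro kernel_noise.intro kernel_axioms noise)
    let ?X = "\<lambda>\<omega>. calibrated_sup \<psi> min_scale n (observations Z n \<omega>)"
    let ?E = "{\<omega>\<in>space M. y 1 \<omega> < s - 1}"
    have E: "?E \<in> events"
    proof -
      have "y 1 \<in> borel_measurable M" using noise_measurable[of 1] n1 by simp
      then show ?thesis by measurable
    qed
    have bounded: "\<bar>?X \<omega>\<bar> \<le> ereal B" if \<omega>: "\<omega> \<in> space M" "\<omega> \<notin> rough_walk C" "\<omega> \<notin> net_exceedance m" "\<omega> \<notin> ?E" for \<omega>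
    proof (rule ereal_abs_leI)
      let ?y = "\<lambda>k. y k \<omega>"
      have total: "\<bar>\<Sum>k=1..n. ?y k\<bar> \<le> 8 * C * sqrt (real n)" by (rule smooth_walk_total) (use \<omega> in auto)
      have S: "s0 \<le> 1 + (\<Sum>k=1..n. ?y k) / real n" unfolding s0_def
        by (rule mean_square_lower_bound[OF n1 y_ge _ _ _ total]) (use \<omega> s C2 in auto)
      have stat: "\<bar>lin_stat \<psi> n ?y t h\<bar> \<le> G n (2 * ln (1 / Lam \<psi> n t h)) (Lam \<psi> n t h) + M2"
        if th: "(t, h) \<in> loc_scales n min_scale" for t h
      proof -
        have "\<omega> \<in> space M - net_exceedance m" using \<omega> by simp
        then obtain j t' h' where *: "1 \<le> j" "1 / 2 ^ (j + 1) \<le> h" "h \<le> 1 / 2 ^ j" "1 / 2 ^ (j + 1) \<le> h'" "h' \<le> 1 / 2 ^ j"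
          "\<bar>t - t'\<bar> \<le> mesh j" "\<bar>h - h'\<bar> \<le> mesh j" "(t', h') \<in> loc_scales n min_scale"
          "\<bar>lin_stat \<psi> n ?y t' h'\<bar> \<le> G n (2 * ln (1 / Lam \<psi> n t' h')) (Lam \<psi> n t' h') + M1"
          unfolding M1_def by (rule nearby_net_point[OF _ th])
        show ?thesis unfolding M2_def
        proof (rule D[OF n1 _ M1 th *(8,1,2,3,4,5,6,7) _ *(9)])
          show "0 \<le> C" using C2 by simp
          fix u u' :: real and L :: nat
          assume "u \<in> {0..1}" "u' \<in> {0..1}" "\<bar>u - u'\<bar> \<le> 1 / 2 ^ L"
          then show "\<bar>walk n ?y u - walk n ?y u'\<bar> \<le> 12 * (4 * C * sqrt (real n)) * (real L + 10) * sqrt (1 / 2) ^ L"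
            by (intro smooth_walk) (use \<omega> C2 in auto)
        qed
      qed
      show "?X \<omega> \<le> ereal B"
        unfolding calibrated_sup_def
      proof (rule SUP_least)
        fix p assume p: "p \<in> loc_scales n min_scale"
        obtain t h where th: "p = (t, h)" by fastforce
        have "\<bar>Psi_hat \<psi> n t h (c_hat_sq n (observations Z n \<omega>)) (observations Z n \<omega>)\<bar>
            - G n (2 * ln (1 / Lam \<psi> n t h)) (Lam \<psi> n t h) \<le> M2 + (7 + M2) * (8 * C) / s0"
          by (rule Psi_hat_le[OF n1 c p[unfolded th] inc[OF \<omega>(1)] total s0 S M2 stat[OF p[unfolded th]]])
        then show "(case p of (t, h) \<Rightarrow> ereal (\<bar>Psi_hat \<psi> n t h (c_hat_sq n (observations Z n \<omega>)) (observations Z n \<omega>)\<bar>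
            - G n (2 * ln (1 / Lam \<psi> n t h)) (Lam \<psi> n t h))) \<le> ereal B"
          using B1 unfolding th by simp
      qed
      obtain t h where th: "(t, h) \<in> loc_scales n min_scale"
        "G n (2 * ln (1 / Lam \<psi> n t h)) (Lam \<psi> n t h) \<le> 3 * ln (32 / core_radius) + 2"
        by (rule large_scale_exists[OF n1 ne])
      have "ereal (- B) \<le> ereal (\<bar>Psi_hat \<psi> n t h (c_hat_sq n (observations Z n \<omega>)) (observations Z n \<omega>)\<bar>
            - G n (2 * ln (1 / Lam \<psi> n t h)) (Lam \<psi> n t h))"
        using th(2) unfolding B_def by simp
      also have "\<dots> \<le> ?X \<omega>" unfolding calibrated_sup_def by (rule SUP_upper2[OF th(1)]) simp
      finally show "- ?X \<omega> \<le> ereal B" by (simp add: ereal_uminus_le_reorder)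
    qed
    have "prob {\<omega>\<in>space M. \<bar>?X \<omega>\<bar> > ereal B} \<le> prob (rough_walk C \<union> net_exceedance m \<union> ?E)"
    proof (rule finite_measure_mono)
      show "{\<omega>\<in>space M. \<bar>?X \<omega>\<bar> > ereal B} \<subseteq> rough_walk C \<union> net_exceedance m \<union> ?E"
      proof
        fix \<omega> assume \<omega>: "\<omega> \<in> {\<omega>\<in>space M. \<bar>?X \<omega>\<bar> > ereal B}"
        then have "\<not> \<bar>?X \<omega>\<bar> \<le> ereal B" by (simp only: mem_Collect_eq not_le)
        then show "\<omega> \<in> rough_walk C \<union> net_exceedance m \<union> ?E" using bounded[of \<omega>] \<omega> by blast
      qed
      show "rough_walk C \<union> net_exceedance m \<union> ?E \<in> events"
        by (intro sets.Un rough_walk_prob(1)[OF C2] net_exceedance_prob(1)[OF m4] E)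
    qed
    also have "\<dots> \<le> prob (rough_walk C) + prob (net_exceedance m) + prob ?E"
      using measure_Un_le[of "rough_walk C" M "net_exceedance m"] measure_Un_le[of "rough_walk C \<union> net_exceedance m" M ?E]
        E rough_walk_prob(1)[OF C2] net_exceedance_prob(1)[OF m4] by simp
    also have "prob (rough_walk C) \<le> \<epsilon> / 3"
    proof -
      have "prob (rough_walk C) \<le> 4 * exp (- 2 * C)" by (rule rough_walk_prob(2)[OF C2])
      also have "\<dots> \<le> 4 * (1 / (2 * C))" using inv_exp[of "2 * C"] C2 by simp
      also have "\<dots> \<le> \<epsilon> / 3"
      proof -
        have "6 / \<epsilon> \<le> C" unfolding C_def by simp
        then show ?thesis using \<epsilon> C2 by (simp add: field_simps)
      qed
      finally show ?thesis .
    qed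
    also have "prob (net_exceedance m) \<le> \<epsilon> / 3"
    proof -
      have "prob (net_exceedance m) \<le> A0 * exp (m - m\<^sup>2)"
        using net_exceedance_prob(2)[OF m4] unfolding A0_def by (simp add: mult_ac)
      also have "\<dots> \<le> A0 * (1 / m)"
      proof (rule mult_left_mono[OF _ A0])
        have "2 * m \<le> m * m" using m4 by (intro mult_right_mono) auto
        then have "exp (m - m\<^sup>2) \<le> exp (- m)" by (simp add: power2_eq_square)
        also have "\<dots> \<le> 1 / m" using inv_exp[of m] m4 by simp
        finally show "exp (m - m\<^sup>2) \<le> 1 / m" .
      qed
      also have "\<dots> \<le> \<epsilon> / 3"
      proof -
        have "3 * A0 / \<epsilon> \<le> m" unfolding m_def by simp
        then show ?thesis using \<epsilon> m4 by (simp add: field_simps)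
      qed
      finally show ?thesis .
    qed
    also have "prob ?E \<le> \<epsilon> / 3"
      using small_ball[of s] s \<epsilon> unfolding s_def by simp
    finally show ?thesis by simp
  qed
  then show "\<exists>C. \<forall>n\<in>{n. n \<ge> 1 \<and> loc_scales n min_scale \<noteq> {}}.
      measure M {\<omega>\<in>space M. \<bar>calibrated_sup \<psi> min_scale n (observations Z n \<omega>)\<bar> > ereal C} \<le> \<epsilon>" by blast
qed

end

theorem theorem2p1:
  fixes \<psi> :: "real \<Rightarrow> real"
  assumes "\<And>x. 0 \<le> \<psi> x"
    and "\<psi> 0 = 1"
    and "\<And>x. x \<noteq> 0 \<Longrightarrow> \<psi> x \<le> 1"
    and "closure {x. \<psi> x \<noteq> 0} \<subseteq> {-1..1}"
    and "bounded_variation \<psi>"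
    and "hoelder_constant_one \<psi>"
  shows "\<exists>K>0.
    (\<forall>n\<ge>1. \<forall>(t, h)\<in>loc_scales n K. (Lam \<psi> n t h)\<^sup>2 \<ge> 1 / real n) \<and>
    (\<forall>c>0. \<forall>z0. \<forall>(M :: 'a measure) Z. constant_volatility_process M c z0 Z \<longrightarrow>
       tight_family M {n. n \<ge> 1 \<and> loc_scales n K \<noteq> {}}
         (\<lambda>n \<omega>. calibrated_sup \<psi> K n (observations Z n \<omega>)))"
proof -
  obtain \<beta> where \<beta>: "0 < \<beta>" "\<And>x y. \<bar>\<psi> x - \<psi> y\<bar> \<le> \<bar>x - y\<bar> powr \<beta>"
    using assms(6) unfolding hoelder_constant_one_def by blast
  obtain V where V: "\<And>m x. (\<forall>i<m. x i \<le> x (Suc i)) \<Longrightarrow> (\<Sum>i<m. \<bar>\<psi> (x (Suc i)) - \<psi> (x i)\<bar>) \<le> V"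
    using assms(5) unfolding bounded_variation_def by blast
  \<comment> \<open>the set where \<open>\<psi>\<close> is nonzero is open, so it avoids the end points \<open>\<plusminus>1\<close> as well\<close>
  have "open {x. \<psi> x \<noteq> 0}"
    by (rule open_Collect_neq[OF hoelder_imp_continuous[OF \<beta>] continuous_on_const])
  then have inner: "{x. \<psi> x \<noteq> 0} \<subseteq> interior {-1..1}"
    by (rule interior_maximal[OF subset_trans[OF closure_subset assms(4)]])
  have supp: "\<psi> x = 0" if "1 \<le> \<bar>x\<bar>" for x
  proof (rule ccontr)
    assume "\<psi> x \<noteq> 0"
    then have "x \<in> interior {-1..1}" using inner by blast
    then show False using that by (auto simp: interior_atLeastAtMost_real)
  qed
  interpret kernel \<psi> \<beta> V
  proof (unfold_locales, fact assms(1), fact assms(2))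
    show "\<psi> x \<le> 1" for x by (cases "x = 0") (simp_all add: assms(2,3))
    show "(\<Sum>i<m. \<bar>\<psi> (p (Suc i)) - \<psi> (p i)\<bar>) \<le> V" if "\<And>i. i < m \<Longrightarrow> p i \<le> p (Suc i)" for m p
      by (rule V) (simp add: that)
  qed (fact supp \<beta>)+
  show ?thesis
  proof (intro exI[of _ min_scale] conjI allI impI ballI)
    show "0 < min_scale" by (rule min_scale_pos)
    fix n :: nat and p assume n: "1 \<le> n" and p: "p \<in> loc_scales n min_scale"
    obtain t h where th: "p = (t, h)" by fastforce
    show "case p of (t, h) \<Rightarrow> 1 / real n \<le> (Lam \<psi> n t h)\<^sup>2"
      using Lam_squared_ge(2)[OF n p[unfolded th]] unfolding th by simp
  next
    fix c z0 :: real and M :: "'a measure" and Z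
    assume "0 < c" "constant_volatility_process M c z0 Z"
    then show "tight_family M {n. n \<ge> 1 \<and> loc_scales n min_scale \<noteq> {}}
         (\<lambda>n \<omega>. calibrated_sup \<psi> min_scale n (observations Z n \<omega>))"
      by (intro calibrated_sup_tight)
  qed
qed

end
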